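(* Consider feasible instances of 2-TSP with Vertex Requisitions (2-TSPVR) with $n\ge2$ vertices and bipartite graph $\bar G$ having $q(\bar G)$ cycles. There is a preprocessing procedure running in time $O(n+q^2(\bar G))$ after which, for any feasible solution $f_\delta$ given by its vector $\delta\in\{0,1\}^{q(\bar G)}$, the Exchange neighborhood of $f_\delta$ can be enumerated (all neighboring vectors $\delta'$ together with their objective values $\rho(f_{\delta'})$) in $O(q^2(\bar G))$ time. Consequently, for almost all feasible instances the Exchange neighborhood can be enumerated, after this preprocessing, in $O(\ln^2 n)$ time; that is, there is a constant $C$ such that the proportion of graphs $\bar G$, among all bipartite graphs corresponding to feasible instances with $n$ vertices, for which this enumeration takes time at most $C\ln^2 n$ (for all arc weights and all $\delta$) tends to $1$ as $n\to\infty$.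
   Context: 2-TSPVR. An instance consists of a set $X=\{x_1,\dots,x_n\}$ of vertices of a complete digraph with non-negative arc weights $\rho(x,y)$, $x\ne y$, and subsets (requisitions) $X^1,\dots,X^n\subseteq X$ with $1\le |X^i|\le 2$ for all $i$. $F$ is the set of bijections $f:\{1,\dots,n\}\to X$ with $f(i)\in X^i$ for all $i$; the instance is feasible if $F\neq\emptyset$. The cost of $f\in F$ is $\rho(f)=\sum_{i=1}^{n-1}\rho(f(i),f(i+1))+\rho(f(n),f(1))$, to be minimized over $F$. Indices are cyclic ($n+1:=1$). Only the arcs that start in $X^i$ and end in $X^{i+1}$ for some $i\in\{1,\dots,n\}$ are given in the input (so the input has size $O(n)$; the weights $\rho(x,y)$ with $x\in X^i$, $y\in X^{i+1}$ are accessible in constant time from $i$). Time is counted with arithmetic operations and comparisons on weights taking unit time (standard unit-cost random access machine). Bipartite graph. Let $X_n=\{1,\dots,n\}$ and let $\bar G=(X_n,X,\bar U)$ be the bipartite graph with edge set $\bar U=\{\{i,x\}: i\in X_n,\ x\in X^i\}$. Feasible solutions $f\in F$ correspond one-to-one to perfect matchings $\{\{i,f(i)\}: i\in X_n\}$ of $\bar G$. An edge is special if it belongs to all perfect matchings of $\bar G$; a vertex is special if it is incident with a special edge. For a feasible instance, let $\bar G'$ be the graph obtained from $\bar G$ by deleting all special vertices; $\bar G'$ is 2-regular, so its components are even cycles, numbered $1,\dots,q(\bar G)$. Each cycle $j$ has exactly two perfect matchings, denoted $w^{0,j}$ and $w^{1,j}$. Each vector $\delta\in\{0,1\}^{q(\bar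 G)}$ determines the feasible solution $f_\delta$ whose perfect matching consists of all special edges and the matchings $w^{\delta_j,j}$, $j=1,\dots,q(\bar G)$; $\delta\mapsto f_\delta$ is a bijection from $\{0,1\}^{q(\bar G)}$ onto $F$. Exchange neighborhood. A solution $f_{\delta'}$ belongs to the Exchange neighborhood of $f_\delta$ if and only if the Hamming distance between $\delta$ and $\delta'$ equals 1. *)

theory Defs
  imports Complex_Main "HOL-Library.FuncSet"
begin

section \<open>Instances\<close>

text \<open>
  The vertices \<open>x\<^sub>1, \<dots>, x\<^sub>n\<close> are identified with their numbers, so \<open>X = {1..n}\<close>. Weights
  \<open>\<rho> x x\<close> carry no information; they are left unconstrained.
\<close>

definition requisitions :: "nat \<Rightarrow> (nat \<Rightarrow> nat set) \<Rightarrow> bool" where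
  "requisitions n Xs \<longleftrightarrow> (\<forall>i\<in>{1..n}. Xs i \<subseteq> {1..n} \<and> 1 \<le> card (Xs i) \<and> card (Xs i) \<le> 2)"

definition weights :: "nat \<Rightarrow> (nat \<Rightarrow> nat \<Rightarrow> real) \<Rightarrow> bool" where
  "weights n \<rho> \<longleftrightarrow> (\<forall>x\<in>{1..n}. \<forall>y\<in>{1..n}. x \<noteq> y \<longrightarrow> 0 \<le> \<rho> x y)"

definition solutions :: "nat \<Rightarrow> (nat \<Rightarrow> nat set) \<Rightarrow> (nat \<Rightarrow> nat) set" where
  "solutions n Xs =
     {f \<in> extensional {1..n}. bij_betw f {1..n} {1..n} \<and> (\<forall>i\<in>{1..n}. f i \<in> Xs i)}"

definition feasible :: "nat \<Rightarrow> (nat \<Rightarrow> nat set) \<Rightarrow> bool" where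
  "feasible n Xs \<longleftrightarrow> requisitions n Xs \<and> solutions n Xs \<noteq> {}"

definition tour_cost :: "nat \<Rightarrow> (nat \<Rightarrow> nat \<Rightarrow> real) \<Rightarrow> (nat \<Rightarrow> nat) \<Rightarrow> real" where
  "tour_cost n \<rho> f = (\<Sum>i=1..n-1. \<rho> (f i) (f (i + 1))) + \<rho> (f n) (f 1)"


section \<open>Graphs, perfect matchings, special edges\<close>

definition perfect_matching :: "'v set \<Rightarrow> 'v set set \<Rightarrow> 'v set set \<Rightarrow> bool" where
  "perfect_matching V E M \<longleftrightarrow> M \<subseteq> E \<and> (\<forall>v\<in>V. \<exists>!e. e \<in> M \<and> v \<in> e)"

definition components :: "'v set \<Rightarrow> 'v set set \<Rightarrow> 'v set set" where
  "components V E =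
     V // {(u, v). u \<in> V \<and> v \<in> V \<and> (u, v) \<in> {(x, y). x \<in> V \<and> y \<in> V \<and> {x, y} \<in> E}\<^sup>*}"

definition special_edges :: "'v set \<Rightarrow> 'v set set \<Rightarrow> 'v set set" where
  "special_edges V E = {e \<in> E. \<forall>M. perfect_matching V E M \<longrightarrow> e \<in> M}"

definition special_vertices :: "'v set \<Rightarrow> 'v set set \<Rightarrow> 'v set" where
  "special_vertices V E = V \<inter> \<Union> (special_edges V E)"

definition reduced_vertices :: "'v set \<Rightarrow> 'v set set \<Rightarrow> 'v set" where
  "reduced_vertices V E = V - special_vertices V E"

definition reduced_edges :: "'v set \<Rightarrow> 'v set set \<Rightarrow> 'v set set" where
  "reduced_edges V E = {e \<in> E. e \<inter> special_vertices V E = {}}"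

definition cycles :: "'v set \<Rightarrow> 'v set set \<Rightarrow> 'v set set" where
  "cycles V E = components (reduced_vertices V E) (reduced_edges V E)"

definition cycle_matchings :: "'v set \<Rightarrow> 'v set set \<Rightarrow> 'v set \<Rightarrow> 'v set set set" where
  "cycle_matchings V E c = {M. perfect_matching c {e \<in> reduced_edges V E. e \<subseteq> c} M}"


section \<open>The bipartite graph of an instance\<close>

text \<open>Positions are tagged \<open>Inl\<close>, elements of \<open>X\<close> are tagged \<open>Inr\<close>.\<close>

definition bip_vertices :: "nat \<Rightarrow> (nat + nat) set" where
  "bip_vertices n = Inl ` {1..n} \<union> Inr ` {1..n}"

definition bip_edges :: "nat \<Rightarrow> (nat \<Rightarrow> nat set) \<Rightarrow> (nat + nat) set set" where
  "bip_edges n Xs = {{Inl i, Inr x} | i x. i \<in> {1..n} \<and> x \<in> Xs i}"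

definition feasible_graphs :: "nat \<Rightarrow> (nat + nat) set set set" where
  "feasible_graphs n = {bip_edges n Xs | Xs. feasible n Xs}"

definition num_cycles :: "nat \<Rightarrow> (nat + nat) set set \<Rightarrow> nat" where
  "num_cycles n E = card (cycles (bip_vertices n) E)"

definition matching_of :: "nat \<Rightarrow> (nat \<Rightarrow> nat) \<Rightarrow> (nat + nat) set set" where
  "matching_of n f = {{Inl i, Inr (f i)} | i. i \<in> {1..n}}"

text \<open>
  \<open>w d j\<close> plays the role of \<open>w\<^bsup>d,j\<^esup>\<close>. The numbering of the cycles and, in each cycle, of its
  two perfect matchings is arbitrary.
\<close>

definition cycle_numbering ::
    "nat \<Rightarrow> (nat + nat) set set \<Rightarrow> (nat \<Rightarrow> nat \<Rightarrow> (nat + nat) set set) \<Rightarrow> bool" where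
  "cycle_numbering n E w \<longleftrightarrow>
     (\<exists>c. bij_betw c {1..num_cycles n E} (cycles (bip_vertices n) E) \<and>
       (\<forall>j\<in>{1..num_cycles n E}.
          w 0 j \<noteq> w 1 j \<and> cycle_matchings (bip_vertices n) E (c j) = {w 0 j, w 1 j}))"

definition vectors :: "nat \<Rightarrow> (nat \<Rightarrow> nat) set" where
  "vectors q = {1..q} \<rightarrow>\<^sub>E {0, 1}"

definition solution_of ::
    "nat \<Rightarrow> (nat \<Rightarrow> nat set) \<Rightarrow> (nat \<Rightarrow> nat \<Rightarrow> (nat + nat) set set) \<Rightarrow> (nat \<Rightarrow> nat) \<Rightarrow> nat \<Rightarrow> nat" where
  "solution_of n Xs w \<delta> =
     (THE f. f \<in> solutions n Xs \<and>
        matching_of n f = special_edges (bip_vertices n) (bip_edges n Xs) \<union>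
                          (\<Union>j\<in>{1..num_cycles n (bip_edges n Xs)}. w (\<delta> j) j))"

definition hamming :: "nat \<Rightarrow> (nat \<Rightarrow> nat) \<Rightarrow> (nat \<Rightarrow> nat) \<Rightarrow> nat" where
  "hamming q \<delta> \<delta>' = card {j \<in> {1..q}. \<delta> j \<noteq> \<delta>' j}"

definition exchange_nbhd :: "nat \<Rightarrow> (nat \<Rightarrow> nat) \<Rightarrow> (nat \<Rightarrow> nat) set" where
  "exchange_nbhd q \<delta> = {\<delta>' \<in> vectors q. hamming q \<delta> \<delta>' = 1}"


section \<open>Unit-cost random access machine\<close>

text \<open>
  The machine has integer memory (natural numbers, used for addresses and counters) and real
  memory (used for weights); as in the algebraic RAM, real numbers can be combined and compared,
  but never converted into integers. Each memory is divided into arrays addressed by a name; a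
  program mentions only finitely many names, so up to a constant factor this is one linear memory
  with the arrays interleaved. Integer arithmetic is limited to addition and truncated
  subtraction, which rules out building long integers by repeated multiplication.
\<close>

record memory =
  ints :: "string \<Rightarrow> nat \<Rightarrow> nat"
  reals :: "string \<Rightarrow> nat \<Rightarrow> real"

datatype iexp = IConst nat | IGet string iexp | IAdd iexp iexp | ISub iexp iexp

datatype rexp = RConst nat | RGet string iexp
  | RAdd rexp rexp | RSub rexp rexp | RMul rexp rexp | RDiv rexp rexp

datatype bexp = ILess iexp iexp | RLess rexp rexp | BNot bexp | BAnd bexp bexp

datatype com =
    Skip
  | IPut string iexp iexp
  | RPut string iexp rexp
  | Seq com com
  | Cond bexp com com
  | While bexp com

fun ival :: "iexp \<Rightarrow> memory \<Rightarrow> nat" where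
  "ival (IConst k) s = k"
| "ival (IGet x a) s = ints s x (ival a s)"
| "ival (IAdd a b) s = ival a s + ival b s"
| "ival (ISub a b) s = ival a s - ival b s"

fun rval :: "rexp \<Rightarrow> memory \<Rightarrow> real" where
  "rval (RConst k) s = real k"
| "rval (RGet x a) s = reals s x (ival a s)"
| "rval (RAdd a b) s = rval a s + rval b s"
| "rval (RSub a b) s = rval a s - rval b s"
| "rval (RMul a b) s = rval a s * rval b s"
| "rval (RDiv a b) s = rval a s / rval b s"

fun bval :: "bexp \<Rightarrow> memory \<Rightarrow> bool" where
  "bval (ILess a b) s \<longleftrightarrow> ival a s < ival b s"
| "bval (RLess a b) s \<longleftrightarrow> rval a s < rval b s"
| "bval (BNot a) s \<longleftrightarrow> \<not> bval a s"
| "bval (BAnd a b) s \<longleftrightarrow> bval a s \<and> bval b s"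

text \<open>Every operation, constant and memory access in an expression takes one time unit.\<close>

fun itime :: "iexp \<Rightarrow> nat" where
  "itime (IConst k) = 1"
| "itime (IGet x a) = 1 + itime a"
| "itime (IAdd a b) = 1 + itime a + itime b"
| "itime (ISub a b) = 1 + itime a + itime b"

fun rtime :: "rexp \<Rightarrow> nat" where
  "rtime (RConst k) = 1"
| "rtime (RGet x a) = 1 + itime a"
| "rtime (RAdd a b) = 1 + rtime a + rtime b"
| "rtime (RSub a b) = 1 + rtime a + rtime b"
| "rtime (RMul a b) = 1 + rtime a + rtime b"
| "rtime (RDiv a b) = 1 + rtime a + rtime b"

fun btime :: "bexp \<Rightarrow> nat" where
  "btime (ILess a b) = 1 + itime a + itime b"
| "btime (RLess a b) = 1 + rtime a + rtime b"
| "btime (BNot a) = 1 + btime a"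
| "btime (BAnd a b) = 1 + btime a + btime b"

definition iput :: "string \<Rightarrow> nat \<Rightarrow> nat \<Rightarrow> memory \<Rightarrow> memory" where
  "iput x k v s = s\<lparr>ints := (ints s)(x := (ints s x)(k := v))\<rparr>"

definition rput :: "string \<Rightarrow> nat \<Rightarrow> real \<Rightarrow> memory \<Rightarrow> memory" where
  "rput x k v s = s\<lparr>reals := (reals s)(x := (reals s x)(k := v))\<rparr>"

text \<open>\<open>exec p s t s'\<close>: started in \<open>s\<close>, program \<open>p\<close> halts in \<open>s'\<close> after exactly \<open>t\<close> time units.\<close>

inductive exec :: "com \<Rightarrow> memory \<Rightarrow> nat \<Rightarrow> memory \<Rightarrow> bool" where
  Skip: "exec Skip s 1 s"
| IPut: "exec (IPut x a e) s (1 + itime a + itime e) (iput x (ival a s) (ival e s) s)"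
| RPut: "exec (RPut x a e) s (1 + itime a + rtime e) (rput x (ival a s) (rval e s) s)"
| Seq: "exec p s t1 s1 \<Longrightarrow> exec q s1 t2 s2 \<Longrightarrow> exec (Seq p q) s (t1 + t2) s2"
| CondTrue: "bval b s \<Longrightarrow> exec p s t s1 \<Longrightarrow> exec (Cond b p q) s (1 + btime b + t) s1"
| CondFalse: "\<not> bval b s \<Longrightarrow> exec q s t s1 \<Longrightarrow> exec (Cond b p q) s (1 + btime b + t) s1"
| WhileFalse: "\<not> bval b s \<Longrightarrow> exec (While b p) s (1 + btime b) s"
| WhileTrue: "bval b s \<Longrightarrow> exec p s t1 s1 \<Longrightarrow> exec (While b p) s1 t2 s2
    \<Longrightarrow> exec (While b p) s (1 + btime b + t1 + t2) s2"

lemma exec_deterministic: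
  assumes "exec p s t s1" and "exec p s t' s1'"
  shows "t' = t \<and> s1' = s1"
  using assms
proof (induction arbitrary: t' s1' rule: exec.induct)
  case (Skip s)
  from Skip.prems show ?case by cases simp
next
  case (IPut x a e s)
  from IPut.prems show ?case by cases simp
next
  case (RPut x a e s)
  from RPut.prems show ?case by cases simp
next
  case (Seq p s t1 s1 q t2 s2)
  from Seq.prems show ?case by cases (use Seq.IH in blast)
next
  case (CondTrue b s p t s1 q)
  from CondTrue.prems show ?case by cases (use CondTrue.IH CondTrue.hyps in blast)+
next
  case (CondFalse b s q t s1 p)
  from CondFalse.prems show ?case by cases (use CondFalse.IH CondFalse.hyps in blast)+
next
  case (WhileFalse b s p)
  from WhileFalse.prems show ?case by cases (use WhileFalse.hyps in simp_all)
next
  case (WhileTrue b s p t1 s1 t2 s2)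
  from WhileTrue.prems show ?case by cases (use WhileTrue.IH WhileTrue.hyps in blast)+
qed


section \<open>Input and output conventions\<close>

text \<open>
  The requisition \<open>X\<^sup>i\<close> is given as a pair \<open>a i\<close>, \<open>b i\<close> of elements (equal if \<open>X\<^sup>i\<close> is a singleton,
  in any order otherwise), and the weights of the arcs from \<open>X\<^sup>i\<close> to \<open>X\<^sup>i\<^sup>+\<^sup>1\<close> as four numbers at
  address \<open>i\<close>. All other memory cells are initially zero.
\<close>

definition input_memory ::
    "nat \<Rightarrow> (nat \<Rightarrow> nat) \<Rightarrow> (nat \<Rightarrow> nat) \<Rightarrow> (nat \<Rightarrow> nat \<Rightarrow> real) \<Rightarrow> memory" where
  "input_memory n a b \<rho> =
     (let nxt = (\<lambda>i. if i = n then 1 else i + 1);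
          arr = (\<lambda>g i. if i \<in> {1..n} then g i else 0)
      in \<lparr> ints = (\<lambda>_ _. 0)
             (''n'' := (\<lambda>_. 0)(0 := n),
              ''req1'' := (\<lambda>i. if i \<in> {1..n} then a i else 0),
              ''req2'' := (\<lambda>i. if i \<in> {1..n} then b i else 0)),
           reals = (\<lambda>_ _. 0)
             (''arc11'' := arr (\<lambda>i. \<rho> (a i) (a (nxt i))),
              ''arc12'' := arr (\<lambda>i. \<rho> (a i) (b (nxt i))),
              ''arc21'' := arr (\<lambda>i. \<rho> (b i) (a (nxt i))),
              ''arc22'' := arr (\<lambda>i. \<rho> (b i) (b (nxt i)))) \<rparr>)"

text \<open>
  The numbering of cycles and matchings, which gives the vectors \<open>\<delta>\<close> their meaning, is chosen and
  reported by the preprocessing: \<open>''cycle''\<close> holds at \<open>i\<close> the number of the cycle through position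
  \<open>i\<close> (a value outside \<open>{1..q}\<close>, such as 0, if there is none), and \<open>''match0''\<close>, \<open>''match1''\<close> hold
  the partners of \<open>i\<close> in the two perfect matchings of that cycle.
\<close>

definition reported_matching :: "nat \<Rightarrow> memory \<Rightarrow> nat \<Rightarrow> nat \<Rightarrow> (nat + nat) set set" where
  "reported_matching n s d j =
     {{Inl i, Inr (ints s (if d = 0 then ''match0'' else ''match1'') i)} | i.
        i \<in> {1..n} \<and> ints s ''cycle'' i = j}"

definition reports_numbering :: "nat \<Rightarrow> (nat + nat) set set \<Rightarrow> memory \<Rightarrow> bool" where
  "reports_numbering n E s \<longleftrightarrow>
     ints s ''q'' 0 = num_cycles n E \<and> cycle_numbering n E (reported_matching n s)"

definition load_vector :: "nat \<Rightarrow> (nat \<Rightarrow> nat) \<Rightarrow> memory \<Rightarrow> memory" where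
  "load_vector q \<delta> s =
     s\<lparr>ints := (ints s)(''delta'' := (\<lambda>j. if j \<in> {1..q} then \<delta> j else 0))\<rparr>"

text \<open>
  The result is a table of \<open>''count''\<close> records: the vector of the \<open>r\<close>-th record is the \<open>r\<close>-th row
  of the row-major array \<open>''nbr''\<close> with rows of length \<open>q\<close>, its objective value is at address \<open>r\<close>
  of \<open>''cost''\<close>.
\<close>

definition listed_vector :: "nat \<Rightarrow> memory \<Rightarrow> nat \<Rightarrow> nat \<Rightarrow> nat" where
  "listed_vector q s r = (\<lambda>j\<in>{1..q}. ints s ''nbr'' ((r - 1) * q + j))"

definition lists_nbhd ::
    "nat \<Rightarrow> (nat \<Rightarrow> nat set) \<Rightarrow> (nat \<Rightarrow> nat \<Rightarrow> real) \<Rightarrow> (nat \<Rightarrow> nat \<Rightarrow> (nat + nat) set set)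
     \<Rightarrow> (nat \<Rightarrow> nat) \<Rightarrow> memory \<Rightarrow> bool" where
  "lists_nbhd n Xs \<rho> w \<delta> s \<longleftrightarrow>
     (let q = num_cycles n (bip_edges n Xs); m = ints s ''count'' 0 in
       bij_betw (listed_vector q s) {1..m} (exchange_nbhd q \<delta>) \<and>
       (\<forall>r\<in>{1..m}. reals s ''cost'' r = tour_cost n \<rho> (solution_of n Xs w (listed_vector q s r))))"

text \<open>
  For every presentation of the instance, \<open>prep\<close> halts within time \<open>T1\<close>; from the memory it leaves
  behind, \<open>enum\<close> lists the Exchange neighborhood of every \<open>f\<^sub>\<delta>\<close> within time \<open>T2\<close>.
\<close>

definition enumerates_exchange ::
    "com \<Rightarrow> com \<Rightarrow> nat \<Rightarrow> (nat \<Rightarrow> nat set) \<Rightarrow> (nat \<Rightarrow> nat \<Rightarrow> real) \<Rightarrow> real \<Rightarrow> real \<Rightarrow> bool" where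
  "enumerates_exchange prep enum n Xs \<rho> T1 T2 \<longleftrightarrow>
     (\<forall>a b. (\<forall>i\<in>{1..n}. Xs i = {a i, b i}) \<longrightarrow>
       (\<exists>t1 s. exec prep (input_memory n a b \<rho>) t1 s \<and> real t1 \<le> T1 \<and>
          reports_numbering n (bip_edges n Xs) s \<and>
          (\<forall>\<delta>\<in>vectors (num_cycles n (bip_edges n Xs)). \<exists>t2 s'.
             exec enum (load_vector (num_cycles n (bip_edges n Xs)) \<delta> s) t2 s' \<and> real t2 \<le> T2 \<and>
             lists_nbhd n Xs \<rho> (reported_matching n s) \<delta> s')))"

end

theory Submission
  imports Defs
begin

text \<open>
  Algorithm. View the elements as vertices of a multigraph in which position \<open>i\<close> is an edge joining
  the elements of \<open>X\<^sup>i\<close>; a solution orients every edge towards one of its ends so that every vertex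
  is chosen once. A vertex of degree one forces its edge, so stripping such vertices determines the
  special edges; for every vertex the degree and the sum of the remaining incident positions
  are maintained, which replaces adjacency lists. By counting, what remains is 2-regular (up to loops, which are
  special), and its cycles are traced with the same sums. Every summand of the tour cost depends on
  the choices in at most two cycles, special positions being assigned to a dummy cycle 0. Hence the cost
  is a sum over a table of \<open>(2q+2)\<^sup>2\<close> entries, and flipping one coordinate changes one row and
  one column of it.

  Number of cycles. A solution \<open>f\<close> turns the multigraph into a map \<open>g\<close> on the elements
  with \<open>X\<^sup>i = {f i, g (f i)}\<close>, and a graph with \<open>q\<close> cycles arises from at least \<open>2\<^sup>q\<close> pairs \<open>(f, g)\<close>.
  So there are at most \<open>n! n\<^sup>n / 2\<^sup>m\<close> graphs with at least \<open>m\<close> cycles. If \<open>g\<close> is a rooted tree, then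
  \<open>f\<close> is the only solution, so there are at least \<open>n!\<close> times as many graphs as rooted trees, and by
  Joyal's encoding \<open>n\<^sup>n\<close> is at most \<open>n\<close> times the number of rooted trees. The
  proportion of graphs with at least \<open>m\<close> cycles is therefore at most \<open>n / 2\<^sup>m\<close>, which is at most \<open>1 / n\<close> for
  \<open>m \<ge> 2 log\<^sub>2 n\<close>.
\<close>

text \<open>All notions about the graph (special edges, components, the two matchings of a cycle)
  are computed from one combinatorial description, \<open>cycle_data\<close>, which is also what the
  tracing program delivers. There is no separate structure theory of feasible graphs: that each of
  them has such a description, and hence at least 2^q solutions, is read off from the termination
  and correctness of the preprocessing. The counting argument therefore takes this bound as an
  assumption that is discharged at the end. The width 2q+2 of the table comes from q+1 cycle
  indices, the dummy included, with two choices each. Integers cannot be multiplied by the machine,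
  so the addresses of the rows are tabulated by repeated addition. The table is never cleared,
  because memory is initially zero; filling it takes time linear in n although it has quadratically
  many cells in q. Writing out q vectors of length q costs q^2 already, so each neighbor may be
  given a row, a column and a copy of the vector.\<close>

declare One_nat_def [simp del]

section \<open>Running times of programs\<close>

definition V :: "string \<Rightarrow> iexp" where "V x = IGet x (IConst 0)"
definition ISet :: "string \<Rightarrow> iexp \<Rightarrow> com" where "ISet x e = IPut x (IConst 0) e"
definition IEq :: "iexp \<Rightarrow> iexp \<Rightarrow> bexp" where
  "IEq a b = BAnd (BNot (ILess a b)) (BNot (ILess b a))"

lemma ival_V [simp]: "ival (V x) s = ints s x 0" and itime_V [simp]: "itime (V x) = 2"
  by (simp_all add: V_def)

lemma bval_IEq [simp]: "bval (IEq a b) s \<longleftrightarrow> ival a s = ival b s"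
  by (auto simp: IEq_def)

lemma ints_iput: "ints (iput x k v s) y = (if x = y then (ints s y)(k := v) else ints s y)"
  and reals_iput: "reals (iput x k v s) = reals s"
  and ints_rput: "ints (rput x k r s) = ints s"
  and reals_rput: "reals (rput x k r s) y = (if x = y then (reals s y)(k := r) else reals s y)"
  by (auto simp: iput_def rput_def)

lemmas mem = ints_iput reals_iput ints_rput reals_rput

section \<open>Frame conditions and time credits\<close>

fun iwrites :: "com \<Rightarrow> string set" where
  "iwrites Skip = {}"
| "iwrites (IPut x a e) = {x}"
| "iwrites (RPut x a e) = {}"
| "iwrites (Seq p q) = iwrites p \<union> iwrites q"
| "iwrites (Cond b p q) = iwrites p \<union> iwrites q"
| "iwrites (While b p) = iwrites p"

fun rwrites :: "com \<Rightarrow> string set" where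
  "rwrites Skip = {}"
| "rwrites (IPut x a e) = {}"
| "rwrites (RPut x a e) = {x}"
| "rwrites (Seq p q) = rwrites p \<union> rwrites q"
| "rwrites (Cond b p q) = rwrites p \<union> rwrites q"
| "rwrites (While b p) = rwrites p"

lemma iwrites_ISet [simp]: "iwrites (ISet x e) = {x}" and rwrites_ISet [simp]: "rwrites (ISet x e) = {}"
  by (simp_all add: ISet_def)

text \<open>Loop invariants only have to describe what a loop changes: the input, finished tables
  and other untouched arrays are carried along by \<open>exec_agree\<close>, which reads off the
  syntax which arrays a program can write.\<close>

definition agree :: "com \<Rightarrow> memory \<Rightarrow> memory \<Rightarrow> bool" where
  "agree p s s' \<longleftrightarrow> (\<forall>x. x \<notin> iwrites p \<longrightarrow> ints s' x = ints s x) \<and>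
                    (\<forall>x. x \<notin> rwrites p \<longrightarrow> reals s' x = reals s x)"

lemma agreeI: "agree p s s' \<Longrightarrow> x \<notin> iwrites p \<Longrightarrow> ints s' x = ints s x"
  and agreeR: "agree p s s' \<Longrightarrow> x \<notin> rwrites p \<Longrightarrow> reals s' x = reals s x"
  by (auto simp: agree_def)

lemma agree_refl [simp]: "agree p s s"
  by (simp add: agree_def)

lemma exec_agree: "exec p s t s' \<Longrightarrow> agree p s s'"
  by (induction rule: exec.induct) (auto simp: agree_def mem)

text \<open>Time is accounted for by credits: \<open>Q\<close> sees those that remain of the initial \<open>N\<close>.\<close>

definition runs :: "com \<Rightarrow> memory \<Rightarrow> nat \<Rightarrow> (nat \<Rightarrow> memory \<Rightarrow> bool) \<Rightarrow> bool" where
  "runs p s N Q \<longleftrightarrow> (\<exists>t s' N'. exec p s t s' \<and> t + N' = N \<and> Q N' s')"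

lemma runs_mono:
  assumes "runs p s N Q" and "\<And>N' s'. Q N' s' \<Longrightarrow> agree p s s' \<Longrightarrow> N' \<le> N \<Longrightarrow> Q' N' s'"
  shows "runs p s N Q'"
  using assms unfolding runs_def by (metis exec_agree le_add2)

lemma runs_Seq:
  assumes "runs p s N (\<lambda>N1 s1. runs q s1 N1 Q)"
  shows "runs (Seq p q) s N Q"
  using assms unfolding runs_def by (metis exec.Seq add.assoc)

lemma runs_Cond:
  assumes "1 + btime b \<le> N"
    and "bval b s \<Longrightarrow> runs p s (N - (1 + btime b)) Q"
    and "\<not> bval b s \<Longrightarrow> runs q s (N - (1 + btime b)) Q"
  shows "runs (Cond b p q) s N Q"
proof (cases "bval b s")
  case True
  then obtain t s' N' where "exec p s t s'" "t + N' = N - (1 + btime b)" "Q N' s'"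
    using assms(2) by (auto simp: runs_def)
  then show ?thesis using assms(1) CondTrue[OF True] unfolding runs_def
    by (intro exI[of _ "1 + btime b + t"] exI[of _ s'] exI[of _ N']) auto
next
  case False
  then obtain t s' N' where "exec q s t s'" "t + N' = N - (1 + btime b)" "Q N' s'"
    using assms(3) by (auto simp: runs_def)
  then show ?thesis using assms(1) CondFalse[OF False] unfolding runs_def
    by (intro exI[of _ "1 + btime b + t"] exI[of _ s'] exI[of _ N']) auto
qed

text \<open>Every iteration consumes credits, so no separate termination argument is needed.\<close>

lemma runs_While:
  assumes "I N0 s0"
    and body: "\<And>N s. I N s \<Longrightarrow> bval b s \<Longrightarrow> agree p s0 s \<Longrightarrow>
      1 + btime b \<le> N \<and> runs p s (N - (1 + btime b)) I"
    and exit: "\<And>N s. I N s \<Longrightarrow> \<not> bval b s \<Longrightarrow> agree p s0 s \<Longrightarrow> 1 + btime b \<le> N \<and> Q (N - (1 + btime b)) s"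
  shows "runs (While b p) s0 N0 Q"
proof -
  have "runs (While b p) s N Q" if "I N s" "agree p s0 s" for N s
    using that
  proof (induction N arbitrary: s rule: less_induct)
    case (less N)
    show ?case
    proof (cases "bval b s")
      case True
      from body[OF less.prems(1) True less.prems(2)] obtain t s1 N1 where
        e: "exec p s t s1" "t + N1 = N - (1 + btime b)" "I N1 s1" "1 + btime b \<le> N"
        by (auto simp: runs_def)
      have "agree p s0 s1" using exec_agree[OF e(1)] less.prems(2) by (simp add: agree_def)
      moreover have "N1 < N" using e by linarith
      ultimately have "runs (While b p) s1 N1 Q" using less.IH e(3) by blast
      then obtain t2 s2 N2 where "exec (While b p) s1 t2 s2" "t2 + N2 = N1" "Q N2 s2"
        by (auto simp: runs_def)
      then show ?thesis using WhileTrue[OF True e(1)] e(2,4) unfolding runs_def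
        by (intro exI[of _ "1 + btime b + t + t2"] exI[of _ s2] exI[of _ N2]) auto
    next
      case False
      from exit[OF less.prems(1) False less.prems(2)] WhileFalse[OF False] show ?thesis
        unfolding runs_def by (intro exI[of _ "1 + btime b"] exI[of _ s] exI[of _ "N - (1 + btime b)"]) auto
    qed
  qed
  then show ?thesis using assms(1) by simp
qed

text \<open>For loop-free code the final state is a function of the initial one, and the time is
  bounded by the dearer branch of each conditional, so both are found by simplification. The values
  of \<open>result\<close> and \<open>max_time\<close> on loops are dummies, excluded by
  \<open>straight\<close>.\<close>

fun straight :: "com \<Rightarrow> bool" where
  "straight (Seq p q) \<longleftrightarrow> straight p \<and> straight q"
| "straight (Cond b p q) \<longleftrightarrow> straight p \<and> straight q"
| "straight (While b p) \<longleftrightarrow> False"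
| "straight _ \<longleftrightarrow> True"

fun result :: "com \<Rightarrow> memory \<Rightarrow> memory" where
  "result (IPut x a e) s = iput x (ival a s) (ival e s) s"
| "result (RPut x a e) s = rput x (ival a s) (rval e s) s"
| "result (Seq p q) s = result q (result p s)"
| "result (Cond b p q) s = (if bval b s then result p s else result q s)"
| "result _ s = s"

fun max_time :: "com \<Rightarrow> nat" where
  "max_time Skip = 1"
| "max_time (IPut x a e) = 1 + itime a + itime e"
| "max_time (RPut x a e) = 1 + itime a + rtime e"
| "max_time (Seq p q) = max_time p + max_time q"
| "max_time (Cond b p q) = 1 + btime b + max (max_time p) (max_time q)"
| "max_time (While b p) = 0"

lemma straight_ISet [simp]: "straight (ISet x e)"
  and result_ISet [simp]: "result (ISet x e) s = iput x 0 (ival e s) s"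
  and max_time_ISet [simp]: "max_time (ISet x e) = 2 + itime e"
  by (simp_all add: ISet_def)

lemma exec_straight:
  "straight p \<Longrightarrow> \<exists>t\<le>max_time p. exec p s t (result p s)"
proof (induction p arbitrary: s)
  case (Seq p q)
  from Seq obtain t1 t2 where "t1 \<le> max_time p" "exec p s t1 (result p s)"
    "t2 \<le> max_time q" "exec q (result p s) t2 (result q (result p s))"
    by (meson straight.simps(1))
  then show ?case using exec.Seq by (intro exI[of _ "t1 + t2"]) auto
next
  case (Cond b p q)
  then have "straight p" "straight q" by auto
  then obtain t1 t2 where t: "t1 \<le> max_time p" "exec p s t1 (result p s)"
    "t2 \<le> max_time q" "exec q s t2 (result q s)" using Cond by meson
  show ?case
  proof (cases "bval b s")
    case True
    then show ?thesis using t CondTrue[OF True t(2)] by (intro exI[of _ "1 + btime b + t1"]) simp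
  next
    case False
    then show ?thesis using t CondFalse[OF False t(4)] by (intro exI[of _ "1 + btime b + t2"]) simp
  qed
next
  case Skip show ?case using exec.Skip by auto
next
  case (IPut x a e) show ?case using exec.IPut by fastforce
next
  case (RPut x a e) show ?case using exec.RPut by fastforce
qed auto

lemma runs_straight:
  assumes "straight p" "max_time p \<le> N" "\<And>N'. N \<le> N' + max_time p \<Longrightarrow> Q N' (result p s)"
  shows "runs p s N Q"
proof -
  obtain t where t: "t \<le> max_time p" "exec p s t (result p s)" using exec_straight[OF assms(1)] by blast
  then have "N \<le> (N - t) + max_time p" by linarith
  then have "Q (N - t) (result p s)" by (rule assms(3))
  then show ?thesis using t assms(2) unfolding runs_def
    by (intro exI[of _ t] exI[of _ "result p s"] exI[of _ "N - t"]) auto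
qed

fun seqs :: "com list \<Rightarrow> com" where
  "seqs [] = Skip"
| "seqs (p # ps) = Seq p (seqs ps)"

lemma runs_prefix:
  assumes "straight p" "max_time p \<le> N"
    "\<And>N'. N \<le> N' + max_time p \<Longrightarrow> N' \<le> N \<Longrightarrow> runs q (result p s) N' Q"
  shows "runs (Seq p q) s N Q"
proof (rule runs_Seq, rule runs_mono)
  show "runs p s N (\<lambda>N' s'. N \<le> N' + max_time p \<and> s' = result p s)"
    using assms(1,2) by (rule runs_straight) simp
qed (use assms(3) in blast)

text \<open>\<open>h\<close> is the price of one test of the guard: one unit each for the loop and
  the comparison, two for \<open>V i\<close>, and \<open>itime hi\<close>. The total consists of
  \<open>H\<close> rounds of at most \<open>L + h\<close> units and one last, failing test. The
  limit \<open>hi\<close> is evaluated anew in every round, so its value must be stable under all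
  changes that the body can make.\<close>

lemma runs_for:
  assumes hi: "\<And>s. agree body s0 s \<Longrightarrow> ival hi s = H" and h: "4 + itime hi = h"
    and i0: "ints s0 i 0 = 0" and P0: "P 0 s0"
    and body: "\<And>t s N. t < H \<Longrightarrow> ints s i 0 = t \<Longrightarrow> P t s \<Longrightarrow> agree body s0 s \<Longrightarrow> L \<le> N \<Longrightarrow>
      runs body s N (\<lambda>N' s'. N \<le> N' + L \<and> ints s' i 0 = t + 1 \<and> P (t + 1) s')"
    and N: "(L + h) * H + h \<le> N"
  shows "runs (While (ILess (V i) hi) body) s0 N (\<lambda>N' s'. N \<le> N' + (L + h) * H + h \<and> P H s')"
proof (rule runs_While[where I = "\<lambda>N' s'. ints s' i 0 \<le> H \<and> P (ints s' i 0) s' \<and>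
    N \<le> N' + (L + h) * ints s' i 0"], goal_cases)
  case 1
  then show ?case using i0 P0 by simp
next
  case (2 N' s')
  let ?t = "ints s' i 0"
  have t: "?t < H" using 2(2) hi[OF 2(3)] by simp
  have "(L + h) * (?t + 1) \<le> (L + h) * H" using t by (intro mult_le_mono2) simp
  then have N': "L + h \<le> N'" using 2(1) N by (simp add: distrib_left)
  have "runs body s' (N' - h) (\<lambda>N'' s''. N' - h \<le> N'' + L \<and> ints s'' i 0 = ?t + 1 \<and> P (?t + 1) s'')"
    using N' 2 by (intro body[OF t]) auto
  then have "runs body s' (N' - h) (\<lambda>N' s'. ints s' i 0 \<le> H \<and> P (ints s' i 0) s' \<and> N \<le> N' + (L + h) * ints s' i 0)"
    by (rule runs_mono) (use t 2(1) N' in \<open>auto simp: distrib_left\<close>)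
  then show ?case using N' h by simp
next
  case (3 N' s')
  then have t: "ints s' i 0 = H" using hi[OF 3(3)] by simp
  then show ?case using 3(1) N h by simp
qed

lemma runs_exec:
  assumes "runs p s N (\<lambda>N'. Q)"
  shows "\<exists>t s'. exec p s t s' \<and> t \<le> N \<and> agree p s s' \<and> Q s'"
  using assms unfolding runs_def by (metis exec_agree le_add1)

section \<open>The cycles of the bipartite graph\<close>

lemma bip_edge_eq: "{Inl i, Inr x} = {Inl j, Inr y} \<longleftrightarrow> i = j \<and> x = y"
  by (auto simp: doubleton_eq_iff)

lemma bip_edge_mem:
  "{Inl i, Inr x} \<in> bip_edges n Xs \<longleftrightarrow> i \<in> {1..n} \<and> x \<in> Xs i"
  by (auto simp: bip_edges_def doubleton_eq_iff)

lemma matching_of_mem: "{Inl i, Inr x} \<in> matching_of n f \<longleftrightarrow> i \<in> {1..n} \<and> x = f i"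
  by (auto simp: matching_of_def doubleton_eq_iff)

lemma matching_of_inj:
  assumes "matching_of n f = matching_of n g" "f \<in> extensional {1..n}" "g \<in> extensional {1..n}"
  shows "f = g"
proof (rule extensionalityI[OF assms(2,3)])
  fix i assume "i \<in> {1..n}"
  then have "{Inl i, Inr (f i)} \<in> matching_of n g"
    using assms(1) by (auto simp flip: assms(1) simp: matching_of_mem)
  then show "f i = g i" by (simp add: matching_of_mem)
qed

lemma solutions_in: "f \<in> solutions n Xs \<Longrightarrow> i \<in> {1..n} \<Longrightarrow> f i \<in> {1..n}"
  unfolding solutions_def bij_betw_def by blast

lemma finite_solutions: "finite (solutions n Xs)"
proof (rule finite_subset)
  have "f \<in> extensional {1..n}" if "f \<in> solutions n Xs" for f using that by (simp add: solutions_def)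
  then show "solutions n Xs \<subseteq> {1..n} \<rightarrow>\<^sub>E {1..n}"
    using solutions_in unfolding PiE_def Pi_def by blast
qed (auto intro: finite_PiE)

lemma perfect_matching_matching_of:
  assumes f: "f \<in> solutions n Xs"
  shows "perfect_matching (bip_vertices n) (bip_edges n Xs) (matching_of n f)"
  unfolding perfect_matching_def
proof (intro conjI ballI)
  show "matching_of n f \<subseteq> bip_edges n Xs"
    using f by (auto simp: matching_of_def bip_edge_mem solutions_def)
  fix v assume v: "v \<in> bip_vertices n"
  have b: "bij_betw f {1..n} {1..n}" using f by (simp add: solutions_def)
  obtain i where i: "i \<in> {1..n}" "v = Inl i \<or> v = Inr (f i)"
    using v b unfolding bip_vertices_def bij_betw_def by blast
  show "\<exists>!e. e \<in> matching_of n f \<and> v \<in> e"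
  proof (rule ex1I[of _ "{Inl i, Inr (f i)}"])
    show "{Inl i, Inr (f i)} \<in> matching_of n f \<and> v \<in> {Inl i, Inr (f i)}"
      using i by (auto simp: matching_of_mem)
    fix e assume "e \<in> matching_of n f \<and> v \<in> e"
    then obtain j where j: "j \<in> {1..n}" "e = {Inl j, Inr (f j)}" "v \<in> {Inl j, Inr (f j)}"
      by (auto simp: matching_of_def)
    then have "j = i" using i b by (auto simp: bij_betw_def dest: inj_onD)
    then show "e = {Inl i, Inr (f i)}" using j by simp
  qed
qed

text \<open>The edge of \<open>M\<close> at each position defines \<open>f\<close>. No element lies
  on two edges of \<open>M\<close>, so \<open>f\<close> is injective, and finiteness makes it a
  bijection.\<close>

lemma perfect_matching_imp_matching_of:
  assumes req: "\<And>i. i \<in> {1..n} \<Longrightarrow> Xs i \<subseteq> {1..n}"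
    and M: "perfect_matching (bip_vertices n) (bip_edges n Xs) M"
  shows "\<exists>f\<in>solutions n Xs. M = matching_of n f"
proof -
  have ME: "M \<subseteq> bip_edges n Xs" and u: "\<And>v. v \<in> bip_vertices n \<Longrightarrow> \<exists>!e. e \<in> M \<and> v \<in> e"
    using M by (auto simp: perfect_matching_def)
  have ex: "\<exists>x. {Inl i, Inr x} \<in> M" if i: "i \<in> {1..n}" for i
  proof -
    obtain e where e: "e \<in> M" "Inl i \<in> e"
      using u[of "Inl i"] i by (auto simp: bip_vertices_def)
    then show ?thesis using ME by (auto simp: bip_edges_def)
  qed
  define f where "f = (\<lambda>i\<in>{1..n}. SOME x. {Inl i, Inr x} \<in> M)"
  have fM: "{Inl i, Inr (f i)} \<in> M" if "i \<in> {1..n}" for i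
    using someI_ex[OF ex[OF that]] that by (simp add: f_def)
  have fX: "f i \<in> Xs i" if "i \<in> {1..n}" for i
    using fM[OF that] ME bip_edge_mem by blast
  have "inj_on f {1..n}"
  proof (rule inj_onI)
    fix i j assume ij: "i \<in> {1..n}" "j \<in> {1..n}" "f i = f j"
    then have "f i \<in> {1..n}" using fX req by blast
    then have "Inr (f i) \<in> bip_vertices n" by (simp add: bip_vertices_def)
    from u[OF this] fM[OF ij(1)] fM[OF ij(2)] ij(3)
    have "{Inl i, Inr (f i)} = {Inl j, Inr (f j)}" by (metis insertI1 insertI2)
    then show "i = j" by (simp only: bip_edge_eq)
  qed
  moreover have "f ` {1..n} \<subseteq> {1..n}" using fX req by blast
  ultimately have "bij_betw f {1..n} {1..n}"
    by (simp add: bij_betw_def endo_inj_surj)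
  then have sol: "f \<in> solutions n Xs" using fX by (auto simp: solutions_def f_def)
  have "M = matching_of n f"
  proof
    show "matching_of n f \<subseteq> M" using fM by (auto simp: matching_of_def)
    show "M \<subseteq> matching_of n f"
    proof
      fix e assume e: "e \<in> M"
      then obtain i x where ix: "e = {Inl i, Inr x}" "i \<in> {1..n}" using ME by (auto simp: bip_edges_def)
      then have "Inl i \<in> bip_vertices n" by (simp add: bip_vertices_def)
      from u[OF this] fM[OF ix(2)] e ix have "e = {Inl i, Inr (f i)}" by auto
      then show "e \<in> matching_of n f" using ix(2) by (auto simp: matching_of_def)
    qed
  qed
  with sol show ?thesis by blast
qed

text \<open>\<open>K\<close> holds the positions on cycles, \<open>c\<close> their cycle numbers,
  and \<open>m0\<close>, \<open>m1\<close> their partners in the two matchings. On all of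
  \<open>{1..n}\<close>, \<open>m0\<close> is a solution, and off \<open>K\<close> it gives the
  forced values. The successor of a position is the one whose \<open>m0\<close>-partner is its own
  \<open>m1\<close>-partner; \<open>nxt\<close> says that successors stay in the cycle,
  \<open>conn\<close> that they run through all of it.\<close>

locale cycle_data =
  fixes n :: nat and Xs :: "nat \<Rightarrow> nat set" and K :: "nat set" and c :: "nat \<Rightarrow> nat" and q :: nat
    and m0 m1 :: "nat \<Rightarrow> nat"
  assumes K: "K \<subseteq> {1..n}"
    and req: "\<And>i. i \<in> {1..n} \<Longrightarrow> Xs i \<subseteq> {1..n}"
    and bij0: "bij_betw m0 {1..n} {1..n}"
    and m0_in: "\<And>i. i \<in> {1..n} \<Longrightarrow> m0 i \<in> Xs i"
    and XsK: "\<And>i. i \<in> K \<Longrightarrow> Xs i = {m0 i, m1 i}"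
    and ne: "\<And>i. i \<in> K \<Longrightarrow> m0 i \<noteq> m1 i"
    and inj1: "inj_on m1 K"
    and nxt: "\<And>i. i \<in> K \<Longrightarrow> \<exists>j\<in>K. m0 j = m1 i \<and> c j = c i"
    and conn: "\<And>i j. i \<in> K \<Longrightarrow> j \<in> K \<Longrightarrow> c i = c j \<Longrightarrow>
      (i, j) \<in> {(x, y). x \<in> K \<and> y \<in> K \<and> m0 y = m1 x}\<^sup>*"
    and range: "c ` K = {1..q}"
    and forced: "\<And>f i. f \<in> solutions n Xs \<Longrightarrow> i \<in> {1..n} - K \<Longrightarrow> f i = m0 i"
begin

definition md :: "nat \<Rightarrow> nat \<Rightarrow> nat" where "md d i = (if d = 0 then m0 i else m1 i)"

definition sel :: "(nat \<Rightarrow> nat) \<Rightarrow> nat \<Rightarrow> nat" where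
  "sel \<delta> = (\<lambda>i\<in>{1..n}. if i \<in> K then md (\<delta> (c i)) i else m0 i)"

definition cls :: "nat \<Rightarrow> nat set" where "cls j = {i \<in> K. c i = j}"

lemma finK: "finite K" using K finite_subset by blast

lemma inj0: "inj_on m0 {1..n}" using bij0 by (simp add: bij_betw_def)

text \<open>Both matchings of a cycle cover the same elements: by \<open>nxt\<close> the image under
  \<open>m1\<close> lies in the image under \<open>m0\<close>, and the two have equal
  cardinality.\<close>

lemma bij_md: "bij_betw (md d) (cls j) (m0 ` cls j)"
proof -
  have i0: "inj_on m0 (cls j)" using inj0 K by (auto simp: cls_def intro: inj_on_subset)
  have i1: "inj_on m1 (cls j)" using inj1 by (auto simp: cls_def intro: inj_on_subset)
  have sub: "m1 ` cls j \<subseteq> m0 ` cls j"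
  proof
    fix x assume "x \<in> m1 ` cls j"
    then obtain i where i: "i \<in> K" "c i = j" "x = m1 i" by (auto simp: cls_def)
    from nxt[OF i(1)] show "x \<in> m0 ` cls j" using i by (force simp: cls_def)
  qed
  have "finite (cls j)" using finK by (simp add: cls_def)
  then have "m1 ` cls j = m0 ` cls j"
    using sub i0 i1 by (intro card_subset_eq) (auto simp: card_image)
  then show ?thesis using i0 i1 unfolding md_def bij_betw_def by (cases "d = 0") (auto cong: inj_on_cong)
qed

lemma md_in: "i \<in> K \<Longrightarrow> md d i \<in> m0 ` cls (c i)"
  using bij_md[of d "c i"] by (auto simp: cls_def bij_betw_def)

lemma md_Xs: "i \<in> K \<Longrightarrow> md d i \<in> Xs i"
  using XsK by (auto simp: md_def)

text \<open>Choices in different cycles cannot collide, because by \<open>bij_md\<close> a cycle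
  takes its elements from \<open>m0\<close> applied to its own positions whichever matching is
  chosen, and \<open>m0\<close> is injective. The same argument separates the cycles from the
  positions off \<open>K\<close>.\<close>

lemma sel_solution: "sel \<delta> \<in> solutions n Xs"
proof -
  have X: "sel \<delta> i \<in> Xs i" if "i \<in> {1..n}" for i
    using that md_Xs m0_in by (auto simp: sel_def)
  have "inj_on (sel \<delta>) {1..n}"
  proof (rule inj_onI)
    fix i j assume i: "i \<in> {1..n}" and j: "j \<in> {1..n}" and e: "sel \<delta> i = sel \<delta> j"
    have aux: False if h: "i \<in> {1..n}" "j \<in> {1..n}" "i \<in> K" "j \<notin> K" "sel \<delta> i = sel \<delta> j" for i j
    proof -
      obtain k where k: "k \<in> K" "m0 k = m0 j"
        using md_in[OF h(3), of "\<delta> (c i)"] h unfolding sel_def cls_def by auto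
      then have "k = j" using inj_onD[OF inj0 k(2)] K h by blast
      then show False using k h by simp
    qed
    show "i = j"
    proof (cases "i \<in> K \<and> j \<in> K")
      case True
      then obtain k l where kl: "k \<in> cls (c i)" "sel \<delta> i = m0 k" "l \<in> cls (c j)" "sel \<delta> j = m0 l"
        using md_in[of i "\<delta> (c i)"] md_in[of j "\<delta> (c j)"] i j by (auto simp: sel_def)
      then have "k = l" using inj_onD[OF inj0, of k l] e K unfolding cls_def by (metis (no_types, lifting) mem_Collect_eq subsetD)
      then have "c i = c j" using kl by (simp add: cls_def)
      then show ?thesis using True e bij_md[of "\<delta> (c i)" "c i"] i j
        by (auto simp: sel_def bij_betw_def cls_def dest: inj_onD)
    next
      case False
      then consider "i \<notin> K" "j \<notin> K" using aux[OF i j] aux[OF j i] e by fastforce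
      then show ?thesis using e i j inj_onD[OF inj0, of i j] by cases (simp add: sel_def)
    qed
  qed
  moreover have "sel \<delta> ` {1..n} \<subseteq> {1..n}" using X req by blast
  ultimately have "bij_betw (sel \<delta>) {1..n} {1..n}"
    by (simp add: bij_betw_def endo_inj_surj)
  then show ?thesis using X by (auto simp: solutions_def sel_def)
qed

abbreviation "VV \<equiv> bip_vertices n"
abbreviation "EE \<equiv> bip_edges n Xs"

text \<open>Off \<open>K\<close> every solution is forced. On \<open>K\<close> no edge is special,
  since the constant vectors 0 and 1 give solutions that differ at every position of
  \<open>K\<close>.\<close>

lemma special_edges_eq: "special_edges VV EE = {{Inl i, Inr (m0 i)} | i. i \<in> {1..n} - K}" (is "_ = ?S")
proof
  show "?S \<subseteq> special_edges VV EE"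
  proof
    fix e assume "e \<in> ?S"
    then obtain i where i: "e = {Inl i, Inr (m0 i)}" "i \<in> {1..n} - K" by blast
    have "e \<in> M" if "perfect_matching VV EE M" for M
    proof -
      obtain f where "f \<in> solutions n Xs" "M = matching_of n f"
        using perfect_matching_imp_matching_of[OF req \<open>perfect_matching VV EE M\<close>] by blast
      then show ?thesis using forced[of f i] i by (auto simp: matching_of_def)
    qed
    then show "e \<in> special_edges VV EE"
      using i m0_in by (auto simp: special_edges_def bip_edge_mem)
  qed
  show "special_edges VV EE \<subseteq> ?S"
  proof
    fix e assume e: "e \<in> special_edges VV EE"
    then obtain i x where ix: "e = {Inl i, Inr x}" "i \<in> {1..n}" by (auto simp: special_edges_def bip_edges_def)
    have "e \<in> matching_of n (sel (\<lambda>_. d))" for d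
      using e perfect_matching_matching_of[OF sel_solution] by (auto simp: special_edges_def)
    from this[of 0] this[of 1] have "x = sel (\<lambda>_. 0) i" "x = sel (\<lambda>_. 1) i"
      by (simp_all add: ix(1) matching_of_mem)
    then have "i \<notin> K" "x = m0 i" using ne[of i] ix(2) by (auto simp: sel_def md_def split: if_splits)
    then show "e \<in> ?S" using ix by blast
  qed
qed

lemma special_vertices_eq: "special_vertices VV EE = Inl ` ({1..n} - K) \<union> Inr ` m0 ` ({1..n} - K)"
proof -
  have "m0 i \<in> {1..n}" if "i \<in> {1..n}" for i using m0_in req that by blast
  then have "Inl ` ({1..n} - K) \<union> Inr ` m0 ` ({1..n} - K) \<subseteq> VV" by (auto simp: bip_vertices_def)
  moreover have "\<Union> {{Inl i, Inr (m0 i)} | i. i \<in> {1..n} - K} = Inl ` ({1..n} - K) \<union> Inr ` m0 ` ({1..n} - K)"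
    unfolding Setcompr_eq_image by blast
  ultimately show ?thesis unfolding special_vertices_def special_edges_eq by blast
qed

lemma m0_mem: "i \<in> {1..n} \<Longrightarrow> A \<subseteq> {1..n} \<Longrightarrow> m0 i \<in> m0 ` A \<longleftrightarrow> i \<in> A"
  using inj0 by (meson inj_on_image_mem_iff)

lemma reduced_vertices_eq: "reduced_vertices VV EE = Inl ` K \<union> Inr ` m0 ` K"
proof -
  have "m0 ` {1..n} = {1..n}" using bij0 by (simp add: bij_betw_def)
  moreover have "m0 ` ({1..n} - K) = m0 ` {1..n} - m0 ` K"
    using inj_on_image_set_diff[OF inj0] K by blast
  moreover have "m0 ` K \<subseteq> m0 ` {1..n}" using K by blast
  ultimately show ?thesis using K unfolding reduced_vertices_def special_vertices_eq
    by (auto simp: bip_vertices_def)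
qed

lemma md_split: "x \<in> {m0 i, m1 i} \<longleftrightarrow> x = md 0 i \<or> x = md 1 i"
  by (auto simp: md_def)

lemma md_m0K: "i \<in> K \<Longrightarrow> md d i \<in> m0 ` K"
  using md_in[of i d] by (auto simp: cls_def)

lemma reduced_edges_eq: "reduced_edges VV EE = {{Inl i, Inr (md d i)} | i d. i \<in> K}" (is "_ = ?R")
proof
  show "reduced_edges VV EE \<subseteq> ?R"
  proof
    fix e assume "e \<in> reduced_edges VV EE"
    then have e: "e \<in> EE" "e \<inter> special_vertices VV EE = {}" by (auto simp: reduced_edges_def)
    then obtain i x where ix: "e = {Inl i, Inr x}" "i \<in> {1..n}" "x \<in> Xs i"
      unfolding bip_edges_def by blast
    then have "i \<in> K" using e(2) unfolding special_vertices_eq by blast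
    note ix = ix this
    then have "x = md 0 i \<or> x = md 1 i" using XsK md_split by blast
    then show "e \<in> ?R" using ix by blast
  qed
  show "?R \<subseteq> reduced_edges VV EE"
  proof
    fix e assume "e \<in> ?R"
    then obtain i d where id: "e = {Inl i, Inr (md d i)}" "i \<in> K" by blast
    then have "e \<in> EE" using md_Xs K by (auto simp: bip_edge_mem)
    moreover obtain k where "k \<in> K" "md d i = m0 k" using md_m0K[OF id(2)] by blast
    then have "e \<inter> special_vertices VV EE = {}"
      using id m0_mem[of k "{1..n} - K"] K by (auto simp: special_vertices_eq)
    ultimately show "e \<in> reduced_edges VV EE" by (simp add: reduced_edges_def)
  qed
qed

definition cyc :: "nat \<Rightarrow> (nat + nat) set" where
  "cyc j = Inl ` cls j \<union> Inr ` m0 ` cls j"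

abbreviation "RV \<equiv> reduced_vertices VV EE"
abbreviation "RE \<equiv> reduced_edges VV EE"

text \<open>An element gets the number of the position that \<open>m0\<close> matches with it. Every
  edge of the reduced graph joins vertices of equal label, so labels are constant on
  components.\<close>

definition label :: "nat + nat \<Rightarrow> nat" where
  "label v = (case v of Inl i \<Rightarrow> c i | Inr x \<Rightarrow> c (inv_into K m0 x))"

lemma label_Inl [simp]: "label (Inl i) = c i" by (simp add: label_def)

lemma label_Inr [simp]: "i \<in> K \<Longrightarrow> label (Inr (m0 i)) = c i"
proof -
  assume "i \<in> K"
  moreover have "inj_on m0 K" using inj0 K inj_on_subset by blast
  ultimately show ?thesis by (simp add: label_def)
qed

lemma label_md: "i \<in> K \<Longrightarrow> label (Inr (md d i)) = c i"
  using md_in[of i d] by (auto simp: cls_def)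

text \<open>One direction is invariance of \<open>label\<close> along edges. For the other, a step
  from \<open>y\<close> to its successor \<open>z\<close> is realised by the two edges from
  \<open>Inl y\<close> through the common element \<open>Inr (m0 z)\<close> to \<open>Inl z\<close>,
  and \<open>conn\<close> provides a sequence of such steps.\<close>

lemma same_component:
  assumes u: "u \<in> RV" and v: "v \<in> RV"
  shows "(u, v) \<in> {(x, y). x \<in> RV \<and> y \<in> RV \<and> {x, y} \<in> RE}\<^sup>* \<longleftrightarrow> label u = label v" (is "_ \<in> ?A\<^sup>* \<longleftrightarrow> _")
proof
  assume "(u, v) \<in> ?A\<^sup>*"
  then show "label u = label v"
  proof induction
    case (step y z)
    then obtain i d where "i \<in> K" "{y, z} = {Inl i, Inr (md d i)}" by (auto simp: reduced_edges_eq)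
    then have "label y = label z" using label_md by (auto simp: doubleton_eq_iff)
    then show ?case using step by simp
  qed simp
next
  assume lab: "label u = label v"
  have "sym ?A" by (auto simp: sym_def insert_commute)
  then have sym: "sym (?A\<^sup>*)" by (rule sym_rtrancl)
  have edge: "(Inl i, Inr (md d i)) \<in> ?A" if "i \<in> K" for i d
    using that md_m0K by (auto simp: reduced_vertices_eq reduced_edges_eq)
  have LL: "(Inl i, Inl j) \<in> ?A\<^sup>*" if "i \<in> K" "j \<in> K" "c i = c j" for i j
    using conn[OF that]
  proof induction
    case (step y z)
    have "(Inl y, Inr (m0 z)) \<in> ?A" using edge[of y 1] step by (simp add: md_def)
    moreover have "(Inr (m0 z), Inl z) \<in> ?A" using edge[of z 0] step \<open>sym ?A\<close> by (auto simp: md_def dest: symD)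
    ultimately show ?case using step.IH by (meson rtrancl.rtrancl_into_rtrancl)
  qed simp
  have rep: "\<exists>i\<in>K. (w, Inl i) \<in> ?A\<^sup>* \<and> label w = c i" if w: "w \<in> RV" for w
  proof -
    from w consider i where "i \<in> K" "w = Inl i" | i where "i \<in> K" "w = Inr (m0 i)"
      by (auto simp: reduced_vertices_eq)
    then show ?thesis
    proof cases
      case 1 then show ?thesis by auto
    next
      case 2
      then have "(w, Inl i) \<in> ?A" using edge[of i 0] \<open>sym ?A\<close> by (auto simp: md_def dest: symD)
      then show ?thesis using 2 by auto
    qed
  qed
  obtain i where i: "i \<in> K" "(u, Inl i) \<in> ?A\<^sup>*" "label u = c i" using rep[OF u] by (elim bexE conjE)
  obtain j where j: "j \<in> K" "(v, Inl j) \<in> ?A\<^sup>*" "label v = c j" using rep[OF v] by (elim bexE conjE)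
  have "(Inl i, Inl j) \<in> ?A\<^sup>*" using LL[OF i(1) j(1)] i(3) j(3) lab by simp
  with i(2) have "(u, Inl j) \<in> ?A\<^sup>*" by (rule rtrancl_trans)
  moreover have "(Inl j, v) \<in> ?A\<^sup>*" using sym j(2) by (rule symD)
  ultimately show "(u, v) \<in> ?A\<^sup>*" by (rule rtrancl_trans)
qed

lemma cyc_eq: "cyc j = {v \<in> RV. label v = j}"
  by (auto simp: cyc_def cls_def reduced_vertices_eq)

lemma cycles_eq: "cycles VV EE = cyc ` {1..q}"
proof -
  let ?r = "{(u, v). u \<in> RV \<and> v \<in> RV \<and> (u, v) \<in> {(x, y). x \<in> RV \<and> y \<in> RV \<and> {x, y} \<in> RE}\<^sup>*}"
  have "?r `` {v} = cyc (label v)" if "v \<in> RV" for v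
    using that same_component by (auto simp: cyc_eq)
  then have "cycles VV EE = (\<lambda>v. cyc (label v)) ` RV"
    by (auto simp: cycles_def components_def quotient_def)
  also have "\<dots> = cyc ` (label ` RV)" by (simp add: image_image)
  also have "label ` RV = c ` K" by (auto simp: reduced_vertices_eq image_Un image_image)
  finally show ?thesis using range by simp
qed

lemma cls_ne: "j \<in> {1..q} \<Longrightarrow> cls j \<noteq> {}"
  unfolding range[symmetric] cls_def by blast

lemma cyc_inj: "inj_on cyc {1..q}"
proof (rule inj_onI)
  fix j k assume "j \<in> {1..q}" "cyc j = cyc k"
  obtain i where i: "i \<in> cls j" using cls_ne[OF \<open>j \<in> {1..q}\<close>] by blast
  then have "Inl i \<in> cyc k" unfolding \<open>cyc j = cyc k\<close>[symmetric] by (simp add: cyc_def)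
  with i show "j = k" by (auto simp: cyc_def cls_def)
qed

lemma num_cycles_eq: "num_cycles n EE = q"
  by (simp add: num_cycles_def cycles_eq card_image[OF cyc_inj])

definition mat :: "nat \<Rightarrow> nat \<Rightarrow> (nat + nat) set set" where
  "mat d j = {{Inl i, Inr (md d i)} | i. i \<in> cls j}"

lemma cycle_edges: "{e \<in> RE. e \<subseteq> cyc j} = {{Inl i, Inr (md d i)} | i d. i \<in> cls j}" (is "?L = ?R")
proof
  show "?L \<subseteq> ?R" by (auto simp: reduced_edges_eq cyc_eq cls_def)
  show "?R \<subseteq> ?L" using md_m0K by (auto simp: reduced_edges_eq cyc_eq cls_def label_md reduced_vertices_eq)
qed

lemma mat_perfect: "perfect_matching (cyc j) {e \<in> RE. e \<subseteq> cyc j} (mat d j)"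
  unfolding perfect_matching_def cycle_edges
proof (intro conjI ballI)
  show "mat d j \<subseteq> {{Inl i, Inr (md d i)} | i d. i \<in> cls j}" by (auto simp: mat_def)
  fix v assume v: "v \<in> cyc j"
  obtain i where i: "i \<in> cls j" "v = Inl i \<or> v = Inr (md d i)"
    using v bij_md[of d j] by (force simp: cyc_def bij_betw_def)
  show "\<exists>!e. e \<in> mat d j \<and> v \<in> e"
  proof (rule ex1I[of _ "{Inl i, Inr (md d i)}"])
    show "{Inl i, Inr (md d i)} \<in> mat d j \<and> v \<in> {Inl i, Inr (md d i)}"
      using i by (auto simp: mat_def)
    fix e assume "e \<in> mat d j \<and> v \<in> e"
    then obtain k where k: "k \<in> cls j" "e = {Inl k, Inr (md d k)}" "v \<in> {Inl k, Inr (md d k)}"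
      by (auto simp: mat_def)
    then have "k = i" using i bij_md[of d j] by (auto simp: bij_betw_def dest: inj_onD)
    then show "e = {Inl i, Inr (md d i)}" using k by simp
  qed
qed

text \<open>A perfect matching of the cycle uses exactly one of the two edges at each position. If
  it uses the \<open>m1\<close>-edge at \<open>y\<close>, the \<open>m0\<close>-edge at the
  successor of \<open>y\<close> is blocked, because the two share an element; so the successor uses
  its \<open>m1\<close>-edge as well, and by \<open>conn\<close> so do all positions.\<close>

lemma cycle_matchings_eq: "cycle_matchings VV EE (cyc j) = {mat 0 j, mat 1 j}"
proof
  show "{mat 0 j, mat 1 j} \<subseteq> cycle_matchings VV EE (cyc j)"
    using mat_perfect by (auto simp: cycle_matchings_def)
  show "cycle_matchings VV EE (cyc j) \<subseteq> {mat 0 j, mat 1 j}"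
  proof
    fix M assume "M \<in> cycle_matchings VV EE (cyc j)"
    then have "perfect_matching (cyc j) {e \<in> RE. e \<subseteq> cyc j} M" by (simp add: cycle_matchings_def)
    then have ME: "M \<subseteq> {{Inl i, Inr (md d i)} | i d. i \<in> cls j}"
      and u: "\<And>v. v \<in> cyc j \<Longrightarrow> \<exists>!e. e \<in> M \<and> v \<in> e"
      unfolding perfect_matching_def cycle_edges by blast+
    have ME': "\<exists>i\<in>cls j. e = {Inl i, Inr (md 0 i)} \<or> e = {Inl i, Inr (md 1 i)}" if h: "e \<in> M" for e
    proof -
      obtain i d where "i \<in> cls j" "e = {Inl i, Inr (md d i)}" using ME h by blast
      moreover have "md d i = md 0 i \<or> md d i = md 1 i" by (simp add: md_def)
      ultimately show ?thesis by metis
    qed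
    have either: "{Inl i, Inr (md 0 i)} \<in> M \<longleftrightarrow> {Inl i, Inr (md 1 i)} \<notin> M" if i: "i \<in> cls j" for i
    proof -
      have v: "Inl i \<in> cyc j" using i by (simp add: cyc_def)
      obtain e where e: "e \<in> M" "Inl i \<in> e" using u[OF v] by blast
      then have "e = {Inl i, Inr (md 0 i)} \<or> e = {Inl i, Inr (md 1 i)}" using ME'[OF e(1)] by auto
      moreover have "md 0 i \<noteq> md 1 i" using ne i by (simp add: md_def cls_def)
      then have "\<not> ({Inl i, Inr (md 0 i)} \<in> M \<and> {Inl i, Inr (md 1 i)} \<in> M)"
        using u[OF v] by (metis bip_edge_eq insertI1)
      ultimately show ?thesis using e(1) by metis
    qed
    show "M \<in> {mat 0 j, mat 1 j}"
    proof (cases "\<exists>i\<in>cls j. {Inl i, Inr (md 1 i)} \<in> M")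
      case True
      then obtain i where i: "i \<in> cls j" "{Inl i, Inr (md 1 i)} \<in> M" by blast
      have all: "{Inl k, Inr (md 1 k)} \<in> M" if k: "k \<in> cls j" for k
      proof -
        have "(i, k) \<in> {(x, y). x \<in> K \<and> y \<in> K \<and> m0 y = m1 x}\<^sup>*"
          using i k by (intro conn) (auto simp: cls_def)
        then have "k \<in> cls j \<and> {Inl k, Inr (md 1 k)} \<in> M"
        proof induction
          case base then show ?case using i by simp
        next
          case (step y z)
          then have yz: "y \<in> K" "z \<in> K" "m0 z = m1 y" "c y = j" by (auto simp: cls_def)
          obtain z' where z': "z' \<in> K" "m0 z' = m1 y" "c z' = c y" using nxt[OF yz(1)] by blast
          then have "z = z'" using yz(2,3) inj_onD[OF inj0, of z z'] K by (simp add: subset_eq)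
          then have "c z = c y" using z' by simp
          then have z: "z \<in> cls j" using yz by (simp add: cls_def)
          have "y \<noteq> z" using yz ne by metis
          have "{Inl z, Inr (md 0 z)} \<notin> M"
          proof
            assume "{Inl z, Inr (md 0 z)} \<in> M"
            moreover have "Inr (m0 z) \<in> cyc j" using z by (simp add: cyc_def)
            moreover have "{Inl y, Inr (md 1 y)} \<in> M" using step by simp
            moreover have "md 0 z = m0 z" "md 1 y = m0 z" using yz by (auto simp: md_def)
            ultimately have "{Inl z, Inr (md 0 z)} = {Inl y, Inr (md 1 y)}" using u[of "Inr (m0 z)"] by (metis insertI1 insertI2)
            then show False using \<open>y \<noteq> z\<close> by (simp add: bip_edge_eq)
          qed
          then show ?case using either[OF z] z by simp
        qed
        then show ?thesis by simp
      qed
      have "M = mat 1 j"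
      proof
        show "mat 1 j \<subseteq> M" using all by (auto simp: mat_def)
        show "M \<subseteq> mat 1 j"
        proof
          fix e assume "e \<in> M"
          from ME'[OF this] obtain k where "k \<in> cls j" "e = {Inl k, Inr (md 1 k)}"
            using either all \<open>e \<in> M\<close> by metis
          then show "e \<in> mat 1 j" by (auto simp: mat_def)
        qed
      qed
      then show ?thesis by simp
    next
      case False
      then have "M = mat 0 j"
      proof (intro equalityI)
        show "mat 0 j \<subseteq> M" using either False by (auto simp: mat_def)
        show "M \<subseteq> mat 0 j"
        proof
          fix e assume "e \<in> M"
          from ME'[OF this] obtain k where "k \<in> cls j" "e = {Inl k, Inr (md 0 k)}"
            using False \<open>e \<in> M\<close> by metis
          then show "e \<in> mat 0 j" by (auto simp: mat_def)
        qed
      qed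
      then show ?thesis by simp
    qed
  qed
qed

lemma cycle_numbering:
  assumes w: "\<And>d j. j \<in> {1..q} \<Longrightarrow> d \<in> {0, 1} \<Longrightarrow> w d j = mat d j"
  shows "cycle_numbering n EE w"
  unfolding cycle_numbering_def num_cycles_eq
proof (intro exI conjI ballI)
  show "bij_betw cyc {1..q} (cycles VV EE)" by (simp add: bij_betw_def cyc_inj cycles_eq)
  fix j assume j: "j \<in> {1..q}"
  then show "cycle_matchings VV EE (cyc j) = {w 0 j, w 1 j}" by (simp add: cycle_matchings_eq w)
  obtain i where i: "i \<in> cls j" using cls_ne[OF j] by blast
  have "{Inl i, Inr (md 0 i)} \<in> mat 0 j" using i by (auto simp: mat_def)
  moreover have "{Inl i, Inr (md 0 i)} \<notin> mat 1 j"
  proof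
    assume "{Inl i, Inr (md 0 i)} \<in> mat 1 j"
    then have "md 0 i = md 1 i" by (auto simp: mat_def doubleton_eq_iff)
    then show False using ne i by (auto simp: md_def cls_def)
  qed
  ultimately show "w 0 j \<noteq> w 1 j" using j by (auto simp: w)
qed

lemma solution_of_eq:
  assumes w: "\<And>d j. j \<in> {1..q} \<Longrightarrow> d \<in> {0, 1} \<Longrightarrow> w d j = mat d j" and \<delta>: "\<delta> \<in> vectors q"
  shows "solution_of n Xs w \<delta> = sel \<delta>"
proof -
  have cK: "c i \<in> {1..q}" if "i \<in> K" for i using range that by blast
  have "matching_of n (sel \<delta>) = {{Inl i, Inr (m0 i)} | i. i \<in> {1..n} - K} \<union> (\<Union>j\<in>{1..q}. mat (\<delta> j) j)"
    (is "?L = ?A \<union> ?B")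
  proof
    show "?L \<subseteq> ?A \<union> ?B"
    proof
      fix e assume "e \<in> ?L"
      then obtain i where i: "i \<in> {1..n}" "e = {Inl i, Inr (sel \<delta> i)}" by (auto simp: matching_of_def)
      show "e \<in> ?A \<union> ?B"
      proof (cases "i \<in> K")
        case True
        then have "e \<in> mat (\<delta> (c i)) (c i)" using i by (auto simp: mat_def sel_def cls_def)
        then show ?thesis using cK[OF True] by blast
      qed (use i in \<open>auto simp: sel_def\<close>)
    qed
    show "?A \<union> ?B \<subseteq> ?L"
    proof
      fix e assume "e \<in> ?A \<union> ?B"
      then obtain i where "i \<in> {1..n}" "e = {Inl i, Inr (sel \<delta> i)}"
      proof
        assume "e \<in> ?A"
        then obtain i where "i \<in> {1..n} - K" "e = {Inl i, Inr (m0 i)}" by blast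
        then show thesis using that[of i] by (simp add: sel_def)
      next
        assume "e \<in> ?B"
        then obtain j i where "i \<in> cls j" "e = {Inl i, Inr (md (\<delta> j) i)}" by (auto simp: mat_def)
        then show thesis using that[of i] K by (auto simp: sel_def cls_def)
      qed
      then show "e \<in> ?L" by (auto simp: matching_of_def)
    qed
  qed
  moreover have "(\<Union>j\<in>{1..q}. w (\<delta> j) j) = ?B"
    using \<delta> by (intro SUP_cong refl w) (auto simp: vectors_def PiE_def Pi_def)
  ultimately have eq: "matching_of n (sel \<delta>) =
      special_edges VV EE \<union> (\<Union>j\<in>{1..num_cycles n EE}. w (\<delta> j) j)"
    by (simp add: special_edges_eq num_cycles_eq)
  show ?thesis unfolding solution_of_def
  proof (rule the_equality)
    show "sel \<delta> \<in> solutions n Xs \<and> matching_of n (sel \<delta>) =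
      special_edges VV EE \<union> (\<Union>j\<in>{1..num_cycles n EE}. w (\<delta> j) j)" using eq sel_solution by blast
    fix f assume "f \<in> solutions n Xs \<and> matching_of n f =
      special_edges VV EE \<union> (\<Union>j\<in>{1..num_cycles n EE}. w (\<delta> j) j)"
    then show "f = sel \<delta>" using eq sel_solution[of \<delta>]
      by (intro matching_of_inj[of n]) (auto simp: solutions_def)
  qed
qed

text \<open>Every cycle contains a position, and the element chosen there reveals the coordinate of
  the vector since \<open>m0\<close> and \<open>m1\<close> differ on \<open>K\<close>.\<close>

lemma card_solutions: "2 ^ q \<le> card (solutions n Xs)"
proof -
  have "inj_on sel (vectors q)"
  proof (rule inj_onI)
    fix \<delta> \<delta>' assume d: "\<delta> \<in> vectors q" "\<delta>' \<in> vectors q" "sel \<delta> = sel \<delta>'"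
    show "\<delta> = \<delta>'"
    proof (rule PiE_ext)
      show "\<delta> \<in> {1..q} \<rightarrow>\<^sub>E {0, 1}" "\<delta>' \<in> {1..q} \<rightarrow>\<^sub>E {0, 1}" using d by (simp_all add: vectors_def)
      fix j assume j: "j \<in> {1..q}"
      then obtain i where i: "i \<in> K" "c i = j" using cls_ne by (auto simp: cls_def)
      then have "md (\<delta> j) i = md (\<delta>' j) i" using fun_cong[OF d(3), of i] K by (auto simp: sel_def)
      moreover have "\<delta> j \<in> {0, 1}" "\<delta>' j \<in> {0, 1}" using d j by (auto simp: vectors_def)
      ultimately show "\<delta> j = \<delta>' j" using ne[OF i(1)] by (auto simp: md_def)
    qed
  qed
  then have "card (vectors q) \<le> card (solutions n Xs)"
    using sel_solution finite_solutions by (intro card_inj_on_le) auto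
  then show ?thesis by (simp add: vectors_def card_PiE numeral_2_eq_2)
qed

end

section \<open>Almost all feasible graphs have few cycles\<close>

definition self_maps :: "nat \<Rightarrow> (nat \<Rightarrow> nat) set" where
  "self_maps n = {1..n} \<rightarrow>\<^sub>E {1..n}"

definition rooted_maps :: "nat \<Rightarrow> (nat \<Rightarrow> nat) set" where
  "rooted_maps n = {t \<in> self_maps n. \<exists>r\<in>{1..n}. t r = r \<and> (\<forall>x\<in>{1..n}. \<exists>k. (t ^^ k) x = r)}"

lemma self_maps_in: "g \<in> self_maps n \<Longrightarrow> x \<in> {1..n} \<Longrightarrow> g x \<in> {1..n}"
  by (auto simp: self_maps_def)

lemma self_maps_funpow: "g \<in> self_maps n \<Longrightarrow> x \<in> {1..n} \<Longrightarrow> (g ^^ k) x \<in> {1..n}"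
  by (induction k) (use self_maps_in in auto)

section \<open>Periodic points and Joyal's encoding\<close>

definition periodic :: "nat \<Rightarrow> (nat \<Rightarrow> nat) \<Rightarrow> nat set" where
  "periodic n g = {x \<in> {1..n}. \<exists>k>0. (g ^^ k) x = x}"

lemma finite_periodic [simp]: "finite (periodic n g)"
  by (simp add: periodic_def)

lemma funpow_mult_fixed:
  fixes g :: "'a \<Rightarrow> 'a"
  assumes "(g ^^ k) x = x"
  shows "(g ^^ (k * m)) x = x"
  by (induction m) (use assms in \<open>auto simp: funpow_add\<close>)

lemma periodic_bij:
  assumes g: "g \<in> self_maps n"
  shows "bij_betw g (periodic n g) (periodic n g)"
proof -
  have sub: "g ` periodic n g \<subseteq> periodic n g"
  proof
    fix y assume "y \<in> g ` periodic n g"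
    then obtain x k where x: "y = g x" "x \<in> {1..n}" "k > 0" "(g ^^ k) x = x" by (auto simp: periodic_def)
    then have "(g ^^ k) y = y" by (metis funpow_swap1)
    then show "y \<in> periodic n g" using x self_maps_in[OF g] by (auto simp: periodic_def)
  qed
  have "inj_on g (periodic n g)"
  proof (rule inj_onI)
    fix x y assume "x \<in> periodic n g" "y \<in> periodic n g" and e: "g x = g y"
    then obtain k l where k: "k > 0" "(g ^^ k) x = x" and l: "l > 0" "(g ^^ l) y = y"
      by (auto simp: periodic_def)
    \<comment> \<open>\<open>k * l\<close> is a period of both points. It is positive, so one
      application of \<open>g\<close> can be split off, and there the orbits merge because
      \<open>g x = g y\<close>.\<close>
    obtain m where m: "k * l = Suc m" using k(1) l(1) by (metis nat_0_less_mult_iff gr0_implies_Suc)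
    have "x = (g ^^ Suc m) x" using funpow_mult_fixed[OF k(2), of l] m by simp
    also have "\<dots> = (g ^^ m) (g x)" by (simp add: funpow_swap1)
    also have "\<dots> = (g ^^ Suc m) y" by (simp add: funpow_swap1 e)
    also have "\<dots> = y" using funpow_mult_fixed[OF l(2), of k] m by (simp add: mult.commute)
    finally show "x = y" .
  qed
  then show ?thesis using sub by (simp add: bij_betw_def endo_inj_surj)
qed

lemma reaches_periodic:
  assumes g: "g \<in> self_maps n" and x: "x \<in> {1..n}"
  shows "\<exists>k. (g ^^ k) x \<in> periodic n g"
proof -
  have "\<not> inj_on (\<lambda>k. (g ^^ k) x) {0..n}"
  proof
    assume "inj_on (\<lambda>k. (g ^^ k) x) {0..n}"
    then have "card {0..n} \<le> card {1..n}"
      using self_maps_funpow[OF g x] by (intro card_inj_on_le[where f = "\<lambda>k. (g ^^ k) x"]) auto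
    then show False by simp
  qed
  then obtain i j where ij: "i < j" "(g ^^ i) x = (g ^^ j) x"
    by (metis (lifting) inj_onI linorder_neqE_nat)
  have "(g ^^ (j - i)) ((g ^^ i) x) = (g ^^ (j - i + i)) x" by (simp only: funpow_add comp_apply)
  then have "(g ^^ (j - i)) ((g ^^ i) x) = (g ^^ i) x" using ij by simp
  then have "(g ^^ i) x \<in> periodic n g"
    using ij(1) self_maps_funpow[OF g x] by (auto simp: periodic_def intro!: exI[of _ "j - i"])
  then show ?thesis ..
qed

text \<open>Joyal's encoding: the permutation that \<open>g\<close> induces on its periodic points is written in
  one-line notation, and this word is turned into a path that ends in the root.\<close>

definition word :: "nat \<Rightarrow> (nat \<Rightarrow> nat) \<Rightarrow> nat list" where
  "word n g = map g (sorted_list_of_set (periodic n g))"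

definition straighten :: "nat \<Rightarrow> (nat \<Rightarrow> nat) \<Rightarrow> nat \<Rightarrow> nat" where
  "straighten n g x = (if x \<in> periodic n g
     then (let w = word n g; j = (THE j. j < length w \<and> w ! j = x) in w ! min (Suc j) (length w - 1))
     else g x)"

lemma word_props:
  assumes g: "g \<in> self_maps n" and n: "n \<ge> 1"
  shows "set (word n g) = periodic n g" "distinct (word n g)" "word n g \<noteq> []"
    "length (word n g) = card (periodic n g)"
proof -
  show "set (word n g) = periodic n g" "distinct (word n g)"
    using periodic_bij[OF g] by (auto simp: word_def bij_betw_def distinct_map)
  have "1 \<in> {1..n}" using n by simp
  then have "periodic n g \<noteq> {}" using reaches_periodic[OF g] by blast
  then show "word n g \<noteq> []" by (simp add: word_def)
  show "length (word n g) = card (periodic n g)" by (simp add: word_def)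
qed

lemma straighten_word:
  assumes g: "g \<in> self_maps n" and n: "n \<ge> 1" and j: "j < length (word n g)"
  shows "straighten n g (word n g ! j) = word n g ! min (Suc j) (length (word n g) - 1)"
proof -
  have "(THE i. i < length (word n g) \<and> word n g ! i = word n g ! j) = j"
    using word_props(2)[OF g n] j by (intro the_equality) (auto simp: nth_eq_iff_index_eq)
  then show ?thesis
    using word_props(1)[OF g n] nth_mem[OF j] by (simp add: straighten_def Let_def)
qed

lemma min_last: "k < L \<Longrightarrow> min k (L - 1) = (k::nat)"
  by linarith

lemma straighten_funpow:
  assumes g: "g \<in> self_maps n" and n: "n \<ge> 1" and j: "j < length (word n g)"
  shows "(straighten n g ^^ k) (word n g ! j) = word n g ! min (j + k) (length (word n g) - 1)"
proof (induction k)
  case 0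
  have "min j (length (word n g) - 1) = j" using j by linarith
  then show ?case by simp
next
  case (Suc k)
  have "min (j + k) (length (word n g) - 1) < length (word n g)" using j by linarith
  moreover have "min (Suc (min (j + k) (length (word n g) - 1))) (length (word n g) - 1)
      = min (j + Suc k) (length (word n g) - 1)" by linarith
  ultimately show ?case using straighten_word[OF g n] Suc by simp
qed

text \<open>The last letter of the word is the root: the cut-off by \<open>min\<close> makes it a
  fixed point, and the other letters move one place to the right.\<close>

lemma straighten_rooted:
  assumes g: "g \<in> self_maps n" and n: "n \<ge> 1"
  shows "straighten n g \<in> rooted_maps n"
proof -
  let ?w = "word n g" and ?t = "straighten n g"
  note wp = word_props[OF g n]
  have wn: "?w ! j \<in> {1..n}" if "j < length ?w" for j
    using nth_mem[OF that] wp(1) by (auto simp: periodic_def)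
  have L: "length ?w - 1 < length ?w" using wp(3) by (simp add: length_greater_0_conv)
  have tw: "?t x \<in> {1..n}" if x: "x \<in> {1..n}" for x
  proof (cases "x \<in> periodic n g")
    case True
    then obtain j where j: "j < length ?w" "?w ! j = x" using wp(1) by (metis in_set_conv_nth)
    then show ?thesis using straighten_word[OF g n j(1)] wn[of "min (Suc j) (length ?w - 1)"] L by simp
  next
    case False then show ?thesis using self_maps_in[OF g x] by (simp add: straighten_def)
  qed
  have "?t x = undefined" if "x \<notin> {1..n}" for x
    using that g by (auto simp: straighten_def periodic_def self_maps_def)
  then have sm: "?t \<in> self_maps n" using tw by (auto simp: self_maps_def)
  let ?r = "?w ! (length ?w - 1)"
  have "?t ?r = ?r" using straighten_word[OF g n L] L by (simp add: min_def)
  moreover have "\<exists>k. (?t ^^ k) x = ?r" if x: "x \<in> {1..n}" for x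
  proof -
    \<comment> \<open>Up to its first periodic point the orbit of \<open>x\<close> is the same under
      both maps; from there on it runs along the word to the last letter.\<close>
    define k where "k = (LEAST k. (g ^^ k) x \<in> periodic n g)"
    have kp: "(g ^^ k) x \<in> periodic n g" using reaches_periodic[OF g x] unfolding k_def by (rule LeastI_ex)
    have "(?t ^^ i) x = (g ^^ i) x" if "i \<le> k" for i
      using that
    proof (induction i)
      case (Suc i)
      then have "(g ^^ i) x \<notin> periodic n g" using not_less_Least[of i "\<lambda>k. (g ^^ k) x \<in> periodic n g"] by (auto simp: k_def)
      then show ?case using Suc by (simp add: straighten_def)
    qed simp
    then obtain j where j: "j < length ?w" "?w ! j = (?t ^^ k) x"
      using kp wp(1) by (metis in_set_conv_nth order_refl)
    have "(?t ^^ (length ?w)) ((?t ^^ k) x) = ?r"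
      using straighten_funpow[OF g n j(1), of "length ?w"] j by simp
    then have "(?t ^^ (length ?w + k)) x = ?r" by (simp add: funpow_add)
    then show ?thesis ..
  qed
  ultimately show ?thesis using sm wn[OF L] by (auto simp: rooted_maps_def)
qed

text \<open>Decoding: the orbit of the head under the straightened map spells out the word and so
  gives the set of periodic points. Listing this set in increasing order above the word recovers
  \<open>g\<close> on it, and elsewhere \<open>g\<close> was not changed. The head is the extra
  datum that costs the factor n.\<close>

lemma straighten_inj:
  assumes n: "n \<ge> 1"
  shows "inj_on (\<lambda>g. (straighten n g, hd (word n g))) (self_maps n)"
proof (rule inj_onI)
  fix g h assume g: "g \<in> self_maps n" and h: "h \<in> self_maps n"
    and "(straighten n g, hd (word n g)) = (straighten n h, hd (word n h))"
  then have t: "straighten n g = straighten n h" and v: "word n g ! 0 = word n h ! 0"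
    using word_props(3)[OF g n] word_props(3)[OF h n] by (auto simp: hd_conv_nth)
  have orbit: "periodic n g = (\<lambda>k. (straighten n g ^^ k) (word n g ! 0)) ` UNIV" if g: "g \<in> self_maps n" for g
  proof -
    have p: "0 < length (word n g)" using word_props(3)[OF g n] by simp
    have "(\<lambda>k. (straighten n g ^^ k) (word n g ! 0)) ` UNIV = set (word n g)" (is "?I = _")
    proof
      have "min k (length (word n g) - 1) < length (word n g)" for k using p by linarith
      then show "?I \<subseteq> set (word n g)" by (auto simp: straighten_funpow[OF g n p] intro!: nth_mem)
      show "set (word n g) \<subseteq> ?I"
      proof
        fix x assume "x \<in> set (word n g)"
        then obtain k where "k < length (word n g)" "x = word n g ! k" by (metis in_set_conv_nth)
        then have "x = (straighten n g ^^ k) (word n g ! 0)"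
          by (simp add: straighten_funpow[OF g n p] min_last)
        then show "x \<in> ?I" by blast
      qed
    qed
    then show ?thesis using word_props(1)[OF g n] by simp
  qed
  have C: "periodic n g = periodic n h" using orbit[OF g] orbit[OF h] t v by simp
  have W: "word n g = word n h"
  proof (rule nth_equalityI)
    show len: "length (word n g) = length (word n h)" using word_props(4)[OF g n] word_props(4)[OF h n] C by simp
    fix k assume k: "k < length (word n g)"
    have p: "0 < length (word n g)" "0 < length (word n h)" using k len by auto
    have "word n g ! k = (straighten n g ^^ k) (word n g ! 0)"
      using k by (simp add: straighten_funpow[OF g n p(1)] min_last)
    also have "\<dots> = (straighten n h ^^ k) (word n h ! 0)" using t v by simp
    also have "\<dots> = word n h ! k" using k len by (simp add: straighten_funpow[OF h n p(2)] min_last)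
    finally show "word n g ! k = word n h ! k" .
  qed
  show "g = h"
  proof
    fix x show "g x = h x"
    proof (cases "x \<in> periodic n g")
      case True
      then have "x \<in> set (sorted_list_of_set (periodic n g))" by simp
      with W C show ?thesis by (simp add: word_def map_eq_conv)
    next
      case False
      then show ?thesis using fun_cong[OF t, of x] C by (simp add: straighten_def)
    qed
  qed
qed

lemma card_self_maps: "card (self_maps n) = n ^ n"
  by (simp add: self_maps_def card_PiE)

lemma finite_self_maps: "finite (self_maps n)"
  by (auto simp: self_maps_def intro: finite_PiE)

lemma finite_rooted_maps: "finite (rooted_maps n)"
  using finite_self_maps by (simp add: rooted_maps_def)

lemma card_rooted_maps:
  assumes n: "n \<ge> 1"
  shows "n ^ n \<le> n * card (rooted_maps n)"
proof -
  have "card (self_maps n) \<le> card (rooted_maps n \<times> {1..n})"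
  proof (rule card_inj_on_le[OF straighten_inj[OF n]])
    have "hd (word n g) \<in> {1..n}" if "g \<in> self_maps n" for g
      using word_props(1,3)[OF that n] hd_in_set[of "word n g"] by (auto simp: periodic_def)
    then show "(\<lambda>g. (straighten n g, hd (word n g))) ` self_maps n \<subseteq> rooted_maps n \<times> {1..n}"
      using straighten_rooted[OF _ n] by auto
  qed (simp add: finite_rooted_maps)
  then show ?thesis by (simp add: card_self_maps card_cartesian_product mult.commute)
qed

section \<open>Graphs as pairs of a bijection and a self-map\<close>

definition bijections :: "nat \<Rightarrow> (nat \<Rightarrow> nat) set" where
  "bijections n = {f \<in> extensional {1..n}. bij_betw f {1..n} {1..n}}"

lemma bijections_sub: "bijections n \<subseteq> self_maps n"
  by (auto simp: bijections_def self_maps_def bij_betw_def PiE_def)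

lemma finite_bijections: "finite (bijections n)"
  using bijections_sub finite_self_maps by (rule finite_subset)

lemma bip_edges_eq_iff: "bip_edges n Xs = bip_edges n Ys \<longleftrightarrow> (\<forall>i\<in>{1..n}. Xs i = Ys i)"
proof
  assume e: "bip_edges n Xs = bip_edges n Ys"
  show "\<forall>i\<in>{1..n}. Xs i = Ys i"
  proof
    fix i assume i: "i \<in> {1..n}"
    have "x \<in> Xs i \<longleftrightarrow> x \<in> Ys i" for x
      using i arg_cong[OF e, of "\<lambda>E. {Inl i, Inr x} \<in> E"] by (simp add: bip_edge_mem)
    then show "Xs i = Ys i" by blast
  qed
next
  assume "\<forall>i\<in>{1..n}. Xs i = Ys i"
  then show "bip_edges n Xs = bip_edges n Ys" unfolding bip_edges_def by blast
qed

lemma solutions_cong: "bip_edges n Xs = bip_edges n Ys \<Longrightarrow> solutions n Xs = solutions n Ys"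
  by (auto simp: bip_edges_eq_iff solutions_def)

definition pair_instance :: "(nat \<Rightarrow> nat) \<Rightarrow> (nat \<Rightarrow> nat) \<Rightarrow> nat \<Rightarrow> nat set" where
  "pair_instance f g i = {f i, g (f i)}"

lemma pair_instance_feasible:
  assumes f: "f \<in> bijections n" and g: "g \<in> self_maps n"
  shows "f \<in> solutions n (pair_instance f g)" "feasible n (pair_instance f g)"
proof -
  show s: "f \<in> solutions n (pair_instance f g)"
    using f by (auto simp: solutions_def bijections_def pair_instance_def)
  have "pair_instance f g i \<subseteq> {1..n} \<and> 1 \<le> card (pair_instance f g i) \<and> card (pair_instance f g i) \<le> 2"
    if "i \<in> {1..n}" for i
    using self_maps_in[OF g] solutions_in[OF s that] by (auto simp: pair_instance_def card_insert_if)
  then show "feasible n (pair_instance f g)" using s by (auto simp: feasible_def requisitions_def)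
qed

text \<open>A deviation from \<open>f\<close> propagates. If \<open>h\<close> does not take
  \<open>f i\<close>, it takes \<open>t (f i)\<close>, so the position to which \<open>f\<close>
  assigns that element has to deviate too. Following \<open>t\<close> in this way leads to the root,
  where \<open>t r = r\<close> leaves no alternative.\<close>

lemma rooted_unique:
  assumes f: "f \<in> bijections n" and t: "t \<in> rooted_maps n" and h: "h \<in> solutions n (pair_instance f t)"
  shows "h = f"
proof -
  obtain r where r: "t r = r" "\<And>x. x \<in> {1..n} \<Longrightarrow> \<exists>k. (t ^^ k) x = r"
    using t by (auto simp: rooted_maps_def)
  have tm: "t \<in> self_maps n" using t by (simp add: rooted_maps_def)
  have fb: "f ` {1..n} = {1..n}" "inj_on f {1..n}" using f by (auto simp: bijections_def bij_betw_def)
  have hi: "inj_on h {1..n}" and hX: "\<And>i. i \<in> {1..n} \<Longrightarrow> h i = f i \<or> h i = t (f i)"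
    using h by (auto simp: solutions_def pair_instance_def bij_betw_def)
  have "h i = f i" if i: "i \<in> {1..n}" for i
  proof (rule ccontr)
    assume ne: "h i \<noteq> f i"
    have chain: "\<exists>j\<in>{1..n}. f j = (t ^^ k) (f i) \<and> h j \<noteq> f j" for k
    proof (induction k)
      case 0 then show ?case using ne i by auto
    next
      case (Suc k)
      then obtain j where j: "j \<in> {1..n}" "f j = (t ^^ k) (f i)" "h j \<noteq> f j" by blast
      then have hj: "h j = t (f j)" using hX by blast
      have "t (f j) \<in> {1..n}" using j fb self_maps_in[OF tm] by blast
      then obtain l where l: "l \<in> {1..n}" "f l = t (f j)" using fb(1) by (metis imageE)
      have "h l \<noteq> f l"
      proof
        assume "h l = f l"
        then have "l = j" using hj l j inj_onD[OF hi] by metis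
        then show False using l hj j by metis
      qed
      then show ?case using l j by auto
    qed
    obtain k where k: "(t ^^ k) (f i) = r" using r(2) fb(1) i by blast
    from chain[of k] obtain j where "j \<in> {1..n}" "f j = r" "h j \<noteq> f j" using k by auto
    then show False using hX[of j] r(1) by auto
  qed
  then show ?thesis using f h
    by (intro extensionalityI[of h "{1..n}" f]) (auto simp: bijections_def solutions_def)
qed

lemma finite_feasible_graphs: "finite (feasible_graphs n)"
proof (rule finite_subset)
  show "feasible_graphs n \<subseteq> Pow ((\<lambda>(i, x). {Inl i, Inr x}) ` ({1..n} \<times> {1..n}))"
    unfolding feasible_graphs_def bip_edges_def feasible_def requisitions_def by fast
qed simp

text \<open>A graph built from a rooted map determines both parts: \<open>f\<close> is its only
  solution, and then \<open>t x\<close> is read off from the requisition of the position that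
  \<open>f\<close> sends to \<open>x\<close>.\<close>

lemma feasible_graphs_lower: "card (bijections n) * card (rooted_maps n) \<le> card (feasible_graphs n)"
proof -
  have sub: "rooted_maps n \<subseteq> self_maps n" by (auto simp: rooted_maps_def)
  have "inj_on (\<lambda>(f, t). bip_edges n (pair_instance f t)) (bijections n \<times> rooted_maps n)"
  proof (rule inj_onI, clarify)
    fix f t f' t'
    assume ft: "f \<in> bijections n" "t \<in> rooted_maps n" "f' \<in> bijections n" "t' \<in> rooted_maps n"
      and e: "bip_edges n (pair_instance f t) = bip_edges n (pair_instance f' t')"
    have "f \<in> solutions n (pair_instance f' t')"
      using pair_instance_feasible(1)[OF ft(1)] ft(2) sub solutions_cong[OF e] by blast
    then have ff: "f = f'" using rooted_unique[OF ft(3,4)] by simp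
    have "t x = t' x" if x: "x \<in> {1..n}" for x
    proof -
      obtain i where "i \<in> {1..n}" "x = f i" using ft(1) x unfolding bijections_def bij_betw_def by blast
      then have "{x, t x} = {x, t' x}" using e ff by (auto simp: bip_edges_eq_iff pair_instance_def)
      then show ?thesis by (auto simp: doubleton_eq_iff)
    qed
    then have "t = t'" using ft sub
      by (intro extensionalityI[of t "{1..n}"]) (auto simp: rooted_maps_def self_maps_def PiE_def)
    with ff show "f = f' \<and> t = t'" by simp
  qed
  moreover have "(\<lambda>(f, t). bip_edges n (pair_instance f t)) ` (bijections n \<times> rooted_maps n) \<subseteq> feasible_graphs n"
    using pair_instance_feasible(2) sub by (fastforce simp: feasible_graphs_def)
  ultimately have "card (bijections n \<times> rooted_maps n) \<le> card (feasible_graphs n)"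
    using finite_feasible_graphs by (rule card_inj_on_le)
  then show ?thesis by (simp add: card_cartesian_product)
qed

text \<open>Members of \<open>feasible_graphs\<close> are bare edge sets; this recovers requisitions
  from them, which is what \<open>solutions\<close> needs.\<close>

definition inst :: "(nat + nat) set set \<Rightarrow> nat \<Rightarrow> nat set" where
  "inst E i = {x. {Inl i, Inr x} \<in> E}"

lemma bip_edges_inst: "bip_edges n (inst (bip_edges n Xs)) = bip_edges n Xs"
  by (auto simp: bip_edges_eq_iff inst_def bip_edge_mem)

text \<open>A second element of the requisition of \<open>i\<close> becomes the image of
  \<open>f i\<close> under \<open>g\<close>; for a singleton, \<open>f i\<close> becomes a fixed
  point. This defines \<open>g\<close> on every element because \<open>f\<close> is
  surjective.\<close>

lemma solution_pair_instance:
  assumes X: "feasible n Xs" and f: "f \<in> solutions n Xs"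
  shows "\<exists>g\<in>self_maps n. bip_edges n Xs = bip_edges n (pair_instance f g)"
proof -
  have f': "f ` {1..n} = {1..n}" "inj_on f {1..n}" "\<And>i. i \<in> {1..n} \<Longrightarrow> f i \<in> Xs i"
    using f by (auto simp: solutions_def bij_betw_def)
  have "\<exists>y\<in>{1..n}. Xs i = {f i, y}" if i: "i \<in> {1..n}" for i
  proof -
    have c: "Xs i \<subseteq> {1..n}" "card (Xs i) \<le> 2" using X i by (auto simp: feasible_def requisitions_def)
    then have fin: "finite (Xs i)" using finite_subset by blast
    have "card (Xs i - {f i}) \<le> 1" using c f'(3)[OF i] fin by simp
    moreover have "finite (Xs i - {f i})" using fin by simp
    ultimately consider "Xs i - {f i} = {}" | y where "Xs i - {f i} = {y}"
      by (metis card_1_singletonE card_0_eq le_neq_implies_less less_one)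
    then show ?thesis
    proof cases
      case 1 then have "Xs i = {f i, f i}" using f'(3)[OF i] by blast
      then show ?thesis using c(1) f'(3)[OF i] by blast
    next
      case 2 then have "Xs i = {f i, y}" "y \<in> {1..n}" using f'(3)[OF i] c(1) by blast+
      then show ?thesis by blast
    qed
  qed
  then obtain y where y: "\<And>i. i \<in> {1..n} \<Longrightarrow> y i \<in> {1..n} \<and> Xs i = {f i, y i}" by metis
  define g where "g = (\<lambda>x\<in>{1..n}. y (inv_into {1..n} f x))"
  have "g (f i) = y i" if "i \<in> {1..n}" for i
    using that f' by (auto simp: g_def)
  then have "bip_edges n Xs = bip_edges n (pair_instance f g)"
    using y by (auto simp: bip_edges_eq_iff pair_instance_def)
  moreover have "g x \<in> {1..n}" if "x \<in> {1..n}" for x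
    using y[OF inv_into_into[of x f "{1..n}"]] that f'(1) by (simp add: g_def)
  then have "g \<in> self_maps n" by (auto simp: self_maps_def g_def)
  ultimately show ?thesis by blast
qed

text \<open>Double counting of the pairs of a graph and one of its solutions.\<close>

lemma feasible_graphs_upper:
  assumes many: "\<And>Xs. feasible n Xs \<Longrightarrow> 2 ^ num_cycles n (bip_edges n Xs) \<le> card (solutions n Xs)"
  shows "2 ^ m * card {E \<in> feasible_graphs n. m \<le> num_cycles n E} \<le> card (bijections n) * n ^ n"
proof -
  define B where "B = {E \<in> feasible_graphs n. m \<le> num_cycles n E}"
  have finB: "finite B" using finite_feasible_graphs by (simp add: B_def)
  have "2 ^ m * card B = (\<Sum>E\<in>B. 2 ^ m)" by simp
  also have "\<dots> \<le> (\<Sum>E\<in>B. card (solutions n (inst E)))"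
  proof (rule sum_mono)
    fix E assume "E \<in> B"
    then obtain Xs where X: "feasible n Xs" "E = bip_edges n Xs" "m \<le> num_cycles n E"
      by (auto simp: B_def feasible_graphs_def)
    have "(2::nat) ^ m \<le> 2 ^ num_cycles n E" using X(3) by simp
    also have "\<dots> \<le> card (solutions n Xs)" using many[OF X(1)] X(2) by simp
    also have "solutions n Xs = solutions n (inst E)"
      using bip_edges_inst X(2) by (intro solutions_cong) simp
    finally show "2 ^ m \<le> card (solutions n (inst E))" .
  qed
  also have "\<dots> = card (SIGMA E:B. solutions n (inst E))"
    using finB finite_solutions by (simp add: card_SigmaI)
  also have "\<dots> \<le> card (bijections n \<times> self_maps n)"
  proof (rule surj_card_le[where f = "\<lambda>(f, g). (bip_edges n (pair_instance f g), f)"])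
    show "finite (bijections n \<times> self_maps n)" using finite_bijections finite_self_maps by simp
    show "(SIGMA E:B. solutions n (inst E)) \<subseteq>
      (\<lambda>(f, g). (bip_edges n (pair_instance f g), f)) ` (bijections n \<times> self_maps n)"
    proof clarify
      fix E f assume E: "E \<in> B" and f: "f \<in> solutions n (inst E)"
      obtain Xs where X: "feasible n Xs" "E = bip_edges n Xs"
        using E by (auto simp: B_def feasible_graphs_def)
      have f': "f \<in> solutions n Xs" using f solutions_cong[OF bip_edges_inst] X(2) by simp
      obtain g where g: "g \<in> self_maps n" "E = bip_edges n (pair_instance f g)"
        using solution_pair_instance[OF X(1) f'] X(2) by blast
      have "f \<in> bijections n" using f' by (auto simp: solutions_def bijections_def)
      then show "(E, f) \<in> (\<lambda>(f, g). (bip_edges n (pair_instance f g), f)) ` (bijections n \<times> self_maps n)"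
        using g by (intro image_eqI[of _ _ "(f, g)"]) auto
    qed
  qed
  also have "\<dots> = card (bijections n) * n ^ n" by (simp add: card_cartesian_product card_self_maps)
  finally show ?thesis by (simp add: B_def)
qed

text \<open>The assumption \<open>many\<close> is obtained only after the preprocessing has been
  verified, since it is the program that exhibits the cycles.\<close>

lemma card_many_cycles:
  assumes many: "\<And>Xs. feasible n Xs \<Longrightarrow> 2 ^ num_cycles n (bip_edges n Xs) \<le> card (solutions n Xs)"
    and n: "n \<ge> 1"
  shows "2 ^ m * card {E \<in> feasible_graphs n. m \<le> num_cycles n E} \<le> n * card (feasible_graphs n)"
proof -
  have "2 ^ m * card {E \<in> feasible_graphs n. m \<le> num_cycles n E} \<le> card (bijections n) * n ^ n"
    using feasible_graphs_upper[OF many] .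
  also have "\<dots> \<le> card (bijections n) * (n * card (rooted_maps n))"
    using card_rooted_maps[OF n] by simp
  also have "\<dots> = n * (card (bijections n) * card (rooted_maps n))" by simp
  also have "\<dots> \<le> n * card (feasible_graphs n)" using feasible_graphs_lower by simp
  finally show ?thesis .
qed

lemma card_feasible_graphs_pos: "n \<ge> 1 \<Longrightarrow> 0 < card (feasible_graphs n)"
proof -
  assume n: "n \<ge> 1"
  have "n ^ n > 0" using n by simp
  then have "card (rooted_maps n) > 0" using card_rooted_maps[OF n] by (metis gr0I leD mult_0_right)
  moreover have "(\<lambda>i\<in>{1..n}. i) \<in> bijections n" by (auto simp: bijections_def bij_betw_def inj_on_def)
  then have "card (bijections n) > 0" using finite_bijections card_gt_0_iff by blast
  ultimately have "card (bijections n) * card (rooted_maps n) > 0" by simp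
  then show ?thesis using feasible_graphs_lower by (rule less_le_trans)
qed

section \<open>Preprocessing: stripping special vertices\<close>

text \<open>If both requisition entries coincide, the two updates hit the same cell, so loops count
  twice. Entering the first element in both matchings is right for loops; for all other positions it
  is a default that stripping or tracing replaces.\<close>

definition init_body :: com where
  "init_body = (let i = V ''i''; a = IGet ''req1'' i; b = IGet ''req2'' i in seqs
    [ISet ''i'' (IAdd i (IConst 1)),
     IPut ''deg'' a (IAdd (IGet ''deg'' a) (IConst 1)),
     IPut ''deg'' b (IAdd (IGet ''deg'' b) (IConst 1)),
     IPut ''sum'' a (IAdd (IGet ''sum'' a) i),
     IPut ''sum'' b (IAdd (IGet ''sum'' b) i),
     IPut ''match0'' i a,
     IPut ''match1'' i a])"

definition init :: com where
  "init = While (ILess (V ''i'') (V ''n'')) init_body"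

text \<open>At degree one, \<open>''sum''\<close> at \<open>u\<close> is the number of the only
  remaining position there. The search goes on at the other end of this position, obtained as the
  sum of both ends minus \<open>u\<close>: it is the only vertex whose degree can have dropped to
  one, that of \<open>u\<close> being zero now.\<close>

definition strip_step :: com where
  "strip_step = (let i = V ''i''; u = V ''u''; a = IGet ''req1'' i; b = IGet ''req2'' i in seqs
    [ISet ''i'' (IGet ''sum'' u),
     IPut ''match0'' i u,
     IPut ''match1'' i u,
     IPut ''rem'' i (IConst 1),
     IPut ''deg'' a (ISub (IGet ''deg'' a) (IConst 1)),
     IPut ''deg'' b (ISub (IGet ''deg'' b) (IConst 1)),
     IPut ''sum'' a (ISub (IGet ''sum'' a) i),
     IPut ''sum'' b (ISub (IGet ''sum'' b) i),
     ISet ''u'' (ISub (IAdd a b) u)])"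

text \<open>\<open>v\<close> scans the vertices once, while \<open>u\<close> follows a chain of
  forced positions starting at \<open>v\<close>. A chain never leaves a vertex of degree one behind,
  so the scan need not go back.\<close>

definition strip_body :: com where
  "strip_body = Cond (IEq (IGet ''deg'' (V ''u'')) (IConst 1)) strip_step
     (seqs [ISet ''v'' (IAdd (V ''v'') (IConst 1)), ISet ''u'' (V ''v'')])"

definition strip :: com where
  "strip = Seq (seqs [ISet ''v'' (IConst 1), ISet ''u'' (IConst 1)])
     (While (ILess (V ''v'') (IAdd (V ''n'') (IConst 1))) strip_body)"

locale tsp_instance =
  fixes n :: nat and Xs :: "nat \<Rightarrow> nat set" and a b :: "nat \<Rightarrow> nat"
  assumes n2: "2 \<le> n" and feas: "feasible n Xs" and ab: "\<And>i. i \<in> {1..n} \<Longrightarrow> Xs i = {a i, b i}"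
begin

definition inp :: "memory \<Rightarrow> bool" where
  "inp s \<longleftrightarrow> ints s ''n'' 0 = n \<and> (\<forall>i\<in>{1..n}. ints s ''req1'' i = a i \<and> ints s ''req2'' i = b i)"

lemma inp_agree: "inp s \<Longrightarrow> agree p s s' \<Longrightarrow> {''n'', ''req1'', ''req2''} \<inter> iwrites p = {} \<Longrightarrow> inp s'"
  by (auto simp: inp_def agree_def)

text \<open>Position \<open>i\<close> is an edge from \<open>a i\<close> to \<open>b i\<close>; a loop counts twice, both in the degree \<open>dg U v\<close>
  and in the sum \<open>sm U v\<close> of the incident positions, from which the only remaining one can be read off.\<close>

definition dg :: "nat set \<Rightarrow> nat \<Rightarrow> nat" where
  "dg U v = (\<Sum>i\<in>U. of_bool (a i = v) + of_bool (b i = v))"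

definition sm :: "nat set \<Rightarrow> nat \<Rightarrow> nat" where
  "sm U v = (\<Sum>i\<in>U. i * (of_bool (a i = v) + of_bool (b i = v)))"

lemma Xs_sub: "i \<in> {1..n} \<Longrightarrow> Xs i \<subseteq> {1..n}"
  using feas by (auto simp: feasible_def requisitions_def)

lemma ab_range: "i \<in> {1..n} \<Longrightarrow> a i \<in> {1..n}" "i \<in> {1..n} \<Longrightarrow> b i \<in> {1..n}"
  using Xs_sub ab by blast+

lemma sol_ab: "f \<in> solutions n Xs \<Longrightarrow> i \<in> {1..n} \<Longrightarrow> f i = a i \<or> f i = b i"
  using ab by (auto simp: solutions_def)

lemma ex_sol: "\<exists>f. f \<in> solutions n Xs"
  using feas by (auto simp: feasible_def)

lemma init_runs:
  assumes inp: "inp s" and z: "ints s ''i'' 0 = 0" "\<And>v. ints s ''deg'' v = 0" "\<And>v. ints s ''sum'' v = 0"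
    and N: "80 * n + 80 \<le> N"
  shows "runs init s N (\<lambda>N' s'. N \<le> N' + 80 * n + 80 \<and> (\<forall>v. ints s' ''deg'' v = dg {1..n} v) \<and>
    (\<forall>v. ints s' ''sum'' v = sm {1..n} v) \<and> (\<forall>x\<in>{1..n}. ints s' ''match0'' x = a x \<and> ints s' ''match1'' x = a x))"
  unfolding init_def
proof (rule runs_mono)
  let ?P = "\<lambda>i s'. (\<forall>v. ints s' ''deg'' v = dg {1..i} v) \<and> (\<forall>v. ints s' ''sum'' v = sm {1..i} v) \<and>
    (\<forall>x\<in>{1..i}. ints s' ''match0'' x = a x \<and> ints s' ''match1'' x = a x)"
  show "runs (While (ILess (V ''i'') (V ''n'')) init_body) s N (\<lambda>N' s'. N \<le> N' + (74 + 6) * n + 6 \<and> ?P n s')"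
  proof (rule runs_for[where P = ?P], goal_cases)
    case (1 s')
    then show ?case using inp_agree[OF inp 1] by (simp add: init_body_def Let_def inp_def)
  next
    case (5 t s' N')
    define i where "i = t + 1"
    have i: "i \<in> {1..n}" using 5(1) by (simp add: i_def)
    have inp': "inp s'" using inp_agree[OF inp 5(4)] by (simp add: init_body_def Let_def)
    have r: "ints s' ''req1'' i = a i" "ints s' ''req2'' i = b i" using inp' i by (auto simp: inp_def)
    have ii: "{1..i} = insert i {1..t}" and ni: "i \<notin> {1..t}" by (auto simp: i_def)
    show ?case unfolding i_def[symmetric]
    proof (rule runs_straight, goal_cases)
      case 1 show ?case by (simp add: init_body_def Let_def)
    next
      case 2 show ?case using 5(5) by (simp add: init_body_def Let_def)
    next
      case (3 N'')
      have "ints (result init_body s') ''i'' 0 = i"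
        using 5(2) by (simp add: init_body_def Let_def mem i_def)
      moreover have "ints (result init_body s') ''deg'' v = dg {1..i} v" for v
        using ni 5(2,3) r unfolding dg_def ii
        by (simp add: init_body_def Let_def mem i_def[symmetric])
      moreover have "ints (result init_body s') ''sum'' v = sm {1..i} v" for v
        using ni 5(2,3) r unfolding sm_def ii
        by (simp add: init_body_def Let_def mem i_def[symmetric])
      moreover have "ints (result init_body s') ''match0'' x = a x \<and> ints (result init_body s') ''match1'' x = a x"
        if "x \<in> {1..i}" for x
        using 5(2,3) r that unfolding ii
        by (auto simp add: init_body_def Let_def mem i_def[symmetric])
      moreover have "N' \<le> N'' + 74" using 3 by (simp add: init_body_def Let_def)
      ultimately show ?case by simp
    qed
  next
    case 6 then show ?case using N by simp
  qed (use z in \<open>simp_all add: dg_def sm_def\<close>)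
qed simp

lemma dg_remove: "finite U \<Longrightarrow> i \<in> U \<Longrightarrow> dg (U - {i}) v = dg U v - (of_bool (a i = v) + of_bool (b i = v))"
  unfolding dg_def by (subst sum_diff1_nat) simp

lemma sm_remove: "finite U \<Longrightarrow> i \<in> U \<Longrightarrow> sm (U - {i}) v = sm U v - i * (of_bool (a i = v) + of_bool (b i = v))"
  unfolding sm_def by (subst sum_diff1_nat) simp

lemma dg_eq_0: "finite U \<Longrightarrow> dg U v = 0 \<longleftrightarrow> (\<forall>i\<in>U. a i \<noteq> v \<and> b i \<noteq> v)"
  by (auto simp: dg_def)

lemma dg_eq_1:
  assumes "finite U" "dg U v = 1"
  obtains i where "i \<in> U" "sm U v = i" "a i \<noteq> b i" "v = a i \<or> v = b i" "dg (U - {i}) v = 0"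
proof -
  from assms have "dg U v \<noteq> 0" by simp
  then obtain i where i: "i \<in> U" "v = a i \<or> v = b i" unfolding dg_eq_0[OF assms(1)] by blast
  have d: "dg U v = of_bool (a i = v) + of_bool (b i = v) + dg (U - {i}) v"
    unfolding dg_def using assms(1) i(1) by (rule sum.remove)
  then have z: "dg (U - {i}) v = 0" "a i \<noteq> b i" using i(2) assms(2) by auto
  have "sm U v = i * (of_bool (a i = v) + of_bool (b i = v)) + sm (U - {i}) v"
    unfolding sm_def using assms(1) i(1) by (rule sum.remove)
  moreover have "sm (U - {i}) v = 0"
    using z(1) assms(1) by (auto simp: sm_def dg_eq_0)
  moreover have "of_bool (a i = v) + of_bool (b i = v) = (1::nat)" using i(2) z(2) by auto
  ultimately have "sm U v = i" by simp
  then show thesis using that i z by blast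
qed

text \<open>\<open>U\<close> are the remaining positions. The clause on \<open>dg U (m i)\<close>
  says that an element already assigned has no remaining position. It shows that an element of
  degree one has to be taken by a position in \<open>U\<close>, and later that the remaining
  positions compete only for unassigned elements.\<close>

definition forced_off :: "nat set \<Rightarrow> (nat \<Rightarrow> nat) \<Rightarrow> bool" where
  "forced_off U m \<longleftrightarrow> U \<subseteq> {1..n} \<and> (\<forall>f\<in>solutions n Xs. \<forall>i\<in>{1..n} - U. f i = m i) \<and>
    (\<forall>i\<in>{1..n} - U. dg U (m i) = 0) \<and> (\<forall>i\<in>{1..n}. m i \<in> {a i, b i})"

text \<open>Every solution assigns \<open>v\<close> to some position. A removed position is ruled
  out, because its element has degree 0 in \<open>U\<close>, and among the remaining ones only
  \<open>sm U v\<close> is incident with \<open>v\<close>.\<close>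

lemma forced_off_step:
  assumes U: "forced_off U m" and d: "dg U v = 1" and v: "v \<in> {1..n}"
    and m': "m' = m(sm U v := v)"
  shows "forced_off (U - {sm U v}) m'" "sm U v \<in> U" "a (sm U v) \<noteq> b (sm U v)"
    "v = a (sm U v) \<or> v = b (sm U v)"
proof -
  have UN: "U \<subseteq> {1..n}" and fin: "finite U" using U finite_subset by (auto simp: forced_off_def)
  from dg_eq_1[OF fin d] obtain i where i: "i \<in> U" "sm U v = i" "a i \<noteq> b i" "v = a i \<or> v = b i"
    "dg (U - {i}) v = 0" by metis
  have sv: "f i = v" if f: "f \<in> solutions n Xs" for f
  proof -
    have "f ` {1..n} = {1..n}" using f by (simp add: solutions_def bij_betw_def)
    then obtain j where j: "j \<in> {1..n}" "f j = v" using v by (metis imageE)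
    have "j \<in> U"
    proof (rule ccontr)
      assume "j \<notin> U"
      then have "dg U v = 0" using U f j unfolding forced_off_def by (metis DiffI)
      then show False using d by simp
    qed
    then have "j = i" using sol_ab[OF f j(1)] j i(5) fin by (auto simp: dg_eq_0)
    then show ?thesis using j by simp
  qed
  have dz: "dg (U - {i}) x = 0" if "dg U x = 0" for x
    using that dg_remove[OF fin i(1)] by simp
  have m'': "m' = m(i := v)" using m' i by simp
  show "forced_off (U - {sm U v}) m'" unfolding forced_off_def i(2)
  proof (intro conjI ballI)
    show "U - {i} \<subseteq> {1..n}" using UN by blast
    fix j assume "j \<in> {1..n} - (U - {i})"
    then have j: "j \<in> {1..n}" "j \<noteq> i \<Longrightarrow> j \<in> {1..n} - U" by auto
    show "dg (U - {i}) (m' j) = 0"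
      using U dz i(5) j unfolding forced_off_def m'' by (cases "j = i") auto
    fix f assume "f \<in> solutions n Xs"
    then show "f j = m' j" using U sv j unfolding forced_off_def m'' by (cases "j = i") auto
  next
    fix j assume "j \<in> {1..n}"
    then show "m' j \<in> {a j, b j}" using U i(4) unfolding forced_off_def m'' by (cases "j = i") auto
  qed
  show "sm U v \<in> U" "a (sm U v) \<noteq> b (sm U v)" "v = a (sm U v) \<or> v = b (sm U v)" using i by auto
qed

definition rest :: "memory \<Rightarrow> nat set" where
  "rest s = {i \<in> {1..n}. ints s ''rem'' i = 0}"

definition strip_inv :: "memory \<Rightarrow> bool" where
  "strip_inv s \<longleftrightarrow> (\<forall>v. ints s ''deg'' v = dg (rest s) v) \<and> (\<forall>v. ints s ''sum'' v = sm (rest s) v) \<and>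
     forced_off (rest s) (ints s ''match0'') \<and>
     (\<forall>i\<in>rest s. ints s ''match0'' i = a i) \<and>
     (\<forall>i\<in>{1..n}. ints s ''match1'' i = ints s ''match0'' i)"

lemma finite_rest [simp]: "finite (rest s)"
  by (simp add: rest_def)

lemma strip_step_result:
  assumes inv: "strip_inv s" and inp: "inp s" and u: "ints s ''u'' 0 \<in> {1..n}"
    and d: "ints s ''deg'' (ints s ''u'' 0) = 1"
    and s': "s' = result strip_step s"
  shows "strip_inv s'" "Suc (card (rest s')) = card (rest s)" "ints s' ''v'' 0 = ints s ''v'' 0"
    "ints s' ''u'' 0 \<in> {1..n}"
    "\<forall>x. x \<noteq> ints s' ''u'' 0 \<longrightarrow> x \<noteq> ints s ''u'' 0 \<longrightarrow> ints s' ''deg'' x = ints s ''deg'' x"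
    "ints s' ''deg'' (ints s ''u'' 0) = 0"
proof -
  define u where "u = ints s ''u'' 0"
  define i where "i = ints s ''sum'' u"
  have iU: "i = sm (rest s) u" using inv by (simp add: strip_inv_def i_def)
  have d: "dg (rest s) u = 1" using d inv by (simp add: u_def strip_inv_def)
  have fo: "forced_off (rest s) (ints s ''match0'')" using inv by (simp add: strip_inv_def)
  note st = forced_off_step[OF fo d u[folded u_def] refl, folded iU]
  have i: "i \<in> {1..n}" using st(2) by (simp add: rest_def)
  have r: "ints s ''req1'' i = a i" "ints s ''req2'' i = b i" using inp i by (auto simp: inp_def)
  have m: "ints s' ''match0'' = (ints s ''match0'')(i := u)" "ints s' ''match1'' = (ints s ''match1'')(i := u)"
    "ints s' ''rem'' = (ints s ''rem'')(i := 1)" "ints s' ''u'' 0 = a i + b i - u" "ints s' ''v'' = ints s ''v''"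
    using r unfolding s' by (simp_all add: strip_step_def Let_def mem u_def[symmetric] i_def[symmetric])
  have rest: "rest s' = rest s - {i}" by (auto simp: rest_def m)
  have dg: "ints s' ''deg'' v = dg (rest s') v" for v
  proof -
    have "ints s' ''deg'' v = ints s ''deg'' v - (of_bool (a i = v) + of_bool (b i = v))"
      using r st(3) unfolding s' by (simp add: strip_step_def Let_def mem u_def[symmetric] i_def[symmetric])
    then show ?thesis using inv dg_remove[OF _ st(2)] by (simp add: rest strip_inv_def)
  qed
  have sm: "ints s' ''sum'' v = sm (rest s') v" for v
  proof -
    have "ints s' ''sum'' v = ints s ''sum'' v - i * (of_bool (a i = v) + of_bool (b i = v))"
      using r st(3) unfolding s' by (simp add: strip_step_def Let_def mem u_def[symmetric] i_def[symmetric])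
    then show ?thesis using inv sm_remove[OF _ st(2)] by (simp add: rest strip_inv_def)
  qed
  show "strip_inv s'" using inv dg sm st(1) unfolding strip_inv_def rest m by auto
  show "Suc (card (rest s')) = card (rest s)" unfolding rest
    using card_Suc_Diff1[OF finite_rest st(2)] .
  show "ints s' ''v'' 0 = ints s ''v'' 0" by (simp add: m)
  have w: "a i + b i - u = (if u = a i then b i else a i)" using st(4) by auto
  show "ints s' ''u'' 0 \<in> {1..n}" using ab_range[OF i] by (simp add: m w)
  show "\<forall>x. x \<noteq> ints s' ''u'' 0 \<longrightarrow> x \<noteq> ints s ''u'' 0 \<longrightarrow> ints s' ''deg'' x = ints s ''deg'' x"
    using dg inv dg_remove[OF _ st(2)] st(4) by (auto simp: rest m w u_def[symmetric] strip_inv_def split: if_splits)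
  show "ints s' ''deg'' (ints s ''u'' 0) = 0"
    using dg[of u] dg_remove[OF _ st(2), of u] d st(3,4) by (auto simp: rest u_def[symmetric])
qed

lemma strip_runs:
  assumes inp: "inp s" and z: "\<And>i. ints s ''rem'' i = 0"
    and d: "\<And>v. ints s ''deg'' v = dg {1..n} v" and sm: "\<And>v. ints s ''sum'' v = sm {1..n} v"
    and m: "\<And>x. x \<in> {1..n} \<Longrightarrow> ints s ''match0'' x = a x \<and> ints s ''match1'' x = a x"
    and N: "200 * n + 200 \<le> N"
  shows "runs strip s N (\<lambda>N' s'. N \<le> N' + 200 * n + 200 \<and> strip_inv s' \<and>
    (\<forall>v\<in>{1..n}. dg (rest s') v \<noteq> 1))"
proof -
  let ?b = "ILess (V ''v'') (IAdd (V ''n'') (IConst 1))"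
  \<comment> \<open>Among the vertices scanned so far only \<open>u\<close> may have degree one. The
    sentinel value \<open>Suc n\<close> of \<open>u\<close> removes this exception at the end of the
    scan. In the credit inequality every round costs at most 100 and either removes a position or
    advances \<open>v\<close>, which gives 200 for each of the n indices.\<close>
  let ?I = "\<lambda>N' s'. strip_inv s' \<and> ints s' ''v'' 0 \<le> Suc n \<and>
    (ints s' ''v'' 0 \<le> n \<longrightarrow> ints s' ''u'' 0 \<in> {1..n}) \<and>
    (ints s' ''v'' 0 = Suc n \<longrightarrow> ints s' ''u'' 0 = Suc n) \<and>
    (\<forall>x\<in>{1..ints s' ''v'' 0}. ints s' ''deg'' x = 1 \<longrightarrow> x = ints s' ''u'' 0) \<and>
    N + 100 * card (rest s') \<le> N' + 20 + 100 * n + 100 * ints s' ''v'' 0"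
  define s1 where "s1 = iput ''u'' 0 1 (iput ''v'' 0 1 s)"
  have loop: "runs (While ?b strip_body) s1 N1 (\<lambda>N' s'. N \<le> N' + 200 * n + 200 \<and> strip_inv s' \<and>
    (\<forall>v\<in>{1..n}. dg (rest s') v \<noteq> 1))" if N1: "N \<le> N1 + 8" for N1
  proof (rule runs_While[where I = ?I], goal_cases)
    case 1
    have r: "rest s1 = {1..n}" using z by (auto simp: rest_def s1_def mem)
    have "strip_inv s1" using d sm m unfolding strip_inv_def r
      by (auto simp: s1_def mem forced_off_def)
    then show ?case using r n2 N1 by (auto simp: s1_def mem)
  next
    case (2 N' s')
    have inp': "inp s'" using inp 2(3) by (auto simp: inp_def agree_def s1_def mem strip_body_def strip_step_def Let_def)
    have v: "ints s' ''v'' 0 \<le> n" using 2(2) inp' by (simp add: inp_def)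
    then have u: "ints s' ''u'' 0 \<in> {1..n}" using 2(1) by simp
    have "rest s' \<subseteq> {1..n}" unfolding rest_def by blast
    from card_mono[OF _ this] have cr: "card (rest s') \<le> n" by simp
    have N': "100 \<le> N'" using 2(1) N v by linarith
    show ?case
    proof (intro conjI)
      show "1 + btime ?b \<le> N'" using N' by simp
      show "runs strip_body s' (N' - (1 + btime ?b)) ?I"
      proof (rule runs_straight, goal_cases)
        case 1 show ?case by (simp add: strip_body_def strip_step_def IEq_def Let_def)
      next
        case 2 show ?case using N' by (simp add: strip_body_def strip_step_def IEq_def Let_def)
      next
        case (3 N'')
        then have t: "N' \<le> N'' + 100" by (simp add: strip_body_def strip_step_def IEq_def Let_def)
        show ?case
        proof (cases "ints s' ''deg'' (ints s' ''u'' 0) = 1")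
          case True
          then have e: "result strip_body s' = result strip_step s'" by (simp add: strip_body_def)
          have inv: "strip_inv s'" using 2(1) by simp
          note R = strip_step_result[OF inv inp' u True refl]
          have "\<forall>x\<in>{1..ints s' ''v'' 0}. ints (result strip_step s') ''deg'' x = 1 \<longrightarrow>
              x = ints (result strip_step s') ''u'' 0"
            using 2(1) R(5,6) by (metis zero_neq_one)
          moreover have "N + 100 * card (rest (result strip_step s')) \<le> N'' + 20 + 100 * n + 100 * ints s' ''v'' 0"
            using 2(1) t R(2) by linarith
          ultimately show ?thesis using R(1,4) v unfolding e R(3) by simp
        next
          case False
          define s2 where "s2 = result strip_body s'"
          have e: "ints s2 ''v'' 0 = Suc (ints s' ''v'' 0)" "ints s2 ''u'' 0 = Suc (ints s' ''v'' 0)"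
            "ints s2 ''deg'' = ints s' ''deg''" "rest s2 = rest s'" "strip_inv s2 \<longleftrightarrow> strip_inv s'"
            using False unfolding s2_def strip_inv_def rest_def by (simp_all add: strip_body_def mem)
          have "\<forall>x\<in>{1..ints s' ''v'' 0}. ints s' ''deg'' x \<noteq> 1" using 2(1) False by blast
          then show ?thesis unfolding s2_def[symmetric] e using 2(1) v t by (auto simp: le_Suc_eq)
        qed
      qed
    qed
  next
    case (3 N' s')
    have "inp s'" using inp 3(3) by (auto simp: inp_def agree_def s1_def mem strip_body_def strip_step_def Let_def)
    then have v: "ints s' ''v'' 0 = Suc n" using 3(1,2) by (simp add: inp_def)
    then have u: "ints s' ''u'' 0 = Suc n" using 3(1) by simp
    have "\<forall>x\<in>{1..n}. dg (rest s') x \<noteq> 1"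
    proof
      fix x assume "x \<in> {1..n}"
      then have "ints s' ''deg'' x = 1 \<Longrightarrow> x = Suc n" using 3(1) v u by (metis atLeastAtMost_iff le_SucI)
      then show "dg (rest s') x \<noteq> 1" using 3(1) \<open>x \<in> {1..n}\<close> by (auto simp: strip_inv_def)
    qed
    moreover have "N \<le> N' + 120 + 200 * n" using 3(1) v by simp
    ultimately show ?case using 3(1) N by auto
  qed
  show ?thesis unfolding strip_def
  proof (rule runs_prefix, goal_cases)
    case (3 N1)
    then show ?case using loop[of N1] by (simp add: s1_def)
  qed (use N in simp_all)
qed

end

section \<open>Preprocessing: tracing cycles\<close>

definition succ_rel :: "nat set \<Rightarrow> (nat \<Rightarrow> nat) \<Rightarrow> (nat \<Rightarrow> nat) \<Rightarrow> (nat \<times> nat) set" where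
  "succ_rel D f h = {(x, y). x \<in> D \<and> y \<in> D \<and> f y = h x}"

text \<open>The successor map \<open>g\<close> is injective, so it permutes the finite,
  \<open>g\<close>-closed set \<open>S\<close> of points reachable from \<open>x\<close>; hence
  \<open>S\<close> is closed under predecessors as well. Going backwards from \<open>x\<close> along
  a path that started at \<open>i\<close> shows that \<open>i\<close> lies in \<open>S\<close>, and
  from \<open>i\<close> everything is reachable.\<close>

lemma succ_rel_reach:
  assumes fin: "finite D" and f: "inj_on f D" and h: "inj_on h D"
    and cl: "\<And>x. x \<in> D \<Longrightarrow> \<exists>y\<in>D. f y = h x"
    and i: "i \<in> D" "\<And>x. x \<in> D \<Longrightarrow> (i, x) \<in> (succ_rel D f h)\<^sup>*"
    and xy: "x \<in> D" "y \<in> D"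
  shows "(x, y) \<in> (succ_rel D f h)\<^sup>*"
proof -
  let ?R = "succ_rel D f h"
  obtain g where g: "\<And>x. x \<in> D \<Longrightarrow> g x \<in> D \<and> f (g x) = h x" using cl by metis
  define S where "S = {z \<in> D. (x, z) \<in> ?R\<^sup>*}"
  have "g ` S \<subseteq> S"
  proof
    fix w assume "w \<in> g ` S"
    then obtain z where z: "z \<in> S" "w = g z" by blast
    then have "(z, w) \<in> ?R" using g[of z] by (auto simp: S_def succ_rel_def)
    then show "w \<in> S" using z g[of z] by (auto simp: S_def intro: rtrancl_into_rtrancl)
  qed
  moreover have "inj_on g S"
  proof (rule inj_onI)
    fix u v assume "u \<in> S" "v \<in> S" "g u = g v"
    then have "u \<in> D" "v \<in> D" "h u = h v" using g[of u] g[of v] by (auto simp: S_def)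
    then show "u = v" using h by (auto dest: inj_onD)
  qed
  moreover have "finite S" using fin by (simp add: S_def)
  ultimately have gS: "g ` S = S" by (simp add: endo_inj_surj)
  have preds: "w \<in> S" if z: "z \<in> S" and wz: "(w, z) \<in> ?R" for w z
  proof -
    obtain w' where w': "w' \<in> S" "z = g w'" using gS z by blast
    then have "w' \<in> D" "w \<in> D" "h w = h w'" using g[of w'] wz by (auto simp: succ_rel_def S_def)
    then have "w = w'" using h by (auto dest: inj_onD)
    then show ?thesis using w' by simp
  qed
  have "i \<in> S" using i(2)[OF xy(1)]
  proof (induction rule: converse_rtrancl_induct)
    case base then show ?case using xy(1) by (simp add: S_def)
  qed (use preds in blast)
  then have "(x, i) \<in> ?R\<^sup>*" by (simp add: S_def)
  then show ?thesis using i(2)[OF xy(2)] by (rule rtrancl_trans)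
qed

lemma succ_rel_mono:
  assumes "(x, y) \<in> (succ_rel D f h)\<^sup>*" "D \<subseteq> D'" "\<And>x. x \<in> D \<Longrightarrow> f' x = f x \<and> h' x = h x"
  shows "(x, y) \<in> (succ_rel D' f' h')\<^sup>*"
proof -
  have "succ_rel D f h \<subseteq> succ_rel D' f' h'" using assms(2,3) by (auto simp: succ_rel_def)
  then show ?thesis using assms(1) rtrancl_mono by blast
qed

section \<open>The 2-regular remainder after stripping\<close>

locale stripped = tsp_instance +
  fixes U :: "nat set" and m :: "nat \<Rightarrow> nat"
  assumes fo: "forced_off U m" and no1: "\<And>v. v \<in> {1..n} \<Longrightarrow> dg U v \<noteq> 1"
begin

abbreviation "F \<equiv> solutions n Xs"

definition oth :: "(nat \<Rightarrow> nat) \<Rightarrow> nat \<Rightarrow> nat" where "oth f x = a x + b x - f x"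

text \<open>The elements not taken by stripped positions; every solution maps \<open>U\<close> onto
  this set.\<close>

definition W :: "nat set" where "W = {1..n} - m ` ({1..n} - U)"

definition core :: "nat set" where "core = {x \<in> U. a x \<noteq> b x}"

lemma U_sub: "U \<subseteq> {1..n}" and fin_U [simp]: "finite U"
  using fo finite_subset by (auto simp: forced_off_def)

lemma U_in: "x \<in> U \<Longrightarrow> x \<in> {1..n}" using U_sub by blast

lemma core_U: "x \<in> core \<Longrightarrow> x \<in> U" by (simp add: core_def)

lemma fin_core [simp]: "finite core" by (simp add: core_def)

lemma F_bij: "f \<in> F \<Longrightarrow> f ` {1..n} = {1..n}" "f \<in> F \<Longrightarrow> inj_on f {1..n}"
  by (auto simp: solutions_def bij_betw_def)

lemma F_inj_U: "f \<in> F \<Longrightarrow> inj_on f U"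
  using F_bij(2) U_sub inj_on_subset by blast

lemma F_image: assumes f: "f \<in> F" shows "f ` U = W"
proof -
  have "f ` ({1..n} - U) = m ` ({1..n} - U)" using fo f by (intro image_cong) (auto simp: forced_off_def)
  moreover have "f ` U = f ` {1..n} - f ` ({1..n} - U)"
    using inj_on_image_set_diff[OF F_bij(2)[OF f], of "{1..n}" "{1..n} - U"] U_sub
    by (simp add: double_diff)
  ultimately show ?thesis using F_bij(1)[OF f] by (simp add: W_def)
qed

lemma ab_W: assumes i: "i \<in> U" shows "a i \<in> W" "b i \<in> W"
proof -
  have "a i \<noteq> m j" "b i \<noteq> m j" if j: "j \<in> {1..n} - U" for j
    using fo j i dg_eq_0[OF fin_U, of "m j"] by (auto simp: forced_off_def)
  then show "a i \<in> W" "b i \<in> W" using ab_range[OF U_in[OF i]] unfolding W_def by blast+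
qed

lemma F_cases: assumes f: "f \<in> F" and x: "x \<in> U"
  shows "f x = a x \<and> oth f x = b x \<or> f x = b x \<and> oth f x = a x"
  using sol_ab[OF f U_in[OF x]] by (auto simp: oth_def)

text \<open>Each element of \<open>W\<close> is taken by a remaining position, so its degree is not
  0, and by \<open>no1\<close> it is at least 2. The degrees sum to twice the size of
  \<open>U\<close>, which equals the size of \<open>W\<close>, so none can exceed 2.\<close>

lemma dg_W: assumes v: "v \<in> W" shows "dg U v = 2"
proof -
  obtain f where f: "f \<in> F" using ex_sol by blast
  have finW: "finite W" by (simp add: W_def)
  have ge: "2 \<le> dg U v" if v: "v \<in> W" for v
  proof -
    obtain i where "i \<in> U" "v = f i" using F_image[OF f] v by blast
    then have "dg U v \<noteq> 0" using F_cases[OF f] dg_eq_0[OF fin_U, of v] by force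
    moreover have "dg U v \<noteq> 1" using no1 v by (simp add: W_def)
    ultimately show ?thesis by linarith
  qed
  have "(\<Sum>v\<in>W. dg U v) = (\<Sum>i\<in>U. \<Sum>v\<in>W. of_bool (a i = v) + of_bool (b i = v))"
    unfolding dg_def by (rule sum.swap)
  also have "\<dots> = (\<Sum>i\<in>U. 2)"
    using ab_W finW by (intro sum.cong refl) (simp add: sum.distrib of_bool_def sum.delta)
  also have "\<dots> = (\<Sum>v\<in>W. 2)"
    using card_image[OF F_inj_U[OF f]] F_image[OF f] by simp
  finally have "(\<Sum>v\<in>W. 2) = (\<Sum>v\<in>W. dg U v)" by simp
  from sum_mono_inv[OF this ge v finW] show ?thesis by simp
qed

lemma indicators: assumes "f \<in> F" "i \<in> U"
  shows "of_bool (a i = v) + of_bool (b i = v) = (of_bool (f i = v) + of_bool (oth f i = v) :: nat)"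
  using F_cases[OF assms] by auto

text \<open>An element \<open>v\<close> of \<open>W\<close> has degree 2. One unit comes from the
  position to which \<open>f\<close> assigns \<open>v\<close>, so exactly one position remains for
  which \<open>v\<close> is the end not chosen.\<close>

lemma oth_inj: assumes f: "f \<in> F" shows "inj_on (oth f) U"
proof (rule inj_onI)
  fix x y assume x: "x \<in> U" and y: "y \<in> U" and e: "oth f x = oth f y"
  let ?v = "oth f x"
  have v: "?v \<in> W" using F_cases[OF f x] ab_W[OF x] by auto
  then obtain z where z: "z \<in> U" "f z = ?v" using F_image[OF f] by (metis imageE)
  have "dg U ?v = (\<Sum>i\<in>U. of_bool (f i = ?v)) + (\<Sum>i\<in>U. of_bool (oth f i = ?v))"
    unfolding dg_def sum.distrib[symmetric] using indicators[OF f] by (intro sum.cong) auto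
  moreover have "(\<Sum>i\<in>U. of_bool (f i = ?v)) = (\<Sum>i\<in>U. if i = z then 1 else 0::nat)"
    using z inj_on_eq_iff[OF F_inj_U[OF f] _ z(1)] by (intro sum.cong) auto
  ultimately have "(\<Sum>i\<in>U. of_bool (oth f i = ?v)) = (1::nat)" using dg_W[OF v] z by simp
  then have "card {i \<in> U. oth f i = ?v} = 1" by (simp add: Int_def conj_commute)
  then obtain w where "{i \<in> U. oth f i = ?v} = {w}" by (rule card_1_singletonE)
  moreover have "x \<in> {i \<in> U. oth f i = ?v}" "y \<in> {i \<in> U. oth f i = ?v}" using x y e by auto
  ultimately have "x \<in> {w}" "y \<in> {w}" by (simp_all only:)
  then show "x = y" by simp
qed

lemma oth_W: "f \<in> F \<Longrightarrow> x \<in> U \<Longrightarrow> oth f x \<in> W"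
  using F_cases ab_W by metis

lemma oth_image: assumes f: "f \<in> F" shows "oth f ` U = W"
proof (rule card_subset_eq)
  show "finite W" by (simp add: W_def)
  show "oth f ` U \<subseteq> W" using oth_W[OF f] by blast
  show "card (oth f ` U) = card W"
    using card_image[OF oth_inj[OF f]] card_image[OF F_inj_U[OF f]] F_image[OF f] by simp
qed

text \<open>Exactly two incidences meet at \<open>oth f x\<close>: that of \<open>x\<close>, where
  it is not chosen, and that of a position \<open>y\<close>, where it is. So subtracting
  \<open>x\<close> from the sum yields the next position of the cycle without any adjacency list;
  for a loop \<open>x\<close> and \<open>y\<close> coincide.\<close>

lemma sm_oth: assumes f: "f \<in> F" and x: "x \<in> U"
  shows "\<exists>y\<in>U. f y = oth f x \<and> sm U (oth f x) = x + y"
proof -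
  let ?v = "oth f x"
  obtain y where y: "y \<in> U" "f y = ?v" using F_image[OF f] oth_W[OF f x] by (metis imageE)
  have "sm U ?v = (\<Sum>i\<in>U. i * of_bool (f i = ?v)) + (\<Sum>i\<in>U. i * of_bool (oth f i = ?v))"
    unfolding sm_def sum.distrib[symmetric] using indicators[OF f]
    by (intro sum.cong) (auto simp: distrib_left simp del: of_bool_eq_iff)
  also have "(\<Sum>i\<in>U. i * of_bool (f i = ?v)) = (\<Sum>i\<in>U. if i = y then y else 0)"
    using y inj_on_eq_iff[OF F_inj_U[OF f] _ y(1)] by (intro sum.cong) auto
  also have "(\<Sum>i\<in>U. i * of_bool (oth f i = ?v)) = (\<Sum>i\<in>U. if i = x then x else 0)"
    using inj_on_eq_iff[OF oth_inj[OF f] _ x] by (intro sum.cong) auto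
  finally show ?thesis using x y by (intro bexI[of _ y]) auto
qed

lemma next_core: assumes f: "f \<in> F" and x: "x \<in> core" and y: "y \<in> U" "f y = oth f x"
  shows "y \<in> core"
proof (rule ccontr)
  assume "y \<notin> core"
  then have "oth f y = f y" using F_cases[OF f y(1)] y(1) by (auto simp: core_def)
  then have "x = y" using oth_inj[OF f] core_U[OF x] y by (auto dest: inj_onD)
  then show False using x \<open>y \<notin> core\<close> by simp
qed

text \<open>On a closed set \<open>P\<close>, and so on its complement in \<open>U\<close>, chosen
  and unchosen ends form the same set of elements. Exchanging them on the complement therefore keeps
  a bijection. This adjusts a witness solution outside the cycles already traced.\<close>

lemma flip_solution:
  assumes f: "f \<in> F" and P: "P \<subseteq> U" and cl: "oth f ` P \<subseteq> f ` P"
  defines "f' \<equiv> (\<lambda>i. if i \<in> U - P then oth f i else f i)"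
  shows "f' \<in> F"
proof -
  have finP: "finite P" using P finite_subset fin_U by blast
  have iP: "inj_on f P" "inj_on (oth f) P" using F_inj_U[OF f] oth_inj[OF f] P inj_on_subset by blast+
  have oP: "oth f ` P = f ` P"
    using cl finP iP by (intro card_subset_eq) (auto simp: card_image)
  have "oth f ` (U - P) = oth f ` U - oth f ` P"
    using inj_on_image_set_diff[OF oth_inj[OF f], of U P] P by simp
  also have "\<dots> = f ` U - f ` P" by (simp add: oP oth_image[OF f] F_image[OF f])
  also have "\<dots> = f ` (U - P)"
    using inj_on_image_set_diff[OF F_inj_U[OF f], of U P] P by simp
  finally have UP: "oth f ` (U - P) = f ` (U - P)" .
  have d: "{1..n} = (U - P) \<union> ({1..n} - (U - P))" using U_sub by blast
  have "f' ` (U - P) = oth f ` (U - P)" by (intro image_cong) (auto simp: f'_def)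
  moreover have "f' ` ({1..n} - (U - P)) = f ` ({1..n} - (U - P))" by (intro image_cong) (auto simp: f'_def)
  ultimately have "f' ` {1..n} = f ` {1..n}" using UP d by (metis image_Un)
  then have s: "f' ` {1..n} = {1..n}" using F_bij(1)[OF f] by simp
  then have "inj_on f' {1..n}" by (intro eq_card_imp_inj_on) auto
  moreover have "f' i \<in> Xs i" if i: "i \<in> {1..n}" for i
    using F_cases[OF f, of i] ab[OF i] f i by (auto simp: f'_def solutions_def)
  moreover have "f' \<in> extensional {1..n}" using f U_sub by (auto simp: solutions_def extensional_def f'_def)
  ultimately show ?thesis using s by (simp add: solutions_def bij_betw_def)
qed

text \<open>Invariant of the tracing: \<open>P\<close> are the positions numbered so far, which form
  complete cycles. The solution \<open>f\<close> certifies that the values \<open>m0\<close>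
  recorded for different cycles are compatible with each other and with a choice for the
  rest.\<close>

definition tinv :: "nat \<Rightarrow> (nat \<Rightarrow> nat) \<Rightarrow> (nat \<Rightarrow> nat) \<Rightarrow> (nat \<Rightarrow> nat) \<Rightarrow> bool" where
  "tinv q cy m0 m1 \<longleftrightarrow> (let P = {x \<in> {1..n}. cy x \<noteq> 0} in P \<subseteq> core \<and>
     (\<exists>f\<in>F. \<forall>x\<in>P. f x = m0 x \<and> oth f x = m1 x) \<and>
     (\<forall>x\<in>P. \<exists>y\<in>P. m0 y = m1 x \<and> cy y = cy x) \<and>
     (\<forall>x\<in>P. \<forall>y\<in>P. cy x = cy y \<longrightarrow> (x, y) \<in> (succ_rel P m0 m1)\<^sup>*) \<and>
     cy ` P = {1..q} \<and> (\<forall>x\<in>{1..n} - P. m0 x = m x \<and> m1 x = m x))"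

text \<open>Tracing always starts with the first entry of the requisition, while the witness
  solution may choose the second; then everything not yet traced is flipped.\<close>

lemma tinv_start:
  assumes t: "tinv q cy m0 m1" and i: "i \<in> core" "cy i = 0"
  shows "\<exists>f\<in>F. f i = a i \<and> (\<forall>x\<in>{x \<in> {1..n}. cy x \<noteq> 0}. f x = m0 x \<and> oth f x = m1 x)"
proof -
  define P where "P = {x \<in> {1..n}. cy x \<noteq> 0}"
  have iP: "i \<in> U - P" using i by (auto simp: P_def core_def)
  have PU: "P \<subseteq> U" using t core_U by (auto simp: tinv_def P_def Let_def)
  obtain f where f: "f \<in> F" "\<forall>x\<in>P. f x = m0 x \<and> oth f x = m1 x"
    using t by (auto simp: tinv_def P_def Let_def)
  show ?thesis
  proof (cases "f i = a i")
    case True then show ?thesis using f unfolding P_def by blast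
  next
    case False
    define f' where "f' = (\<lambda>i. if i \<in> U - P then oth f i else f i)"
    have "oth f ` P \<subseteq> f ` P"
    proof
      fix v assume "v \<in> oth f ` P"
      then obtain x where x: "x \<in> P" "v = m1 x" using f by auto
      moreover have "\<forall>x\<in>P. \<exists>y\<in>P. m0 y = m1 x" using t unfolding tinv_def P_def Let_def by blast
      ultimately obtain y where "y \<in> P" "m0 y = m1 x" by blast
      then show "v \<in> f ` P" using f x by force
    qed
    then have "f' \<in> F" unfolding f'_def using flip_solution[OF f(1) PU] by blast
    moreover have "f' i = a i" using F_cases[OF f(1), of i] False iP by (auto simp: f'_def)
    moreover have "f' x = m0 x \<and> oth f' x = m1 x" if "x \<in> P" for x
      using that f by (auto simp: f'_def oth_def)
    ultimately show ?thesis unfolding P_def by blast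
  qed
qed

text \<open>State of a trace that started at \<open>i\<close>: \<open>D\<close> has been numbered
  and \<open>j\<close> is the current position. All successors of points in \<open>D\<close> lie in
  \<open>D\<close> or equal \<open>j\<close>, so once \<open>j\<close> is in \<open>D\<close> the
  cycle is closed.\<close>

definition chain :: "(nat \<Rightarrow> nat) \<Rightarrow> nat \<Rightarrow> nat set \<Rightarrow> nat \<Rightarrow> bool" where
  "chain f i D j \<longleftrightarrow> D \<subseteq> core \<and> j \<in> core \<and> (\<forall>x\<in>D. oth f x = f j \<or> (\<exists>y\<in>D. f y = oth f x)) \<and>
     (\<forall>x\<in>D. (i, x) \<in> (succ_rel D f (oth f))\<^sup>*) \<and>
     (D = {} \<and> j = i \<or> i \<in> D \<and> (\<exists>x\<in>D. oth f x = f j))"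

lemma chain_step:
  assumes f: "f \<in> F" and c: "chain f i D j" and j: "j \<notin> D"
  shows "chain f i (insert j D) (sm U (oth f j) - j)" "f (sm U (oth f j) - j) = oth f j"
proof -
  have jc: "j \<in> core" and DD: "D \<subseteq> core" using c by (auto simp: chain_def)
  obtain y where y: "y \<in> U" "f y = oth f j" "sm U (oth f j) = j + y" using sm_oth[OF f core_U[OF jc]] by blast
  then have e: "sm U (oth f j) - j = y" by simp
  show "f (sm U (oth f j) - j) = oth f j" using y e by simp
  have yc: "y \<in> core" using next_core[OF f jc y(1,2)] .
  let ?R = "succ_rel (insert j D) f (oth f)"
  have old: "(i, x) \<in> ?R\<^sup>*" if "x \<in> D" for x
    using c that succ_rel_mono[of i x D f "oth f" "insert j D" f "oth f"] by (auto simp: chain_def)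
  have new: "(i, j) \<in> ?R\<^sup>*"
  proof (cases "D = {}")
    case True then show ?thesis using c by (auto simp: chain_def)
  next
    case False
    then obtain x where x: "x \<in> D" "oth f x = f j" using c by (auto simp: chain_def)
    then have "(x, j) \<in> ?R" by (auto simp: succ_rel_def)
    then show ?thesis using old[OF x(1)] by (rule rtrancl_into_rtrancl[rotated])
  qed
  have "\<forall>x\<in>insert j D. oth f x = f y \<or> (\<exists>y\<in>insert j D. f y = oth f x)"
    using c y(2) unfolding chain_def by (metis insert_iff)
  then show "chain f i (insert j D) (sm U (oth f j) - j)"
    unfolding e chain_def using jc DD yc old new y(2) c by (auto simp: chain_def)
qed

lemma chain_exit:
  assumes f: "f \<in> F" and c: "chain f i D j" and j: "j \<in> D"
  shows "i \<in> D" "\<And>x. x \<in> D \<Longrightarrow> \<exists>y\<in>D. f y = oth f x"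
    "\<And>x y. x \<in> D \<Longrightarrow> y \<in> D \<Longrightarrow> (x, y) \<in> (succ_rel D f (oth f))\<^sup>*"
proof -
  have D: "D \<subseteq> U" and finD: "finite D"
    using c core_U finite_subset[OF _ fin_core] by (auto simp: chain_def)
  show i: "i \<in> D" using c j by (auto simp: chain_def)
  show cl: "\<exists>y\<in>D. f y = oth f x" if "x \<in> D" for x using c j that unfolding chain_def by metis
  show "(x, y) \<in> (succ_rel D f (oth f))\<^sup>*" if "x \<in> D" "y \<in> D" for x y
  proof (rule succ_rel_reach[OF finD _ _ cl i _ that])
    show "inj_on f D" "inj_on (oth f) D" using F_inj_U[OF f] oth_inj[OF f] D inj_on_subset by blast+
    show "(i, z) \<in> (succ_rel D f (oth f))\<^sup>*" if "z \<in> D" for z using c that by (auto simp: chain_def)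
  qed
qed

lemma tinv_extend:
  assumes t: "tinv q cy m0 m1" and f: "f \<in> F"
    and fP: "\<forall>x\<in>{x \<in> {1..n}. cy x \<noteq> 0}. f x = m0 x \<and> oth f x = m1 x"
    and D: "D \<subseteq> core" "\<And>x. x \<in> D \<Longrightarrow> cy x = 0" "D \<noteq> {}"
    and cl: "\<And>x. x \<in> D \<Longrightarrow> \<exists>y\<in>D. f y = oth f x"
    and co: "\<And>x y. x \<in> D \<Longrightarrow> y \<in> D \<Longrightarrow> (x, y) \<in> (succ_rel D f (oth f))\<^sup>*"
  shows "tinv (Suc q) (\<lambda>x. if x \<in> D then Suc q else cy x) (\<lambda>x. if x \<in> D then f x else m0 x)
     (\<lambda>x. if x \<in> D then oth f x else m1 x)" (is "tinv _ ?cy ?m0 ?m1")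
proof -
  define P where "P = {x \<in> {1..n}. cy x \<noteq> 0}"
  have T: "P \<subseteq> core" "\<forall>x\<in>P. \<exists>y\<in>P. m0 y = m1 x \<and> cy y = cy x"
    "\<forall>x\<in>P. \<forall>y\<in>P. cy x = cy y \<longrightarrow> (x, y) \<in> (succ_rel P m0 m1)\<^sup>*"
    "cy ` P = {1..q}" "\<forall>x\<in>{1..n} - P. m0 x = m x \<and> m1 x = m x"
    using t unfolding tinv_def Let_def P_def by blast+
  have dis: "x \<notin> D" if "x \<in> P" for x using D(2) that by (auto simp: P_def)
  have Dn: "D \<subseteq> {1..n}" using D(1) core_U U_in by blast
  then have P': "{x \<in> {1..n}. ?cy x \<noteq> 0} = P \<union> D" by (auto simp: P_def)
  have cyP: "cy x \<le> q" if "x \<in> P" for x using T(4) that by auto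
  show ?thesis unfolding tinv_def P' Let_def
  proof (intro conjI ballI impI)
    show "P \<union> D \<subseteq> core" using T(1) D(1) by simp
    show "\<exists>f\<in>F. \<forall>x\<in>P \<union> D. f x = ?m0 x \<and> oth f x = ?m1 x"
      using f fP by (intro bexI[of _ f]) (auto simp: P_def)
    show "?cy ` (P \<union> D) = {1..Suc q}"
    proof -
      have "?cy ` P = cy ` P" using dis by (intro image_cong) auto
      moreover have "?cy ` D = {Suc q}" using D(3) by auto
      ultimately show ?thesis unfolding image_Un T(4)[symmetric] using T(4) by (simp add: atLeastAtMostSuc_conv)
    qed
    fix x assume x: "x \<in> P \<union> D"
    show "\<exists>y\<in>P \<union> D. ?m0 y = ?m1 x \<and> ?cy y = ?cy x"
    proof (cases "x \<in> D")
      case True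
      then obtain y where "y \<in> D" "f y = oth f x" using cl by blast
      then show ?thesis using True by (intro bexI[of _ y]) auto
    next
      case False
      then obtain y where "y \<in> P" "m0 y = m1 x" "cy y = cy x" using T(2) x by blast
      then show ?thesis using False dis by (intro bexI[of _ y]) auto
    qed
    fix y assume y: "y \<in> P \<union> D" and e: "?cy x = ?cy y"
    show "(x, y) \<in> (succ_rel (P \<union> D) ?m0 ?m1)\<^sup>*"
    proof (cases "x \<in> D")
      case True
      then have "y \<in> D" using e y cyP[of y] by (auto split: if_splits)
      from succ_rel_mono[OF co[OF True this]] show ?thesis by auto
    next
      case False
      then have xy: "x \<in> P" "y \<in> P" "cy x = cy y" using x y e cyP[of x] by (auto split: if_splits)
      then have "(x, y) \<in> (succ_rel P m0 m1)\<^sup>*" using T(3) by blast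
      from succ_rel_mono[OF this, of "P \<union> D"] show ?thesis using dis by auto
    qed
  next
    fix x assume "x \<in> {1..n} - (P \<union> D)"
    then show "?m0 x = m x" "?m1 x = m x" using T(5) by auto
  qed
qed

text \<open>What remains to be seen is that positions off the core are forced: stripped ones by
  \<open>forced_off\<close>, and the others because they are loops and offer a single
  element.\<close>

lemma tinv_cycle_data:
  assumes t: "tinv q cy m0 m1" and all: "\<And>x. x \<in> core \<Longrightarrow> cy x \<noteq> 0"
  shows "cycle_data n Xs core cy q m0 m1"
proof -
  have P: "{x \<in> {1..n}. cy x \<noteq> 0} = core"
    using t all core_U U_in by (auto simp: tinv_def Let_def)
  note t' = t[unfolded tinv_def Let_def P, THEN conjunct2]
  note T = t'[THEN conjunct1] t'[THEN conjunct2, THEN conjunct1]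
    t'[THEN conjunct2, THEN conjunct2, THEN conjunct1]
    t'[THEN conjunct2, THEN conjunct2, THEN conjunct2, THEN conjunct1]
    t'[THEN conjunct2, THEN conjunct2, THEN conjunct2, THEN conjunct2]
  obtain f where f: "f \<in> F" "\<forall>x\<in>core. f x = m0 x \<and> oth f x = m1 x" using T(1) by (elim bexE)
  have off: "g x = m0 x" if "g \<in> F" "x \<in> {1..n} - core" for g x
  proof -
    have m0: "m0 x = m x" using T(5) that by blast
    show ?thesis
    proof (cases "x \<in> U")
      case True
      then have "a x = b x" using that by (simp add: core_def)
      moreover have "m x \<in> {a x, b x}" using fo that by (auto simp: forced_off_def)
      ultimately show ?thesis using m0 sol_ab[OF that(1), of x] that by auto
    qed (use m0 fo that in \<open>auto simp: forced_off_def\<close>)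
  qed
  have fm: "f x = m0 x" if "x \<in> {1..n}" for x using f off[OF f(1)] that by (cases "x \<in> core") auto
  show ?thesis
  proof
    show "core \<subseteq> {1..n}" using core_U U_in by blast
    show "Xs i \<subseteq> {1..n}" if "i \<in> {1..n}" for i using Xs_sub[OF that] .
    have "bij_betw f {1..n} {1..n}" using f by (simp add: solutions_def)
    then show "bij_betw m0 {1..n} {1..n}" using bij_betw_cong[of "{1..n}" f m0] fm by simp
    have "f i \<in> Xs i" if "i \<in> {1..n}" for i using f(1) that by (auto simp: solutions_def)
    then show "m0 i \<in> Xs i" if "i \<in> {1..n}" for i using fm that by metis
    fix i assume i: "i \<in> core"
    note fc = F_cases[OF f(1) core_U[OF i]] ab[OF U_in[OF core_U[OF i]]]
    have "f i = m0 i" "oth f i = m1 i" using f(2) i by auto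
    moreover have "a i \<noteq> b i" using i by (simp add: core_def)
    ultimately show "Xs i = {m0 i, m1 i}" "m0 i \<noteq> m1 i" using fc by auto
    show "\<exists>j\<in>core. m0 j = m1 i \<and> cy j = cy i" using T(2) i by blast
    fix j assume "j \<in> core" "cy i = cy j"
    then have "(i, j) \<in> (succ_rel core m0 m1)\<^sup>*" using T(3) i by blast
    then show "(i, j) \<in> {(x, y). x \<in> core \<and> y \<in> core \<and> m0 y = m1 x}\<^sup>*" by (simp add: succ_rel_def)
  next
    have "inj_on (oth f) core" using oth_inj[OF f(1)] core_U by (auto intro: inj_on_subset)
    then show "inj_on m1 core" using f(2) inj_on_cong[of core "oth f" m1] by simp
    show "cy ` core = {1..q}" by (rule T(4))
  qed (rule off)
qed

end

text \<open>Tracing leaves \<open>''sum''\<close> untouched, so at the newly reached element it is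
  still the sum of both remaining positions there, and subtracting \<open>j\<close> gives the other
  one.\<close>

definition trace_step :: com where
  "trace_step = (let j = V ''j''; u = V ''u'' in seqs
    [IPut ''cycle'' j (V ''q''),
     IPut ''match0'' j u,
     ISet ''u'' (ISub (IAdd (IGet ''req1'' j) (IGet ''req2'' j)) u),
     IPut ''match1'' j u,
     ISet ''j'' (ISub (IGet ''sum'' u) j)])"

definition trace_loop :: com where
  "trace_loop = While (IEq (IGet ''cycle'' (V ''j'')) (IConst 0)) trace_step"

definition trace_start :: com where
  "trace_start = seqs
    [ISet ''q'' (IAdd (V ''q'') (IConst 1)),
     ISet ''j'' (V ''i''),
     ISet ''u'' (IGet ''req1'' (V ''i''))]"

definition trace_body :: com where
  "trace_body = Seq (ISet ''i'' (IAdd (V ''i'') (IConst 1)))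
     (Cond (BAnd (BAnd (IEq (IGet ''rem'' (V ''i'')) (IConst 0)) (IEq (IGet ''cycle'' (V ''i'')) (IConst 0)))
          (BNot (IEq (IGet ''req1'' (V ''i'')) (IGet ''req2'' (V ''i'')))))
       (Seq trace_start trace_loop) Skip)"

definition trace :: com where
  "trace = Seq (ISet ''i'' (IConst 0)) (While (ILess (V ''i'') (V ''n'')) trace_body)"

context stripped
begin

lemma trace_loop_runs:
  assumes inp: "inp s" and sm: "\<And>v. ints s ''sum'' v = sm U v"
    and f: "f \<in> F" "i \<in> core" "f i = a i" and cy: "ints s ''cycle'' = cy" "cy i = 0"
    and cl: "\<And>x j. j \<in> core \<Longrightarrow> cy j \<noteq> 0 \<Longrightarrow> x \<in> core \<Longrightarrow> oth f x = f j \<Longrightarrow> cy x \<noteq> 0"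
    and q: "ints s ''q'' 0 = q" "q \<noteq> 0" and j: "ints s ''j'' 0 = i" "ints s ''u'' 0 = a i"
    and N: "60 * card {x \<in> core. cy x = 0} + 60 \<le> N"
    and m: "ints s ''match0'' = m0" "ints s ''match1'' = m1"
  shows "runs trace_loop s N (\<lambda>N' s'. \<exists>D. D \<subseteq> {x \<in> core. cy x = 0} \<and> i \<in> D \<and>
     (\<forall>x\<in>D. \<exists>y\<in>D. f y = oth f x) \<and> (\<forall>x\<in>D. \<forall>y\<in>D. (x, y) \<in> (succ_rel D f (oth f))\<^sup>*) \<and>
     ints s' ''cycle'' = (\<lambda>x. if x \<in> D then q else cy x) \<and>
     ints s' ''match0'' = (\<lambda>x. if x \<in> D then f x else m0 x) \<and>
     ints s' ''match1'' = (\<lambda>x. if x \<in> D then oth f x else m1 x) \<and>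
     N \<le> N' + 60 * card D + 20)"
proof -
  let ?I = "\<lambda>N' s'. \<exists>D. chain f i D (ints s' ''j'' 0) \<and> D \<subseteq> {x \<in> core. cy x = 0} \<and>
     ints s' ''u'' 0 = f (ints s' ''j'' 0) \<and>
     ints s' ''cycle'' = (\<lambda>x. if x \<in> D then q else cy x) \<and>
     ints s' ''match0'' = (\<lambda>x. if x \<in> D then f x else m0 x) \<and>
     ints s' ''match1'' = (\<lambda>x. if x \<in> D then oth f x else m1 x) \<and>
     N \<le> N' + 60 * card D"
  let ?b = "IEq (IGet ''cycle'' (V ''j'')) (IConst 0)"
  have finR: "finite {x \<in> core. cy x = 0}" by simp
  show ?thesis unfolding trace_loop_def
  proof (rule runs_While[where I = ?I], goal_cases)
    case 1
    have "chain f i {} i" using f(2) by (simp add: chain_def)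
    then show ?case using j f(3) cy m by (intro exI[of _ "{}"]) simp
  next
    case (2 N' s')
    define j where "j = ints s' ''j'' 0"
    from 2(1) obtain D where D: "chain f i D j" "D \<subseteq> {x \<in> core. cy x = 0}" "ints s' ''u'' 0 = f j"
      "ints s' ''cycle'' = (\<lambda>x. if x \<in> D then q else cy x)"
      "ints s' ''match0'' = (\<lambda>x. if x \<in> D then f x else m0 x)"
      "ints s' ''match1'' = (\<lambda>x. if x \<in> D then oth f x else m1 x)" "N \<le> N' + 60 * card D"
      unfolding j_def by blast
    have inp': "inp s'" using inp_agree[OF inp 2(3)] by (simp add: trace_step_def Let_def)
    have sm': "ints s' ''sum'' v = sm U v" for v
      using sm agreeI[OF 2(3), of "''sum''"] by (simp add: trace_step_def Let_def)
    have q': "ints s' ''q'' 0 = q"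
      using q agreeI[OF 2(3), of "''q''"] by (simp add: trace_step_def Let_def)
    have c0: "ints s' ''cycle'' j = 0" using 2(2) by (simp add: j_def)
    then have jD: "j \<notin> D" and cj: "cy j = 0" using D(4) q(2) by (auto split: if_splits)
    have jc: "j \<in> core" using D(1) by (simp add: chain_def)
    have r: "ints s' ''req1'' j = a j" "ints s' ''req2'' j = b j"
      using inp' U_in[OF core_U[OF jc]] by (auto simp: inp_def)
    have finD: "finite D" using D(2) finR finite_subset by blast
    have D': "insert j D \<subseteq> {x \<in> core. cy x = 0}" using D(2) jc cj by blast
    have "card (insert j D) \<le> card {x \<in> core. cy x = 0}" using card_mono[OF finR D'] .
    then have N': "60 \<le> N'" using N D(7) jD finD by simp
    show ?case
    proof (intro conjI)
      show "1 + btime ?b \<le> N'" using N' by (simp add: IEq_def)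
      show "runs trace_step s' (N' - (1 + btime ?b)) ?I"
      proof (rule runs_straight, goal_cases)
        case 1 show ?case by (simp add: trace_step_def Let_def)
      next
        case 2 show ?case using N' by (simp add: trace_step_def IEq_def Let_def)
      next
        case (3 N'')
        then have t: "N' \<le> N'' + 60" by (simp add: trace_step_def IEq_def Let_def)
        define s2 where "s2 = result trace_step s'"
        have o: "a j + b j - f j = oth f j" by (simp add: oth_def)
        have e: "ints s2 ''j'' 0 = sm U (oth f j) - j" "ints s2 ''u'' 0 = oth f j"
          "ints s2 ''cycle'' = (ints s' ''cycle'')(j := q)"
          "ints s2 ''match0'' = (ints s' ''match0'')(j := f j)"
          "ints s2 ''match1'' = (ints s' ''match1'')(j := oth f j)"
          unfolding s2_def using D(3) r q' sm' o
          by (simp_all add: trace_step_def Let_def mem j_def[symmetric])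
        note cs = chain_step[OF f(1) D(1) jD]
        have "N \<le> N'' + 60 * card (insert j D)" using t D(7) finD jD by simp
        then show ?case unfolding s2_def[symmetric] using cs D' e D(4,5,6)
          by (intro exI[of _ "insert j D"]) (auto simp: fun_eq_iff)
      qed
    qed
  next
    case (3 N' s')
    define j where "j = ints s' ''j'' 0"
    from 3(1) obtain D where D: "chain f i D j" "D \<subseteq> {x \<in> core. cy x = 0}"
      "ints s' ''cycle'' = (\<lambda>x. if x \<in> D then q else cy x)"
      "ints s' ''match0'' = (\<lambda>x. if x \<in> D then f x else m0 x)"
      "ints s' ''match1'' = (\<lambda>x. if x \<in> D then oth f x else m1 x)" "N \<le> N' + 60 * card D"
      unfolding j_def by blast
    have jc: "j \<in> core" using D(1) by (simp add: chain_def)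
    \<comment> \<open>The loop stops at any numbered position, so running into an older cycle has to
      be excluded: by \<open>cl\<close>, a predecessor of a position numbered earlier was itself
      numbered earlier.\<close>
    have jD: "j \<in> D"
    proof (rule ccontr)
      assume "j \<notin> D"
      then have cj: "cy j \<noteq> 0" using 3(2) D(3) by (simp add: j_def)
      then have "j \<noteq> i" using cy by metis
      then obtain x where x: "x \<in> D" "oth f x = f j" using D(1) by (auto simp: chain_def)
      then have "x \<in> core" using D(2) by (auto dest: subsetD)
      then have "cy x \<noteq> 0" by (rule cl[OF jc cj _ x(2)])
      moreover have "x \<in> {x \<in> core. cy x = 0}" using D(2) x(1) by (rule subsetD)
      ultimately show False by simp
    qed
    have "card D \<le> card {x \<in> core. cy x = 0}" using card_mono[OF finR D(2)] .
    then have N': "60 \<le> N'" using N D(6) by linarith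
    note ce = chain_exit[OF f(1) D(1) jD]
    have "N \<le> (N' - (1 + btime ?b)) + 60 * card D + 20" using D(6) N' by (simp add: IEq_def)
    moreover have "1 + btime ?b \<le> N'" using N' by (simp add: IEq_def)
    ultimately show ?case using ce D(2-5) by blast
  qed
qed

text \<open>On the traced set the injections \<open>f\<close> and \<open>oth f\<close> have the same
  image. So the element \<open>f j\<close> is the unchosen end of a traced position, and by
  injectivity of \<open>oth f\<close> that position is \<open>x\<close>.\<close>

lemma tinv_closed:
  assumes t: "tinv q cy m0 m1" and f: "f \<in> F"
    and fP: "\<forall>x\<in>{x \<in> {1..n}. cy x \<noteq> 0}. f x = m0 x \<and> oth f x = m1 x"
    and j: "j \<in> core" "cy j \<noteq> 0" and x: "x \<in> core" "oth f x = f j"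
  shows "cy x \<noteq> 0"
proof -
  define P where "P = {x \<in> {1..n}. cy x \<noteq> 0}"
  have jP: "j \<in> P" using j core_U U_in by (auto simp: P_def)
  have PU: "P \<subseteq> U" using t core_U by (auto simp: tinv_def P_def Let_def)
  have T: "\<forall>x\<in>P. \<exists>y\<in>P. m0 y = m1 x" using t unfolding tinv_def P_def Let_def by blast
  have "oth f ` P \<subseteq> f ` P"
  proof
    fix v assume "v \<in> oth f ` P"
    then obtain z where z: "z \<in> P" "v = m1 z" using fP by (auto simp: P_def)
    then obtain y where "y \<in> P" "m0 y = m1 z" using T by blast
    then show "v \<in> f ` P" using fP z by (force simp: P_def)
  qed
  moreover have "inj_on f P" "inj_on (oth f) P" using F_inj_U[OF f] oth_inj[OF f] PU inj_on_subset by blast+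
  ultimately have "oth f ` P = f ` P"
    by (intro card_subset_eq) (auto simp: card_image P_def)
  then obtain z where z: "z \<in> P" "oth f z = f j" using jP by (metis imageE imageI)
  then have "z = x" using inj_onD[OF oth_inj[OF f], of z x] x PU core_U by auto
  then show ?thesis using z by (simp add: P_def)
qed

lemma trace_runs:
  assumes inp: "inp s" and sm: "\<And>v. ints s ''sum'' v = sm U v" and rem: "rest s = U"
    and z: "\<And>v. ints s ''cycle'' v = 0" "ints s ''q'' 0 = 0"
    and m: "\<And>x. x \<in> {1..n} \<Longrightarrow> ints s ''match0'' x = m x \<and> ints s ''match1'' x = m x"
    and N: "300 * n + 300 \<le> N"
  shows "runs trace s N (\<lambda>N' s'. N \<le> N' + 300 * n + 300 \<and>
    (\<forall>i\<in>{1..n}. i \<notin> core \<longrightarrow> ints s' ''cycle'' i = 0 \<and> ints s' ''match1'' i = ints s' ''match0'' i) \<and>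
    cycle_data n Xs core (ints s' ''cycle'') (ints s' ''q'' 0) (ints s' ''match0'') (ints s' ''match1''))"
    (is "runs trace s N ?Q")
proof -
  let ?b = "ILess (V ''i'') (V ''n'')"
  let ?done = "\<lambda>s'. {x \<in> core. ints s' ''cycle'' x \<noteq> 0}"
  \<comment> \<open>Credits are charged twice: up to 200 per start position examined, and 60 per
    core position that has received a number. As every position is numbered at most once, the nested
    loop stays linear.\<close>
  let ?I = "\<lambda>N' s'. tinv (ints s' ''q'' 0) (ints s' ''cycle'') (ints s' ''match0'') (ints s' ''match1'') \<and>
     ints s' ''i'' 0 \<le> n \<and> (\<forall>x\<in>core. x \<le> ints s' ''i'' 0 \<longrightarrow> ints s' ''cycle'' x \<noteq> 0) \<and>
     N \<le> N' + 200 * ints s' ''i'' 0 + 60 * card (?done s') + 10"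
  have cardc: "card core \<le> n"
  proof -
    have "core \<subseteq> {1..n}" using core_U U_in by blast
    from card_mono[OF _ this] show ?thesis by simp
  qed
  have loop: "runs (While ?b trace_body) (iput ''i'' 0 0 s) N1 ?Q"
    if N1: "N \<le> N1 + 10" for N1
  proof (rule runs_While[where I = ?I], goal_cases)
    case 1
    have "tinv 0 (ints s ''cycle'') (ints s ''match0'') (ints s ''match1'')"
      using ex_sol m by (auto simp: tinv_def z)
    moreover have "x \<noteq> 0" if "x \<in> core" for x using U_in[OF core_U[OF that]] by simp
    ultimately show ?case using z N1 by (auto simp: mem)
  next
    case (2 N' s')
    define i where "i = ints s' ''i'' 0 + 1"
    have ag: "ints s' x = ints s x" if "x \<in> {''n'', ''req1'', ''req2'', ''sum'', ''rem''}" for x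
      using that agreeI[OF 2(3), of x]
      by (auto simp: mem trace_body_def trace_start_def trace_loop_def trace_step_def Let_def)
    have inp': "inp s'" using inp by (simp add: inp_def ag)
    have i: "i \<in> {1..n}" "i \<le> n" using 2(1,2) inp' by (auto simp: i_def inp_def)
    have r: "ints s' ''req1'' i = a i" "ints s' ''req2'' i = b i" using inp' i by (auto simp: inp_def)
    have cd: "card (?done s') \<le> card core" by (rule card_mono) auto
    have N': "200 \<le> N'" using 2(1) N cd cardc i by (simp add: i_def)
    define s1 where "s1 = iput ''i'' 0 i s'"
    have s1: "result (ISet ''i'' (IAdd (V ''i'') (IConst 1))) s' = s1" by (simp add: s1_def i_def)
    show ?case
    proof (intro conjI)
      show "1 + btime ?b \<le> N'" using N' by simp
      show "runs trace_body s' (N' - (1 + btime ?b)) ?I"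
        unfolding trace_body_def
      proof (rule runs_prefix, goal_cases)
        case 1 show ?case by simp
      next
        case 2 show ?case using N' by simp
      next
        case (3 N2)
        have t2: "N' \<le> N2 + 15" using 3 by simp
        have u: "i \<in> U \<longleftrightarrow> ints s' ''rem'' i = 0" using rem i by (auto simp: ag rest_def)
        show ?case unfolding s1
        proof (rule runs_Cond, goal_cases)
          case 1 show ?case using t2 N' by (simp add: IEq_def)
        next
          case 2
          then have ic: "i \<in> core" "ints s' ''cycle'' i = 0" using u r by (auto simp: s1_def mem core_def)
          define q cy m0 m1 where d: "q = ints s' ''q'' 0" "cy = ints s' ''cycle''" "m0 = ints s' ''match0''"
            "m1 = ints s' ''match1''"
          have t: "tinv q cy m0 m1" using \<open>?I N' s'\<close> by (simp add: d)
          obtain f where f: "f \<in> F" "f i = a i" "\<forall>x\<in>{x \<in> {1..n}. cy x \<noteq> 0}. f x = m0 x \<and> oth f x = m1 x"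
            using tinv_start[OF t ic(1)] ic(2) by (auto simp: d)
          have "{x \<in> core. cy x = 0} = core - ?done s'" by (auto simp: d)
          then have cr: "card {x \<in> core. cy x = 0} + card (?done s') = card core"
            using cd by (simp add: card_Diff_subset)
          show ?case
          proof (rule runs_prefix, goal_cases)
            case 1 show ?case by (simp add: trace_start_def)
          next
            case 2 show ?case using t2 N' by (simp add: trace_start_def IEq_def)
          next
            case (3 N3)
            then have t3: "N' \<le> N3 + 100" using t2 by (simp add: trace_start_def IEq_def)
            have "runs trace_loop (result trace_start s1) N3 (\<lambda>N' s'. \<exists>D. D \<subseteq> {x \<in> core. cy x = 0} \<and> i \<in> D \<and>
              (\<forall>x\<in>D. \<exists>y\<in>D. f y = oth f x) \<and> (\<forall>x\<in>D. \<forall>y\<in>D. (x, y) \<in> (succ_rel D f (oth f))\<^sup>*) \<and>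
              ints s' ''cycle'' = (\<lambda>x. if x \<in> D then Suc q else cy x) \<and>
              ints s' ''match0'' = (\<lambda>x. if x \<in> D then f x else m0 x) \<and>
              ints s' ''match1'' = (\<lambda>x. if x \<in> D then oth f x else m1 x) \<and>
              N3 \<le> N' + 60 * card D + 20)"
            proof (rule trace_loop_runs[OF _ _ f(1) ic(1) f(2)])
              show "inp (result trace_start s1)" using inp' by (simp add: inp_def trace_start_def s1_def mem)
              show "ints (result trace_start s1) ''sum'' v = sm U v" for v
                using sm by (simp add: trace_start_def s1_def mem ag)
              show "cy x \<noteq> 0" if "j \<in> core" "cy j \<noteq> 0" "x \<in> core" "oth f x = f j" for x j
                by (rule tinv_closed[OF t f(1,3) that])
              show "60 * card {x \<in> core. cy x = 0} + 60 \<le> N3"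
                using t3 \<open>?I N' s'\<close> N cr cardc i by (simp add: i_def)
            qed (use r ic in \<open>simp_all add: trace_start_def s1_def mem d\<close>)
            then show ?case
            proof (rule runs_mono, goal_cases)
              case (1 N4 s4)
              then obtain D where D: "D \<subseteq> {x \<in> core. cy x = 0}" "i \<in> D"
                "\<forall>x\<in>D. \<exists>y\<in>D. f y = oth f x" "\<forall>x\<in>D. \<forall>y\<in>D. (x, y) \<in> (succ_rel D f (oth f))\<^sup>*"
                "ints s4 ''cycle'' = (\<lambda>x. if x \<in> D then Suc q else cy x)"
                "ints s4 ''match0'' = (\<lambda>x. if x \<in> D then f x else m0 x)"
                "ints s4 ''match1'' = (\<lambda>x. if x \<in> D then oth f x else m1 x)"
                "N3 \<le> N4 + 60 * card D + 20" by blast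
              have k: "ints s4 ''q'' 0 = Suc q" "ints s4 ''i'' 0 = i"
                using agreeI[OF 1(2), of "''q''"] agreeI[OF 1(2), of "''i''"]
                by (simp_all add: trace_loop_def trace_step_def trace_start_def s1_def mem d Let_def)
              have "tinv (Suc q) (ints s4 ''cycle'') (ints s4 ''match0'') (ints s4 ''match1'')"
                unfolding D(5,6,7) using D(1-4) by (intro tinv_extend[OF t f(1,3)]) auto
              moreover have "\<forall>x\<in>core. x \<le> i \<longrightarrow> ints s4 ''cycle'' x \<noteq> 0"
              proof (intro ballI impI)
                fix x assume x: "x \<in> core" "x \<le> i"
                show "ints s4 ''cycle'' x \<noteq> 0"
                proof (cases "x \<in> D")
                  case False
                  then have "x \<le> ints s' ''i'' 0" using x D(2) by (cases "x = i") (auto simp: i_def)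
                  then show ?thesis using \<open>?I N' s'\<close> x False by (simp add: D(5) d)
                qed (simp add: D(5))
              qed
              moreover have "N \<le> N4 + 200 * i + 60 * card (?done s4) + 10"
              proof -
                have "?done s4 = ?done s' \<union> D" using D(1) by (auto simp: D(5) d)
                moreover have "finite D" using D(1) finite_subset[of D core] by auto
                moreover have "?done s' \<inter> D = {}" using D(1) by (auto simp: d)
                ultimately have "card (?done s4) = card (?done s') + card D" by (simp add: card_Un_disjoint)
                then show ?thesis using D(8) t3 \<open>?I N' s'\<close> by (simp add: i_def)
              qed
              ultimately show ?case using k i by simp
            qed
          qed
        next
          case 3
          then have ic: "i \<in> core \<Longrightarrow> ints s' ''cycle'' i \<noteq> 0" using u r by (auto simp: s1_def mem core_def)
          show ?case
          proof (rule runs_straight, goal_cases)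
            case (3 N3)
            have k: "ints s1 ''i'' 0 = i" "\<And>x. x \<noteq> ''i'' \<Longrightarrow> ints s1 x = ints s' x"
              by (simp_all add: s1_def mem)
            have "\<forall>x\<in>core. x \<le> i \<longrightarrow> ints s' ''cycle'' x \<noteq> 0"
            proof (intro ballI impI)
              fix x assume x: "x \<in> core" "x \<le> i"
              show "ints s' ''cycle'' x \<noteq> 0"
                using \<open>?I N' s'\<close> x ic by (cases "x = i") (auto simp: i_def)
            qed
            moreover have "N \<le> N3 + 200 * i + 60 * card (?done s') + 10"
            proof -
              have "N \<le> N' + 200 * ints s' ''i'' 0 + 60 * card (?done s') + 10" using \<open>?I N' s'\<close> by blast
              moreover have "N2 \<le> N3 + 50" using 3 by (simp add: IEq_def)
              ultimately show ?thesis using t2 by (simp add: i_def)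
            qed
            ultimately show ?case using \<open>?I N' s'\<close> i by (simp add: k)
          qed (use t2 N' in \<open>simp_all add: IEq_def\<close>)
        qed
      qed
    qed
  next
    case (3 N' s')
    have "ints s' ''n'' 0 = n"
      using inp agreeI[OF 3(3), of "''n''"]
      by (simp add: inp_def mem trace_body_def trace_start_def trace_loop_def trace_step_def Let_def)
    then have i: "ints s' ''i'' 0 = n" using 3(1,2) by simp
    have "x \<le> n" if "x \<in> core" for x using U_in[OF core_U[OF that]] by simp
    then have all: "\<And>x. x \<in> core \<Longrightarrow> ints s' ''cycle'' x \<noteq> 0" using 3(1) i by simp
    have t: "tinv (ints s' ''q'' 0) (ints s' ''cycle'') (ints s' ''match0'') (ints s' ''match1'')" using 3(1) by blast
    have "card (?done s') \<le> card core" by (rule card_mono) auto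
    then have N': "N \<le> N' + 260 * n + 10" using 3(1) i cardc by simp
    have "ints s' ''cycle'' x = 0 \<and> ints s' ''match1'' x = ints s' ''match0'' x" if x: "x \<in> {1..n}" "x \<notin> core" for x
    proof -
      have "ints s' ''cycle'' x = 0" using t x unfolding tinv_def Let_def by blast
      moreover have "\<forall>x\<in>{1..n} - {x \<in> {1..n}. ints s' ''cycle'' x \<noteq> 0}. ints s' ''match0'' x = m x \<and> ints s' ''match1'' x = m x"
        using t unfolding tinv_def Let_def by blast
      ultimately show ?thesis using x by auto
    qed
    then show ?case using tinv_cycle_data[OF t all] N' N by simp
  qed
  show ?thesis unfolding trace_def
  proof (rule runs_prefix, goal_cases)
    case (3 N1) then show ?case using loop[of N1] by simp
  qed (use N in simp_all)
qed

end

section \<open>Preprocessing: the table of arc weights\<close>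

text \<open>\<open>''x''\<close> accumulates multiples of the width \<open>''w''\<close>, a
  substitute for integer multiplication.\<close>

definition rows_body :: com where
  "rows_body = seqs
    [IPut ''row'' (V ''i'') (V ''x''),
     ISet ''x'' (IAdd (V ''x'') (V ''w'')),
     ISet ''i'' (IAdd (V ''i'') (IConst 1))]"

definition rows :: com where
  "rows = Seq (seqs [ISet ''w'' (IAdd (IAdd (V ''q'') (V ''q'')) (IConst 2)), ISet ''i'' (IConst 0), ISet ''x'' (IConst 0)])
     (While (ILess (V ''i'') (V ''w'')) rows_body)"

text \<open>Which of the four given weights applies depends on whether the matched element is the
  first entry of its requisition. Positions off the cycles have cycle number 0 and equal entries in
  both matchings; they fill the cells of index 0 for both choices, of which the enumeration reads
  only choice 0.\<close>

definition arc_add :: "string \<Rightarrow> nat \<Rightarrow> string \<Rightarrow> nat \<Rightarrow> com" where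
  "arc_add M d M' e = (let i = V ''i''; k = V ''k''; c = IGet ''cycle'' i; c' = IGet ''cycle'' k;
     x = IAdd (IGet ''row'' (IAdd (IAdd c c) (IConst d))) (IAdd (IAdd c' c') (IConst e));
     add = (\<lambda>arc. RPut ''P'' x (RAdd (RGet ''P'' x) (RGet arc i)))
   in Cond (IEq (IGet M i) (IGet ''req1'' i))
        (Cond (IEq (IGet M' k) (IGet ''req1'' k)) (add ''arc11'') (add ''arc12''))
        (Cond (IEq (IGet M' k) (IGet ''req1'' k)) (add ''arc21'') (add ''arc22'')))"

definition arcs_body :: com where
  "arcs_body = seqs
    [ISet ''i'' (IAdd (V ''i'') (IConst 1)),
     Cond (ILess (V ''i'') (V ''n'')) (ISet ''k'' (IAdd (V ''i'') (IConst 1))) (ISet ''k'' (IConst 1)),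
     arc_add ''match0'' 0 ''match0'' 0, arc_add ''match0'' 0 ''match1'' 1,
     arc_add ''match1'' 1 ''match0'' 0, arc_add ''match1'' 1 ''match1'' 1]"

definition arcs :: com where
  "arcs = Seq (ISet ''i'' (IConst 0)) (While (ILess (V ''i'') (V ''n'')) arcs_body)"

lemma rows_runs:
  assumes q: "ints s ''q'' 0 = q" and N: "60 * q + 100 \<le> N"
  shows "runs rows s N (\<lambda>N' s'. N \<le> N' + 60 * q + 100 \<and> (\<forall>u<2*q+2. ints s' ''row'' u = u * (2*q+2)))"
  unfolding rows_def
proof (rule runs_prefix, goal_cases)
  case (3 N1)
  define s1 where "s1 = result (seqs [ISet ''w'' (IAdd (IAdd (V ''q'') (V ''q'')) (IConst 2)),
    ISet ''i'' (IConst 0), ISet ''x'' (IConst 0)]) s"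
  have N1: "N \<le> N1 + 20" using 3 by simp
  have w1: "ints s1 ''w'' 0 = 2*q+2" by (simp add: s1_def mem q)
  have "runs (While (ILess (V ''i'') (V ''w'')) rows_body) s1 N1
    (\<lambda>N' s'. N1 \<le> N' + (20 + 6) * (2*q+2) + 6 \<and> ((\<forall>u<2*q+2. ints s' ''row'' u = u * (2*q+2)) \<and>
       ints s' ''x'' 0 = (2*q+2) * (2*q+2)))"
  proof (rule runs_for[where P = "\<lambda>t s'. (\<forall>u<t. ints s' ''row'' u = u * (2*q+2)) \<and> ints s' ''x'' 0 = t * (2*q+2)"], goal_cases)
    case (1 s') then show ?case using w1 agreeI[OF 1, of "''w''"] by (simp add: rows_body_def)
  next
    case (5 t s' N')
    have w: "ints s' ''w'' 0 = 2*q+2" using w1 agreeI[OF 5(4), of "''w''"] by (simp add: rows_body_def)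
    show ?case
    proof (rule runs_straight, goal_cases)
      case (3 N2)
      then show ?case using 5(2,3) w by (auto simp: rows_body_def mem less_Suc_eq algebra_simps)
    qed (use 5 in \<open>simp_all add: rows_body_def\<close>)
  next
    case 6 then show ?case using N N1 by simp
  qed (simp_all add: s1_def mem)
  then show ?case unfolding s1_def by (rule runs_mono) (use N1 in auto)
qed (use N in simp_all)

section \<open>What the table contains and how the tour cost is read from it\<close>

context tsp_instance
begin

definition nxt :: "nat \<Rightarrow> nat" where "nxt i = (if i = n then 1 else i + 1)"

lemma nxt_range: "i \<in> {1..n} \<Longrightarrow> nxt i \<in> {1..n}" by (auto simp: nxt_def)

definition rinp :: "(nat \<Rightarrow> nat \<Rightarrow> real) \<Rightarrow> memory \<Rightarrow> bool" where
  "rinp \<rho> s \<longleftrightarrow> (\<forall>i\<in>{1..n}. reals s ''arc11'' i = \<rho> (a i) (a (nxt i)) \<and> reals s ''arc12'' i = \<rho> (a i) (b (nxt i)) \<and>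
     reals s ''arc21'' i = \<rho> (b i) (a (nxt i)) \<and> reals s ''arc22'' i = \<rho> (b i) (b (nxt i)))"

text \<open>\<open>k\<close> is an address in the flattened table, and \<open>x\<close> stands for
  the arc from position \<open>x\<close> to the next one. The arc is stored under the cycles of both
  positions and the choices \<open>d\<close> and \<open>e\<close> made there.\<close>

definition entry :: "(nat \<Rightarrow> nat \<Rightarrow> real) \<Rightarrow> nat \<Rightarrow> (nat \<Rightarrow> nat) \<Rightarrow> (nat \<Rightarrow> nat \<Rightarrow> nat) \<Rightarrow> nat \<Rightarrow> nat \<Rightarrow> nat \<Rightarrow> nat \<Rightarrow> real" where
  "entry \<rho> q cy mm d e x k = (if k = (2 * cy x + d) * (2*q+2) + (2 * cy (nxt x) + e)
     then \<rho> (mm d x) (mm e (nxt x)) else 0)"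

definition contrib :: "(nat \<Rightarrow> nat \<Rightarrow> real) \<Rightarrow> nat \<Rightarrow> (nat \<Rightarrow> nat) \<Rightarrow> (nat \<Rightarrow> nat \<Rightarrow> nat) \<Rightarrow> nat \<Rightarrow> nat \<Rightarrow> real" where
  "contrib \<rho> q cy mm x k = entry \<rho> q cy mm 0 0 x k + entry \<rho> q cy mm 0 1 x k +
     entry \<rho> q cy mm 1 0 x k + entry \<rho> q cy mm 1 1 x k"

lemma arc_add_result:
  assumes inp: "inp s" and rinp: "rinp \<rho> s" and i: "ints s ''i'' 0 = i" "i \<in> {1..n}" and k: "ints s ''k'' 0 = nxt i"
    and row: "\<forall>u<2*q+2. ints s ''row'' u = u * (2*q+2)" and cy: "\<forall>x\<in>{1..n}. ints s ''cycle'' x \<le> q"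
    and m: "\<forall>x\<in>{1..n}. ints s M x \<in> {a x, b x} \<and> ints s M' x \<in> {a x, b x}"
    and d: "d \<le> 1" "e \<le> 1"
    and mm: "mm d i = ints s M i" "mm e (nxt i) = ints s M' (nxt i)"
    and s': "s' = result (arc_add M d M' e) s"
  shows "reals s' ''P'' x = reals s ''P'' x + entry \<rho> q (ints s ''cycle'') mm d e i x"
    "ints s' = ints s" "\<And>y. y \<noteq> ''P'' \<Longrightarrow> reals s' y = reals s y"
proof -
  have n: "nxt i \<in> {1..n}" using nxt_range i by blast
  have c: "ints s ''cycle'' i \<le> q" using cy i(2) by blast
  have r: "ints s ''req1'' i = a i" "ints s ''req1'' (nxt i) = a (nxt i)" using inp i n by (auto simp: inp_def)
  have ro: "ints s ''row'' (ints s ''cycle'' i + ints s ''cycle'' i + d) = (2 * ints s ''cycle'' i + d) * (2*q+2)"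
    using row[rule_format, of "ints s ''cycle'' i + ints s ''cycle'' i + d"] c d by (simp add: mult_2)
  have mi: "ints s M i = a i \<or> ints s M i = b i" "ints s M' (nxt i) = a (nxt i) \<or> ints s M' (nxt i) = b (nxt i)"
    using m i(2) n by auto
  have R: "reals s ''arc11'' i = \<rho> (a i) (a (nxt i))" "reals s ''arc12'' i = \<rho> (a i) (b (nxt i))"
     "reals s ''arc21'' i = \<rho> (b i) (a (nxt i))" "reals s ''arc22'' i = \<rho> (b i) (b (nxt i))"
    using rinp i(2) by (auto simp: rinp_def)
  have "s' = rput ''P'' ((2 * ints s ''cycle'' i + d) * (2*q+2) + (2 * ints s ''cycle'' (nxt i) + e))
     (reals s ''P'' ((2 * ints s ''cycle'' i + d) * (2*q+2) + (2 * ints s ''cycle'' (nxt i) + e)) +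
      \<rho> (mm d i) (mm e (nxt i))) s"
    unfolding s' arc_add_def Let_def result.simps bval_IEq ival.simps rval.simps ival_V i(1) k ro r mm
    using mi R by (auto simp: mult_2)
  then show "reals s' ''P'' x = reals s ''P'' x + entry \<rho> q (ints s ''cycle'') mm d e i x"
    "ints s' = ints s" "\<And>y. y \<noteq> ''P'' \<Longrightarrow> reals s' y = reals s y"
    by (simp_all add: mem entry_def)
qed

lemma arcs_runs:
  assumes inp: "inp s" and rinp: "rinp \<rho> s" and cy: "\<forall>x\<in>{1..n}. ints s ''cycle'' x \<le> q"
    and row: "\<forall>u<2*q+2. ints s ''row'' u = u * (2*q+2)"
    and m: "\<forall>x\<in>{1..n}. ints s ''match0'' x \<in> {a x, b x} \<and> ints s ''match1'' x \<in> {a x, b x}"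
    and z: "\<And>k. reals s ''P'' k = 0"
    and mm: "mm = (\<lambda>d x. if d = 0 then ints s ''match0'' x else ints s ''match1'' x)"
    and N: "500 * n + 100 \<le> N"
  shows "runs arcs s N (\<lambda>N' s'. N \<le> N' + 500 * n + 100 \<and>
    (\<forall>k. reals s' ''P'' k = (\<Sum>x=1..n. contrib \<rho> q (ints s ''cycle'') mm x k)))"
  unfolding arcs_def
proof (rule runs_prefix, goal_cases)
  case (3 N1)
  define s1 where "s1 = result (ISet ''i'' (IConst 0)) s"
  have N1: "N \<le> N1 + 20" using 3 by simp
  have iw: "iwrites arcs_body = {''i'', ''k''}" "rwrites arcs_body = {''P''}"
    by (auto simp: arcs_body_def arc_add_def Let_def)
  have "runs (While (ILess (V ''i'') (V ''n'')) arcs_body) s1 N1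
    (\<lambda>N' s'. N1 \<le> N' + (450 + 6) * n + 6 \<and>
      (\<forall>k. reals s' ''P'' k = (\<Sum>x=1..n. contrib \<rho> q (ints s ''cycle'') mm x k)))"
  proof (rule runs_for[where P = "\<lambda>t s'. \<forall>k. reals s' ''P'' k = (\<Sum>x=1..t. contrib \<rho> q (ints s ''cycle'') mm x k)"],
      goal_cases)
    case (1 s')
    then show ?case using inp agreeI[OF 1, of "''n''"] by (simp add: iw inp_def s1_def mem)
  next
    case (5 t s' N')
    define i where "i = t + 1"
    have i: "i \<in> {1..n}" using 5(1) by (simp add: i_def)
    define s2 where "s2 = iput ''k'' 0 (nxt i) (iput ''i'' 0 i s')"
    have ag: "ints s2 y = ints s y" if "y \<noteq> ''i''" "y \<noteq> ''k''" for y
      using that agreeI[OF 5(4), of y] by (simp add: iw s2_def s1_def mem)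
    have agr: "reals s2 y = reals s y" if "y \<noteq> ''P''" for y
      using that agreeR[OF 5(4), of y] by (simp add: iw s2_def s1_def mem)
    have n': "ints s' ''n'' 0 = n" using inp ag[of "''n''"] by (simp add: inp_def s2_def mem)
    have "result (Cond (ILess (V ''i'') (V ''n'')) (ISet ''k'' (IAdd (V ''i'') (IConst 1))) (ISet ''k'' (IConst 1)))
        (result (ISet ''i'' (IAdd (V ''i'') (IConst 1))) s') = s2"
      using i 5(2) n' by (auto simp: s2_def nxt_def i_def mem)
    note st2 = this
    let ?ok = "\<lambda>s3. ints s3 = ints s2 \<and> (\<forall>y. y \<noteq> ''P'' \<longrightarrow> reals s3 y = reals s2 y)"
    let ?cy = "ints s ''cycle''"
    have stp: "?ok (result (arc_add M d M' e) s3) \<and>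
        (\<forall>x. reals (result (arc_add M d M' e) s3) ''P'' x = reals s3 ''P'' x + entry \<rho> q ?cy mm d e i x)"
      if ok: "?ok s3" and M: "M = ''match0'' \<and> d = 0 \<or> M = ''match1'' \<and> d = 1"
        "M' = ''match0'' \<and> e = 0 \<or> M' = ''match1'' \<and> e = 1" for s3 M d M' e
    proof -
      have c: "ints s3 y = ints s y" if "y \<noteq> ''i''" "y \<noteq> ''k''" for y using ok ag that by simp
      have cr: "reals s3 y = reals s y" if "y \<noteq> ''P''" for y using ok agr that by simp
      have 1: "inp s3" using inp by (simp add: inp_def c)
      have 2: "rinp \<rho> s3" using rinp by (simp add: rinp_def cr)
      have 3: "ints s3 ''i'' 0 = i" "ints s3 ''k'' 0 = nxt i" using ok by (simp_all add: s2_def mem)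
      have Mn: "M \<noteq> ''i''" "M \<noteq> ''k''" "M' \<noteq> ''i''" "M' \<noteq> ''k''" using M by auto
      have 4: "\<forall>u<2*q+2. ints s3 ''row'' u = u * (2*q+2)" using row by (simp add: c)
      have 5: "\<forall>x\<in>{1..n}. ints s3 ''cycle'' x \<le> q" using cy by (simp add: c)
      have 6: "\<forall>x\<in>{1..n}. ints s3 M x \<in> {a x, b x} \<and> ints s3 M' x \<in> {a x, b x}"
        unfolding c[OF Mn(1,2)] c[OF Mn(3,4)] using M m by metis
      have 7: "d \<le> 1" "e \<le> 1" "mm d i = ints s3 M i" "mm e (nxt i) = ints s3 M' (nxt i)"
        unfolding c[OF Mn(1,2)] c[OF Mn(3,4)] mm using M by auto
      note R = arc_add_result[OF 1 2 3(1) i 3(2) 4 5 6 7 refl]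
      have "ints s3 ''cycle'' = ?cy" by (rule c) auto
      then show ?thesis using R ok by simp
    qed
    show ?case
    proof (rule runs_straight, goal_cases)
      case 1 show ?case by (simp add: arcs_body_def arc_add_def Let_def)
    next
      case 2 show ?case using 5(5) by (simp add: arcs_body_def arc_add_def Let_def IEq_def)
    next
      case (3 N2)
      have t: "N' \<le> N2 + 450" using 3 by (simp add: arcs_body_def arc_add_def Let_def IEq_def)
      define s3 where "s3 = result (arc_add ''match0'' 0 ''match0'' 0) s2"
      define s4 where "s4 = result (arc_add ''match0'' 0 ''match1'' 1) s3"
      define s5 where "s5 = result (arc_add ''match1'' 1 ''match0'' 0) s4"
      define s6 where "s6 = result (arc_add ''match1'' 1 ''match1'' 1) s5"
      have r: "result arcs_body s' = s6"
        unfolding arcs_body_def seqs.simps result.simps(3) st2 s6_def s5_def s4_def s3_def by simp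
      have o3: "?ok s3 \<and> (\<forall>x. reals s3 ''P'' x = reals s2 ''P'' x + entry \<rho> q ?cy mm 0 0 i x)"
        unfolding s3_def by (rule stp) auto
      have o4: "?ok s4 \<and> (\<forall>x. reals s4 ''P'' x = reals s3 ''P'' x + entry \<rho> q ?cy mm 0 1 i x)"
        unfolding s4_def using o3 by (intro stp) auto
      have o5: "?ok s5 \<and> (\<forall>x. reals s5 ''P'' x = reals s4 ''P'' x + entry \<rho> q ?cy mm 1 0 i x)"
        unfolding s5_def using o4 by (intro stp) auto
      have o6: "?ok s6 \<and> (\<forall>x. reals s6 ''P'' x = reals s5 ''P'' x + entry \<rho> q ?cy mm 1 1 i x)"
        unfolding s6_def using o5 by (intro stp) auto
      have "ints s6 ''i'' 0 = t + 1" using o6 by (simp add: s2_def mem i_def)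
      moreover have "reals s6 ''P'' k = (\<Sum>x=1..t+1. contrib \<rho> q ?cy mm x k)" for k
      proof -
        have "(\<Sum>x=1..t+1. h x) = (\<Sum>x=1..t. h x) + h (t + 1)" for h :: "nat \<Rightarrow> real"
          using sum.cl_ivl_Suc[of h 1 t] by (simp flip: Suc_eq_plus1)
        then show ?thesis using o3 o4 o5 o6 5(3) by (simp add: contrib_def s2_def mem i_def)
      qed
      ultimately show ?case unfolding r using t by simp
    qed
  next
    case 6 then show ?case using N N1 by simp
  qed (simp_all add: s1_def mem z)
  then show ?case unfolding s1_def by (rule runs_mono) (use N1 in auto)
qed (use N in simp_all)

lemma pair_code:
  assumes "v < (w::nat)" "v' < w" shows "u * w + v = u' * w + v' \<longleftrightarrow> u = u' \<and> v = v'"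
proof
  assume e: "u * w + v = u' * w + v'"
  have "u = (u * w + v) div w" "v = (u * w + v) mod w" "u' = (u' * w + v') div w" "v' = (u' * w + v') mod w"
    using assms by auto
  then show "u = u' \<and> v = v'" using e by metis
qed simp

lemma sum_entry:
  assumes d: "\<forall>j\<le>q. \<delta> j \<le> 1" and de: "d \<le> 1" "e \<le> 1" and cy: "cy x \<le> q" "cy (nxt x) \<le> q"
  shows "(\<Sum>j\<le>q. \<Sum>k\<le>q. entry \<rho> q cy mm d e x ((2*j + \<delta> j) * (2*q+2) + (2*k + \<delta> k))) =
    (if \<delta> (cy x) = d \<and> \<delta> (cy (nxt x)) = e then \<rho> (mm d x) (mm e (nxt x)) else 0)"
proof -
  let ?r = "\<rho> (mm d x) (mm e (nxt x))"
  have eq: "entry \<rho> q cy mm d e x ((2*j + \<delta> j) * (2*q+2) + (2*k + \<delta> k)) =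
     (if j = cy x then if k = cy (nxt x) then if \<delta> (cy x) = d \<and> \<delta> (cy (nxt x)) = e then ?r else 0 else 0 else 0)"
    if jk: "j \<le> q" "k \<le> q" for j k
  proof -
    have l: "\<delta> j \<le> 1" "\<delta> k \<le> 1" using d jk by auto
    have "(2*j + \<delta> j) * (2*q+2) + (2*k + \<delta> k) = (2 * cy x + d) * (2*q+2) + (2 * cy (nxt x) + e) \<longleftrightarrow>
       2*j + \<delta> j = 2 * cy x + d \<and> 2*k + \<delta> k = 2 * cy (nxt x) + e"
      by (rule pair_code) (use l jk cy de in linarith)+
    also have "\<dots> \<longleftrightarrow> (j = cy x \<and> \<delta> j = d) \<and> (k = cy (nxt x) \<and> \<delta> k = e)"
    proof -
      have "2*y + z = 2*y' + z' \<longleftrightarrow> y = y' \<and> z = z'" if "z \<le> 1" "z' \<le> 1" for y y' z z' :: nat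
        using that by presburger
      then show ?thesis using l de by blast
    qed
    finally show ?thesis unfolding entry_def by auto
  qed
  have "(\<Sum>j\<le>q. \<Sum>k\<le>q. entry \<rho> q cy mm d e x ((2*j + \<delta> j) * (2*q+2) + (2*k + \<delta> k))) =
    (\<Sum>j\<le>q. \<Sum>k\<le>q. (if j = cy x then if k = cy (nxt x) then if \<delta> (cy x) = d \<and> \<delta> (cy (nxt x)) = e then ?r else 0 else 0 else 0))"
    by (intro sum.cong refl eq) auto
  also have "\<dots> = (\<Sum>j\<le>q. if j = cy x then if \<delta> (cy x) = d \<and> \<delta> (cy (nxt x)) = e then ?r else 0 else 0)"
    using cy(2) by (intro sum.cong refl) simp
  also have "\<dots> = (if \<delta> (cy x) = d \<and> \<delta> (cy (nxt x)) = e then ?r else 0)" using cy(1) by simp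
  finally show ?thesis .
qed

text \<open>After exchanging the sums each arc can be treated alone. Of its four entries, exactly
  the one for the choices that \<delta> makes in the cycles of its two positions lies in a cell that
  is read, and it is read once. Two positions in the same cycle lead to a diagonal pair, where the
  choices agree automatically.\<close>

lemma sum_table:
  assumes P: "\<forall>k. P k = (\<Sum>x=1..n. contrib \<rho> q cy mm x k)" and cy: "\<forall>x\<in>{1..n}. cy x \<le> q"
    and d: "\<forall>j\<le>q. \<delta> j \<le> 1"
  shows "(\<Sum>j\<le>q. \<Sum>k\<le>q. P ((2*j + \<delta> j) * (2*q+2) + (2*k + \<delta> k))) =
    (\<Sum>x=1..n. \<rho> (mm (\<delta> (cy x)) x) (mm (\<delta> (cy (nxt x))) (nxt x)))"
proof -
  have "(\<Sum>j\<le>q. \<Sum>k\<le>q. P ((2*j + \<delta> j) * (2*q+2) + (2*k + \<delta> k))) =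
    (\<Sum>j\<le>q. \<Sum>k\<le>q. \<Sum>x=1..n. contrib \<rho> q cy mm x ((2*j + \<delta> j) * (2*q+2) + (2*k + \<delta> k)))"
    using P by simp
  also have "\<dots> = (\<Sum>x=1..n. \<Sum>j\<le>q. \<Sum>k\<le>q. contrib \<rho> q cy mm x ((2*j + \<delta> j) * (2*q+2) + (2*k + \<delta> k)))"
    by (simp only: sum.swap[of _ "{..q}" "{1..n}"])
  also have "\<dots> = (\<Sum>x=1..n. \<rho> (mm (\<delta> (cy x)) x) (mm (\<delta> (cy (nxt x))) (nxt x)))"
  proof (rule sum.cong[OF refl])
    fix x assume x: "x \<in> {1..n}"
    then have c: "cy x \<le> q" "cy (nxt x) \<le> q" using cy nxt_range[OF x] by auto
    then have l: "\<delta> (cy x) \<le> 1" "\<delta> (cy (nxt x)) \<le> 1" using d by auto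
    then have l': "\<delta> (cy x) = 0 \<or> \<delta> (cy x) = 1" "\<delta> (cy (nxt x)) = 0 \<or> \<delta> (cy (nxt x)) = 1" by linarith+
    show "(\<Sum>j\<le>q. \<Sum>k\<le>q. contrib \<rho> q cy mm x ((2*j + \<delta> j) * (2*q+2) + (2*k + \<delta> k))) =
      \<rho> (mm (\<delta> (cy x)) x) (mm (\<delta> (cy (nxt x))) (nxt x))"
      unfolding contrib_def sum.distrib
      by (simp only: sum_entry[where cy = cy and x = x, OF d _ _ c] order_refl le_numeral_extra) (use l' in auto)
  qed
  finally show ?thesis .
qed

end

section \<open>Enumeration of the neighborhood\<close>

lemma sum_lessThan_plus1: "(\<Sum>k<t+(1::nat). h k) = (\<Sum>k<t. h k) + (h t :: real)"
  by (simp only: sum.lessThan_Suc flip: Suc_eq_plus1)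

lemma lessThan_plus1: "{..<q+1} = {..q::nat}"
  by auto

text \<open>Index 0 is the dummy cycle; \<open>load_vector\<close> leaves 0 there in
  \<open>''delta''\<close>, as required for forced positions.\<close>

definition cell :: "iexp \<Rightarrow> iexp \<Rightarrow> rexp" where
  "cell j k = RGet ''P'' (IAdd (IGet ''row'' (IAdd (IAdd j j) (IGet ''delta'' j))) (IAdd (IAdd k k) (IGet ''delta'' k)))"

definition q_plus_one :: iexp where "q_plus_one = IAdd (V ''q'') (IConst 1)"

definition inner_body :: com where
  "inner_body = seqs
    [RPut ''tot'' (IConst 0) (RAdd (RGet ''tot'' (IConst 0)) (cell (V ''j'') (V ''k''))),
     ISet ''k'' (IAdd (V ''k'') (IConst 1))]"

definition outer_body :: com where
  "outer_body = Seq (ISet ''k'' (IConst 0)) (Seq (While (ILess (V ''k'') q_plus_one) inner_body)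
     (ISet ''j'' (IAdd (V ''j'') (IConst 1))))"

definition total :: com where
  "total = Seq (seqs [RPut ''tot'' (IConst 0) (RConst 0), ISet ''j'' (IConst 0)])
     (While (ILess (V ''j'') q_plus_one) outer_body)"

definition line_body :: "(rexp \<Rightarrow> rexp \<Rightarrow> rexp) \<Rightarrow> com" where
  "line_body f = seqs
    [RPut ''x'' (IConst 0) (f (RGet ''x'' (IConst 0)) (RAdd (cell (V ''r'') (V ''k'')) (cell (V ''k'') (V ''r'')))),
     ISet ''k'' (IAdd (V ''k'') (IConst 1))]"

definition line :: "(rexp \<Rightarrow> rexp \<Rightarrow> rexp) \<Rightarrow> com" where
  "line f = Seq (ISet ''k'' (IConst 0)) (While (ILess (V ''k'') q_plus_one) (line_body f))"

definition flip :: com where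
  "flip = IPut ''delta'' (V ''r'') (ISub (IConst 1) (IGet ''delta'' (V ''r'')))"

definition copy_body :: com where
  "copy_body = seqs
    [ISet ''k'' (IAdd (V ''k'') (IConst 1)),
     IPut ''nbr'' (IAdd (V ''pos'') (V ''k'')) (IGet ''delta'' (V ''k''))]"

definition copy :: com where
  "copy = Seq (ISet ''k'' (IConst 0)) (While (ILess (V ''k'') (V ''q'')) copy_body)"

text \<open>A pass over row and column counts the diagonal cell twice; this undoes the surplus, with
  the sign opposite to that of the pass.\<close>

definition x_put :: "(rexp \<Rightarrow> rexp \<Rightarrow> rexp) \<Rightarrow> com" where
  "x_put f = RPut ''x'' (IConst 0) (f (RGet ''x'' (IConst 0)) (cell (V ''r'') (V ''r'')))"

text \<open>The full table sum is computed once, outside this loop; a neighbor then takes two passes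
  over a row and a column and one copy of the vector, which is linear in q. The second
  \<open>flip\<close> restores \<delta> for the next round.\<close>

definition enum_body :: com where
  "enum_body =
     Seq (seqs [ISet ''r'' (IAdd (V ''r'') (IConst 1)), RPut ''x'' (IConst 0) (RGet ''tot'' (IConst 0))])
    (Seq (line RSub)
    (Seq (seqs [x_put RAdd, flip])
    (Seq (line RAdd)
    (Seq (seqs [x_put RSub, RPut ''cost'' (V ''r'') (RGet ''x'' (IConst 0))])
    (Seq copy
    (seqs [ISet ''pos'' (IAdd (V ''pos'') (V ''q'')), flip]))))))"

definition list_neighbors :: com where
  "list_neighbors = Seq total (Seq (seqs [ISet ''count'' (V ''q''), ISet ''pos'' (IConst 0), ISet ''r'' (IConst 0)])
     (While (ILess (V ''r'') (V ''q'')) enum_body))"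

section \<open>Table sums and the effect of a flip\<close>

definition entry_at :: "memory \<Rightarrow> (nat \<Rightarrow> nat) \<Rightarrow> nat \<Rightarrow> nat \<Rightarrow> real" where
  "entry_at s d j k = reals s ''P'' (ints s ''row'' (2 * j + d j) + (2 * k + d k))"

definition table_sum :: "memory \<Rightarrow> (nat \<Rightarrow> nat) \<Rightarrow> real" where
  "table_sum s d = (\<Sum>j\<le>ints s ''q'' 0. \<Sum>k\<le>ints s ''q'' 0. entry_at s d j k)"

lemma rval_cell: "rval (cell j k) s = entry_at s (ints s ''delta'') (ival j s) (ival k s)"
  by (simp add: cell_def entry_at_def mult_2)

lemma rtime_cell: "rtime (cell j k) = 9 + 3 * itime j + 3 * itime k"
  by (simp add: cell_def)

lemma q_plus_one [simp]: "ival q_plus_one s = ints s ''q'' 0 + 1" "itime q_plus_one = 4"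
  by (simp_all add: q_plus_one_def)

lemma table_sum_cong:
  assumes "ints s ''q'' 0 = ints s' ''q'' 0" "ints s ''row'' = ints s' ''row''" "reals s ''P'' = reals s' ''P''"
  shows "entry_at s = entry_at s'" "table_sum s = table_sum s'"
proof -
  show e: "entry_at s = entry_at s'" by (intro ext) (simp add: entry_at_def assms)
  show "table_sum s = table_sum s'" by (intro ext) (simp add: table_sum_def assms e)
qed

text \<open>Flipping one coordinate changes only one row and one column of the table.\<close>

lemma sum_cross:
  fixes h :: "nat \<Rightarrow> nat \<Rightarrow> real"
  assumes r: "r \<le> q"
  shows "(\<Sum>j\<le>q. \<Sum>k\<le>q. h j k) =
    (\<Sum>j\<in>{..q} - {r}. \<Sum>k\<in>{..q} - {r}. h j k) + (\<Sum>k\<le>q. h r k + h k r) - h r r"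
proof -
  have s: "(\<Sum>k\<le>q. g k) = g r + (\<Sum>k\<in>{..q} - {r}. g k)" for g :: "nat \<Rightarrow> real"
    using r by (intro sum.remove) auto
  have "(\<Sum>j\<le>q. \<Sum>k\<le>q. h j k) = (\<Sum>k\<le>q. h r k) + (\<Sum>j\<in>{..q} - {r}. \<Sum>k\<le>q. h j k)" by (rule s)
  also have "(\<Sum>j\<in>{..q} - {r}. \<Sum>k\<le>q. h j k) =
      (\<Sum>j\<in>{..q} - {r}. h j r) + (\<Sum>j\<in>{..q} - {r}. \<Sum>k\<in>{..q} - {r}. h j k)"
    unfolding s sum.distrib ..
  also have "(\<Sum>j\<in>{..q} - {r}. h j r) = (\<Sum>j\<le>q. h j r) - h r r" using s[of "\<lambda>j. h j r"] by simp
  finally show ?thesis by (simp add: sum.distrib)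
qed

lemma table_sum_flip:
  assumes r: "r \<le> ints s ''q'' 0" and d': "\<And>j. j \<noteq> r \<Longrightarrow> d' j = d j"
  shows "table_sum s d' = table_sum s d
    - (\<Sum>k\<le>ints s ''q'' 0. entry_at s d r k + entry_at s d k r) + entry_at s d r r
    + (\<Sum>k\<le>ints s ''q'' 0. entry_at s d' r k + entry_at s d' k r) - entry_at s d' r r"
proof -
  have "(\<Sum>j\<in>{..ints s ''q'' 0} - {r}. \<Sum>k\<in>{..ints s ''q'' 0} - {r}. entry_at s d' j k) =
    (\<Sum>j\<in>{..ints s ''q'' 0} - {r}. \<Sum>k\<in>{..ints s ''q'' 0} - {r}. entry_at s d j k)"
    using d' by (intro sum.cong refl) (simp add: entry_at_def)
  then show ?thesis unfolding table_sum_def sum_cross[OF r] by simp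
qed

section \<open>Correctness and running time of the enumeration\<close>

lemma total_runs:
  assumes q: "ints s ''q'' 0 = q" and N: "100 * ((q + 1) * (q + 1)) + 20 \<le> N"
  shows "runs total s N (\<lambda>N' s'. N \<le> N' + 100 * ((q + 1) * (q + 1)) + 20 \<and>
    reals s' ''tot'' 0 = table_sum s (ints s ''delta''))"
  unfolding total_def
proof (rule runs_prefix, goal_cases)
  case (3 N1)
  define s1 where "s1 = result (seqs [RPut ''tot'' (IConst 0) (RConst 0), ISet ''j'' (IConst 0)]) s"
  let ?d = "ints s ''delta''"
  have N1: "N \<le> N1 + 8" using 3 by simp
  have iw: "iwrites inner_body = {''k''}" "rwrites inner_body = {''tot''}"
    "iwrites outer_body = {''k'', ''j''}" "rwrites outer_body = {''tot''}"
    by (auto simp: outer_body_def inner_body_def)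
  have "runs (While (ILess (V ''j'') q_plus_one) outer_body) s1 N1 (\<lambda>N' s'. N1 \<le> N' + (45 * (q + 1) + 20 + 8) * (q + 1) + 8 \<and>
      reals s' ''tot'' 0 = (\<Sum>j<q+1. \<Sum>k\<le>q. entry_at s ?d j k))"
  proof (rule runs_for[where P = "\<lambda>t s'. reals s' ''tot'' 0 = (\<Sum>j<t. \<Sum>k\<le>q. entry_at s ?d j k)"], goal_cases)
    case (1 s') then show ?case using q agreeI[OF 1, of "''q''"] by (simp add: iw s1_def mem)
  next
    case (5 t s' N')
    show ?case unfolding outer_body_def
    proof (rule runs_prefix, goal_cases)
      case 1 show ?case by simp
    next
      case 2 show ?case using 5(5) by simp
    next
      case (3 N2)
      let ?s2 = "result (ISet ''k'' (IConst 0)) s'"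
      have N2: "N' \<le> N2 + 3" using 3 by simp
      have ag2: "ints ?s2 x = ints s x" if "x \<noteq> ''k''" "x \<noteq> ''j''" for x
        using that agreeI[OF 5(4), of x] by (simp add: iw s1_def mem)
      have agP: "reals ?s2 ''P'' = reals s ''P''"
        using agreeR[OF 5(4), of "''P''"] by (simp add: iw s1_def mem)
      have inner: "runs (While (ILess (V ''k'') q_plus_one) inner_body) ?s2 N2 (\<lambda>N' s'. N2 \<le> N' + (37 + 8) * (q + 1) + 8 \<and>
        reals s' ''tot'' 0 = (\<Sum>j<t. \<Sum>k\<le>q. entry_at s ?d j k) + (\<Sum>k<q+1. entry_at s ?d t k))"
      proof (rule runs_for[where P = "\<lambda>u s'. reals s' ''tot'' 0 =
          (\<Sum>j<t. \<Sum>k\<le>q. entry_at s ?d j k) + (\<Sum>k<u. entry_at s ?d t k)"], goal_cases)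
        case (1 s3) then show ?case using q ag2[of "''q''"] agreeI[OF 1, of "''q''"] by (simp add: iw)
      next
        case (4) then show ?case using 5(3) by (simp add: mem)
      next
        case (5 u s3 N3)
        have ag3: "ints s3 x = ints s x" if "x \<noteq> ''k''" "x \<noteq> ''j''" for x
          using that agreeI[OF 5(4), of x] ag2[OF that] by (simp add: iw)
        have "entry_at s3 = entry_at s"
          using agreeR[OF 5(4), of "''P''"] agP by (intro table_sum_cong) (simp_all add: ag3 iw)
        moreover have "ints s3 ''j'' 0 = t"
          using agreeI[OF 5(4), of "''j''"] \<open>ints s' ''j'' 0 = t\<close> by (simp add: iw mem)
        ultimately have c: "rval (cell (V ''j'') (V ''k'')) s3 = entry_at s ?d t u"
          using 5(2) ag3[of "''delta''"] by (simp add: rval_cell)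
        show ?case
        proof (rule runs_straight, goal_cases)
          case 1 show ?case by (simp add: inner_body_def)
        next
          case 2 show ?case using 5(5) by (simp add: inner_body_def rtime_cell)
        next
          case (3 N4) then show ?case using 5(2,3) c by (simp add: inner_body_def mem rtime_cell sum_lessThan_plus1)
        qed
      next
        case 6 then show ?case using 5(5) N2 by simp
      qed (simp_all add: mem)
      show ?case
      proof (rule runs_Seq, rule runs_mono[OF inner], goal_cases)
        case (1 N4 s4)
        have j: "ints s4 ''j'' 0 = t" using agreeI[OF 1(2), of "''j''"] 5(2) by (simp add: iw mem)
        have l: "N' \<le> N4 + 45 * (q + 1) + 11" using N2 1(1) by simp
        show ?case
        proof (rule runs_straight, goal_cases)
          case 2 show ?case using l 5(5) by simp
        next
          case (3 N5) then show ?case using 1(1)[unfolded lessThan_plus1] j l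
            by (simp add: mem sum_lessThan_plus1)
        qed simp
      qed
    qed
  next
    case 6 
    have "(45 * (q + 1) + 20 + 8) * (q + 1) + 8 \<le> 100 * ((q + 1) * (q + 1))" by (simp add: algebra_simps)
    then show ?case using N N1 by simp
  qed (simp_all add: s1_def mem)
  then show ?case unfolding s1_def
  proof (rule runs_mono, goal_cases)
    case (1 N' s')
    have "(45 * (q + 1) + 20 + 8) * (q + 1) + 16 \<le> 100 * ((q + 1) * (q + 1))" by (simp add: algebra_simps)
    then show ?case using 1(1) N1 q unfolding lessThan_plus1 by (simp add: table_sum_def)
  qed
qed (use N in simp_all)

text \<open>The operation \<open>f\<close> is subtraction for the old row and column and addition
  for the new ones; \<open>c\<close> is the corresponding sign.\<close>

lemma line_runs:
  assumes q: "ints s ''q'' 0 = q" and r: "ints s ''r'' 0 = r" and N: "100 * q + 200 \<le> N"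
    and f: "\<And>x y. rtime (f x y) = 1 + rtime x + rtime y" "\<And>x y s. rval (f x y) s = rval x s + c * rval y s"
  shows "runs (line f) s N (\<lambda>N' s'. N \<le> N' + 100 * q + 200 \<and>
    reals s' ''x'' 0 = reals s ''x'' 0 +
      c * (\<Sum>k\<le>q. entry_at s (ints s ''delta'') r k + entry_at s (ints s ''delta'') k r))"
  unfolding line_def
proof (rule runs_prefix, goal_cases)
  case (3 N1)
  let ?d = "ints s ''delta''"
  define s1 where "s1 = result (ISet ''k'' (IConst 0)) s"
  have N1: "N \<le> N1 + 3" using 3 by simp
  have iw: "iwrites (line_body f) = {''k''}" "rwrites (line_body f) = {''x''}"
    by (auto simp: line_body_def)
  have "runs (While (ILess (V ''k'') q_plus_one) (line_body f)) s1 N1 (\<lambda>N' s'. N1 \<le> N' + (70 + 8) * (q + 1) + 8 \<and>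
    reals s' ''x'' 0 = reals s ''x'' 0 + c * (\<Sum>k<q+1. entry_at s ?d r k + entry_at s ?d k r))"
  proof (rule runs_for[where P = "\<lambda>t s'. reals s' ''x'' 0 = reals s ''x'' 0 +
      c * (\<Sum>k<t. entry_at s ?d r k + entry_at s ?d k r)"], goal_cases)
    case (1 s') then show ?case using q agreeI[OF 1, of "''q''"] by (simp add: iw s1_def mem)
  next
    case (5 t s' N')
    have ag: "ints s' x = ints s x" if "x \<noteq> ''k''" for x
      using that agreeI[OF 5(4), of x] by (simp add: iw s1_def mem)
    have "entry_at s' = entry_at s"
      using agreeR[OF 5(4), of "''P''"] by (intro table_sum_cong) (simp_all add: ag iw s1_def mem)
    then have c: "rval (cell (V ''r'') (V ''k'')) s' = entry_at s ?d r t" "rval (cell (V ''k'') (V ''r'')) s' = entry_at s ?d t r"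
      using 5(2) ag[of "''delta''"] ag[of "''r''"] r by (simp_all add: rval_cell)
    show ?case
    proof (rule runs_straight, goal_cases)
      case 1 show ?case by (simp add: line_body_def)
    next
      case 2 show ?case using 5(5) by (simp add: line_body_def rtime_cell f)
    next
      case (3 N4) then show ?case using 5(2,3) c
        by (simp add: line_body_def mem rtime_cell f distrib_left sum_lessThan_plus1)
    qed
  next
    case 6 then show ?case using N N1 by simp
  qed (simp_all add: s1_def mem)
  then show ?case unfolding s1_def
    by (rule runs_mono) (use N1 in \<open>simp add: lessThan_plus1\<close>)
qed (use N in simp_all)

lemma copy_runs:
  assumes q: "ints s ''q'' 0 = q" and p: "ints s ''pos'' 0 = p" and N: "100 * q + 100 \<le> N"
  shows "runs copy s N (\<lambda>N' s'. N \<le> N' + 100 * q + 100 \<and>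
    ints s' ''nbr'' = (\<lambda>x. if x \<in> {p+1..p+q} then ints s ''delta'' (x - p) else ints s ''nbr'' x))"
  unfolding copy_def
proof (rule runs_prefix, goal_cases)
  case (3 N1)
  define s1 where "s1 = result (ISet ''k'' (IConst 0)) s"
  have N1: "N \<le> N1 + 3" using 3 by simp
  have iw: "iwrites copy_body = {''k'', ''nbr''}" by (auto simp: copy_body_def)
  have "runs (While (ILess (V ''k'') (V ''q'')) copy_body) s1 N1 (\<lambda>N' s'. N1 \<le> N' + (30 + 6) * q + 6 \<and>
    ints s' ''nbr'' = (\<lambda>x. if x \<in> {p+1..p+q} then ints s ''delta'' (x - p) else ints s ''nbr'' x))"
  proof (rule runs_for[where P = "\<lambda>t s'. ints s' ''nbr'' =
      (\<lambda>x. if x \<in> {p+1..p+t} then ints s ''delta'' (x - p) else ints s ''nbr'' x)"], goal_cases)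
    case (1 s') then show ?case using q agreeI[OF 1, of "''q''"] by (simp add: iw s1_def mem)
  next
    case (5 t s' N')
    have ag: "ints s' x = ints s x" if "x \<noteq> ''k''" "x \<noteq> ''nbr''" for x
      using that agreeI[OF 5(4), of x] by (simp add: iw s1_def mem)
    show ?case
    proof (rule runs_straight, goal_cases)
      case 1 show ?case by (simp add: copy_body_def)
    next
      case 2 show ?case using 5(5) by (simp add: copy_body_def)
    next
      case (3 N4)
      have "ints (result copy_body s') ''nbr'' = (ints s' ''nbr'')(p + (t + 1) := ints s ''delta'' (t + 1))"
        using 5(2) ag[of "''delta''"] ag[of "''pos''"] p by (simp add: copy_body_def mem)
      then have "ints (result copy_body s') ''nbr'' =
        (\<lambda>x. if x \<in> {p+1..p+(t+1)} then ints s ''delta'' (x - p) else ints s ''nbr'' x)"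
        unfolding 5(3) by (auto simp: fun_eq_iff)
      moreover have "ints (result copy_body s') ''k'' 0 = t + 1" using 5(2) by (simp add: copy_body_def mem)
      ultimately show ?case using 3 by (simp add: copy_body_def)
    qed
  next
    case 6 then show ?case using N N1 by simp
  qed (auto simp add: s1_def mem)
  then show ?case unfolding s1_def
    by (rule runs_mono) (use N1 in simp)
qed (use N in simp_all)

lemma line_iwrites: "iwrites (line f) = {''k''}" "rwrites (line f) = {''x''}"
  by (auto simp: line_def line_body_def)

lemma copy_iwrites: "iwrites copy = {''k'', ''nbr''}" "rwrites copy = {}"
  by (auto simp: copy_def copy_body_def)

lemma enum_body_runs:
  assumes q: "ints s ''q'' 0 = q" and r: "ints s ''r'' 0 + 1 = r" "r \<le> q"
    and d: "ints s ''delta'' = d" "d r \<le> 1" and T: "reals s ''tot'' 0 = table_sum s d"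
    and p: "ints s ''pos'' 0 = p" and N: "300 * q + 800 \<le> N"
  defines "d' \<equiv> d(r := 1 - d r)"
  shows "runs enum_body s N (\<lambda>N' s'. N \<le> N' + (300 * q + 800) \<and> ints s' ''r'' 0 = r \<and> ints s' ''delta'' = d \<and>
     ints s' ''pos'' 0 = p + q \<and> reals s' ''cost'' = (reals s ''cost'')(r := table_sum s d') \<and>
     ints s' ''nbr'' = (\<lambda>x. if x \<in> {p+1..p+q} then d' (x - p) else ints s ''nbr'' x))"
proof -
  define s1 where "s1 = rput ''x'' 0 (table_sum s d) (iput ''r'' 0 r s)"
  let ?S = "\<lambda>d. \<Sum>k\<le>q. entry_at s d r k + entry_at s d k r"
  have flip: "table_sum s d' = table_sum s d - ?S d + entry_at s d r r + ?S d' - entry_at s d' r r"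
    using table_sum_flip[of r s d' d] r q by (simp add: d'_def)
  show ?thesis unfolding enum_body_def
  proof (rule runs_prefix, goal_cases)
    case (3 N1)
    have N1: "N \<le> N1 + 20" using 3 by simp
    have e1: "result (seqs [ISet ''r'' (IAdd (V ''r'') (IConst 1)), RPut ''x'' (IConst 0) (RGet ''tot'' (IConst 0))]) s = s1"
      using r T by (simp add: s1_def mem)
    have en1: "entry_at s1 = entry_at s" by (rule table_sum_cong) (simp_all add: s1_def mem)
    have i1: "ints s1 ''q'' 0 = q" "ints s1 ''r'' 0 = r" "ints s1 ''delta'' = d" using q d by (simp_all add: s1_def mem)
    have l1: "runs (line RSub) s1 N1 (\<lambda>N' s'. N1 \<le> N' + 100 * q + 200 \<and>
        reals s' ''x'' 0 = reals s1 ''x'' 0 + - 1 * (\<Sum>k\<le>q. entry_at s1 (ints s1 ''delta'') r k + entry_at s1 (ints s1 ''delta'') k r))"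
      by (rule line_runs[OF i1(1,2)]) (use N N1 in auto)
    show ?case unfolding e1
    proof (rule runs_Seq, rule runs_mono[OF l1], goal_cases)
      case (1 N2 s2)
      have x2: "reals s2 ''x'' 0 = table_sum s d - ?S d" and N2: "N1 \<le> N2 + 100 * q + 200"
        using 1(1) i1 en1 by (simp_all add: s1_def mem)
      have a2: "\<And>y. y \<noteq> ''k'' \<Longrightarrow> ints s2 y = ints s1 y" "\<And>y. y \<noteq> ''x'' \<Longrightarrow> reals s2 y = reals s1 y"
        using agreeI[OF 1(2)] agreeR[OF 1(2)] by (auto simp: line_iwrites)
      have en2: "entry_at s2 = entry_at s" unfolding en1[symmetric] by (rule table_sum_cong) (simp_all add: a2)
      define s3 where "s3 = iput ''delta'' r (1 - d r) (rput ''x'' 0 (table_sum s d - ?S d + entry_at s d r r) s2)"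
      have e3: "result (seqs [x_put RAdd, flip]) s2 = s3"
        using i1 x2 en2 by (simp add: s3_def x_put_def flip_def mem rval_cell a2)
      have i3: "ints s3 ''q'' 0 = q" "ints s3 ''r'' 0 = r" "ints s3 ''delta'' = d'"
        using i1 by (simp_all add: s3_def mem a2 d'_def)
      have en3: "entry_at s3 = entry_at s" unfolding en2[symmetric] by (rule table_sum_cong) (simp_all add: s3_def mem)
      show ?case
      proof (rule runs_prefix, goal_cases)
        case 1 show ?case by (simp add: x_put_def flip_def)
      next
        case 2 show ?case using N N1 N2 by (simp add: x_put_def flip_def rtime_cell)
      next
        case (3 N3)
        have N3: "N2 \<le> N3 + 60" using 3 by (simp add: x_put_def flip_def rtime_cell)
        have l3: "runs (line RAdd) s3 N3 (\<lambda>N' s'. N3 \<le> N' + 100 * q + 200 \<and>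
            reals s' ''x'' 0 = reals s3 ''x'' 0 + 1 * (\<Sum>k\<le>q. entry_at s3 (ints s3 ''delta'') r k + entry_at s3 (ints s3 ''delta'') k r))"
          by (rule line_runs[OF i3(1,2)]) (use N N1 N2 N3 in auto)
        show ?case unfolding e3
        proof (rule runs_Seq, rule runs_mono[OF l3], goal_cases)
          case (1 N4 s4)
          have x4: "reals s4 ''x'' 0 = table_sum s d - ?S d + entry_at s d r r + ?S d'" and N4: "N3 \<le> N4 + 100 * q + 200"
            using 1(1) i3 en3 by (simp_all add: s3_def mem)
          have a4: "\<And>y. y \<noteq> ''k'' \<Longrightarrow> ints s4 y = ints s3 y" "\<And>y. y \<noteq> ''x'' \<Longrightarrow> reals s4 y = reals s3 y"
            using agreeI[OF 1(2)] agreeR[OF 1(2)] by (auto simp: line_iwrites)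
          have en4: "entry_at s4 = entry_at s" unfolding en3[symmetric] by (rule table_sum_cong) (simp_all add: a4)
          define s5 where "s5 = rput ''cost'' r (table_sum s d') (rput ''x'' 0 (table_sum s d') s4)"
          have e5: "result (seqs [x_put RSub, RPut ''cost'' (V ''r'') (RGet ''x'' (IConst 0))]) s4 = s5"
            using i3 x4 en4 by (simp add: s5_def x_put_def mem rval_cell a4 flip)
          have i5: "ints s5 ''q'' 0 = q" "ints s5 ''pos'' 0 = p"
            using i3 p by (simp_all add: s5_def mem a4) (simp add: s3_def s1_def mem a2)
          show ?case
          proof (rule runs_prefix, goal_cases)
            case 1 show ?case by (simp add: x_put_def)
          next
            case 2 show ?case using N N1 N2 N3 N4 by (simp add: x_put_def rtime_cell)
          next
            case (3 N5)
            have N5: "N4 \<le> N5 + 60" using 3 by (simp add: x_put_def rtime_cell)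
            have l5: "runs copy s5 N5 (\<lambda>N' s'. N5 \<le> N' + 100 * q + 100 \<and>
              ints s' ''nbr'' = (\<lambda>x. if x \<in> {p+1..p+q} then ints s5 ''delta'' (x - p) else ints s5 ''nbr'' x))"
              by (rule copy_runs[OF i5]) (use N N1 N2 N3 N4 N5 in auto)
            show ?case unfolding e5
            proof (rule runs_Seq, rule runs_mono[OF l5], goal_cases)
              case (1 N6 s6)
              have N6: "N5 \<le> N6 + 100 * q + 100" using 1(1) by simp
              have a6: "\<And>y. y \<noteq> ''k'' \<Longrightarrow> y \<noteq> ''nbr'' \<Longrightarrow> ints s6 y = ints s5 y" "\<And>y. reals s6 y = reals s5 y"
                using agreeI[OF 1(2)] agreeR[OF 1(2)] by (auto simp: copy_iwrites)
              have b: "ints s5 y = ints s4 y" for y by (simp add: s5_def mem)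
              have dl: "ints s6 ''delta'' = d'" using i3 by (simp add: a6 b a4)
              have rr: "ints s6 ''r'' 0 = r" "ints s6 ''q'' 0 = q" "ints s6 ''pos'' 0 = p"
                using i3 i5 by (simp_all add: a6 b a4)
              have nb: "ints s6 ''nbr'' = (\<lambda>x. if x \<in> {p+1..p+q} then d' (x - p) else ints s ''nbr'' x)"
              proof -
                have dn: "ints s5 ''delta'' = d'" "ints s5 ''nbr'' = ints s ''nbr''"
                  using i3 by (simp_all add: b a4) (simp add: s3_def s1_def mem a2)
                show ?thesis using conjunct2[OF 1(1)] unfolding dn .
              qed
              have co: "reals s6 ''cost'' = (reals s ''cost'')(r := table_sum s d')"
                by (simp add: a6 s5_def mem a4) (simp add: s3_def s1_def mem a2)
              show ?case
              proof (rule runs_straight, goal_cases)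
                case 1 show ?case by (simp add: flip_def)
              next
                case 2 show ?case using N N1 N2 N3 N4 N5 N6 by (simp add: flip_def)
              next
                case (3 N7)
                then have N7: "N6 \<le> N7 + 40" by (simp add: flip_def)
                \<comment> \<open>Flipping is an involution only because \<open>d r\<close> is at
                  most 1: subtraction is truncated.\<close>
                have "d'(r := 1 - d' r) = d" using d(2) by (auto simp: d'_def fun_eq_iff)
                then show ?case using N1 N2 N3 N4 N5 N6 N7 dl rr nb co by (simp add: flip_def mem)
              qed
            qed
          qed
        qed
      qed
    qed
  qed (use N in simp_all)
qed

lemma total_iwrites: "iwrites total = {''k'', ''j''}" "rwrites total = {''tot''}"
  by (auto simp: total_def outer_body_def inner_body_def)

lemma enum_body_iwrites: "iwrites enum_body = {''r'', ''k'', ''delta'', ''nbr'', ''pos''}" "rwrites enum_body = {''x'', ''cost''}"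
  by (auto simp: enum_body_def line_iwrites copy_iwrites x_put_def flip_def)

lemma list_neighbors_runs:
  assumes q: "ints s ''q'' 0 = q" and d: "ints s ''delta'' = d" "\<And>j. d j \<le> 1"
    and N: "2000 * (1 + q * q) \<le> N"
  shows "runs list_neighbors s N (\<lambda>N' s'. ints s' ''count'' 0 = q \<and> (\<forall>r\<in>{1..q}.
    reals s' ''cost'' r = table_sum s (d(r := 1 - d r)) \<and>
    (\<forall>j\<in>{1..q}. ints s' ''nbr'' ((r - 1) * q + j) = (d(r := 1 - d r)) j)))"
proof -
  \<comment> \<open>This absorbs the linear terms of all parts into the quadratic budget; the
    summand 1 in the budget pays for the case q = 0.\<close>
  have q2: "q \<le> q * q" by simp
  have sq: "(q + 1) * (q + 1) = q * q + 2 * q + 1" "(300 * q + 800 + 6) * q = 300 * (q * q) + 806 * q"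
    by (simp_all add: algebra_simps)
  define Q where "Q = q * q"
  note Q = Q_def[symmetric]
  have b1: "100 * ((q + 1) * (q + 1)) + 20 \<le> N" using N q2 unfolding sq Q by (simp add: distrib_left)
  show ?thesis unfolding list_neighbors_def
  proof (rule runs_Seq, rule runs_mono[OF total_runs[OF q b1]], goal_cases)
    case (1 N1 s1)
    have N1: "N \<le> N1 + 100 * ((q + 1) * (q + 1)) + 20" using 1(1) by simp
    have a1: "\<And>y. y \<noteq> ''k'' \<Longrightarrow> y \<noteq> ''j'' \<Longrightarrow> ints s1 y = ints s y" "\<And>y. y \<noteq> ''tot'' \<Longrightarrow> reals s1 y = reals s y"
      using agreeI[OF 1(2)] agreeR[OF 1(2)] by (auto simp: total_iwrites)
    have b2: "(300 * q + 800 + 6) * q + 106 \<le> N1" using N1 N q2 unfolding sq Q by (simp add: distrib_left)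
    show ?case
    proof (rule runs_prefix, goal_cases)
      case 1 show ?case by simp
    next
      case 2 show ?case using b2 by simp
    next
      case (3 N2)
      define s2 where "s2 = result (seqs [ISet ''count'' (V ''q''), ISet ''pos'' (IConst 0), ISet ''r'' (IConst 0)]) s1"
      have N2: "N1 \<le> N2 + 40" using 3 by simp
      have a2: "ints s2 ''q'' 0 = q" "ints s2 ''row'' = ints s ''row''" "reals s2 ''P'' = reals s ''P''"
        "ints s2 ''delta'' = d" "ints s2 ''count'' 0 = q" "reals s2 ''tot'' 0 = table_sum s d"
        using q d 1(1) by (simp_all add: s2_def mem a1)
      let ?P = "\<lambda>t s'. ints s' ''delta'' = d \<and> ints s' ''pos'' 0 = t * q \<and> (\<forall>r\<in>{1..t}.
        reals s' ''cost'' r = table_sum s (d(r := 1 - d r)) \<and>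
        (\<forall>j\<in>{1..q}. ints s' ''nbr'' ((r - 1) * q + j) = (d(r := 1 - d r)) j))"
      have "runs (While (ILess (V ''r'') (V ''q'')) enum_body) s2 N2 (\<lambda>N' s'. N2 \<le> N' + (300 * q + 800 + 6) * q + 6 \<and> ?P q s')"
      proof (rule runs_for[where P = ?P], goal_cases)
        case (1 s') then show ?case using a2 agreeI[OF 1, of "''q''"] by (simp add: enum_body_iwrites)
      next
        case (5 t s' N')
        have f: "ints s' ''q'' 0 = q" "ints s' ''row'' = ints s ''row''" "reals s' ''P'' = reals s ''P''"
          "reals s' ''tot'' 0 = table_sum s d"
          using a2 agreeI[OF 5(4)] agreeR[OF 5(4)] by (simp_all add: enum_body_iwrites)
        have ts: "table_sum s' = table_sum s" by (rule table_sum_cong) (use f q in simp_all)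
        have "runs enum_body s' N' (\<lambda>N'' s''. N' \<le> N'' + (300 * q + 800) \<and> ints s'' ''r'' 0 = t + 1 \<and> ints s'' ''delta'' = d \<and>
           ints s'' ''pos'' 0 = t * q + q \<and> reals s'' ''cost'' = (reals s' ''cost'')(t + 1 := table_sum s' (d(t + 1 := 1 - d (t + 1)))) \<and>
           ints s'' ''nbr'' = (\<lambda>x. if x \<in> {t*q+1..t*q+q} then (d(t + 1 := 1 - d (t + 1))) (x - t*q) else ints s' ''nbr'' x))"
          by (rule enum_body_runs) (use 5 f ts d in auto)
        then show ?case
        proof (rule runs_mono, goal_cases)
          case (1 N'' s'')
          have "reals s'' ''cost'' r = table_sum s (d(r := 1 - d r)) \<and>
             (\<forall>j\<in>{1..q}. ints s'' ''nbr'' ((r - 1) * q + j) = (d(r := 1 - d r)) j)" if r: "r \<in> {1..t+1}" for r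
          proof (cases "r = t + 1")
            case True
            then show ?thesis using 1(1) ts by simp
          next
            case False
            then have rt: "r \<in> {1..t}" using r by auto
            \<comment> \<open>Rows written in earlier rounds end at address \<open>t * q\<close>,
              just before the row written now, so they are preserved.\<close>
            have le: "(r - 1) * q + j \<le> t * q" if "j \<in> {1..q}" for j
            proof -
              have "(r - 1) * q + j \<le> (r - 1) * q + q" using that by simp
              also have "\<dots> = (r - 1 + 1) * q" by (simp add: distrib_right)
              also have "\<dots> \<le> t * q" using rt by (intro mult_le_mono1) auto
              finally show ?thesis .
            qed
            have "ints s'' ''nbr'' ((r - 1) * q + j) = ints s' ''nbr'' ((r - 1) * q + j)" if "j \<in> {1..q}" for j
            proof -
              have out: "(r - 1) * q + j \<notin> {t*q+1..t*q+q}" using le[OF that] by simp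
              have nb: "ints s'' ''nbr'' = (\<lambda>x. if x \<in> {t*q+1..t*q+q} then (d(t + 1 := 1 - d (t + 1))) (x - t*q)
                else ints s' ''nbr'' x)" using 1(1) by (elim conjE)
              show ?thesis unfolding nb using out by (rule if_not_P)
            qed
            moreover have "reals s'' ''cost'' r = reals s' ''cost'' r" using 1(1) False by simp
            ultimately show ?thesis using 5(3) rt by simp
          qed
          then show ?case using 1(1) by (simp add: distrib_right)
        qed
      next
        case 6 then show ?case using b2 N2 by simp
      qed (use a2 in \<open>simp_all add: s2_def mem\<close>)
      then show ?case unfolding s2_def[symmetric]
      proof (rule runs_mono, goal_cases)
        case (1 N3 s3)
        have "ints s3 ''count'' 0 = q" using agreeI[OF 1(2), of "''count''"] a2 by (simp add: enum_body_iwrites)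
        then show ?case using 1(1) by simp
      qed
    qed
  qed
qed

section \<open>The theorem\<close>

definition preprocess :: com where
  "preprocess = Seq init (Seq strip (Seq trace (Seq rows arcs)))"

lemma init_iwrites: "iwrites init = {''i'', ''deg'', ''sum'', ''match0'', ''match1''}" "rwrites init = {}"
  by (auto simp: init_def init_body_def Let_def)

lemma strip_iwrites: "iwrites strip = {''v'', ''u'', ''i'', ''deg'', ''sum'', ''match0'', ''match1'', ''rem''}"
  "rwrites strip = {}"
  by (auto simp: strip_def strip_body_def strip_step_def Let_def)

lemma trace_iwrites: "iwrites trace = {''i'', ''q'', ''j'', ''u'', ''cycle'', ''match0'', ''match1''}" "rwrites trace = {}"
  by (auto simp: trace_def trace_body_def trace_start_def trace_loop_def trace_step_def Let_def)

lemma rows_iwrites: "iwrites rows = {''w'', ''i'', ''x'', ''row''}" "rwrites rows = {}"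
  by (auto simp: rows_def rows_body_def)

lemma arcs_iwrites: "iwrites arcs = {''i'', ''k''}" "rwrites arcs = {''P''}"
  by (auto simp: arcs_def arcs_body_def arc_add_def Let_def)

context tsp_instance
begin

text \<open>The contract between preprocessing and enumeration; \<open>K\<close> is an existential
  ghost, known to the proof but not stored by the program.\<close>

definition prepared :: "(nat \<Rightarrow> nat \<Rightarrow> real) \<Rightarrow> nat set \<Rightarrow> memory \<Rightarrow> bool" where
  "prepared \<rho> K s \<longleftrightarrow> (let q = ints s ''q'' 0; cy = ints s ''cycle'' in
     cycle_data n Xs K cy q (ints s ''match0'') (ints s ''match1'') \<and>
     (\<forall>i\<in>{1..n} - K. cy i = 0) \<and>
     (\<forall>u<2*q+2. ints s ''row'' u = u * (2*q+2)) \<and>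
     (\<forall>k. reals s ''P'' k = (\<Sum>x=1..n. contrib \<rho> q cy
        (\<lambda>d x. if d = 0 then ints s ''match0'' x else ints s ''match1'' x) x k)))"

text \<open>The five stages need at most 1140 n + 780 units together, which is below 2000 n since n
  is at least 2. Building the rows takes time proportional to the number of cycles, and adding the
  arcs has one round per position.\<close>

lemma preprocess_runs: "runs preprocess (input_memory n a b \<rho>) (2000 * n) (\<lambda>N' s. \<exists>K. prepared \<rho> K s)"
  unfolding preprocess_def
proof -
  define s0 where "s0 = input_memory n a b \<rho>"
  have inp0: "inp s0" by (simp add: s0_def inp_def input_memory_def Let_def)
  have rinp0: "rinp \<rho> s0" by (simp add: s0_def rinp_def input_memory_def Let_def nxt_def)
  have z0: "ints s0 y v = 0" if "y \<notin> {''n'', ''req1'', ''req2''}" for y v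
    using that by (simp add: s0_def input_memory_def Let_def)
  have P0: "reals s0 ''P'' k = 0" for k by (simp add: s0_def input_memory_def Let_def)
  have r1: "runs init s0 (2000 * n) (\<lambda>N' s'. 2000 * n \<le> N' + 80 * n + 80 \<and> (\<forall>v. ints s' ''deg'' v = dg {1..n} v) \<and>
    (\<forall>v. ints s' ''sum'' v = sm {1..n} v) \<and> (\<forall>x\<in>{1..n}. ints s' ''match0'' x = a x \<and> ints s' ''match1'' x = a x))"
    using n2 by (intro init_runs inp0) (auto intro!: z0)
  show "runs (Seq init (Seq strip (Seq trace (Seq rows arcs)))) (input_memory n a b \<rho>) (2000 * n) (\<lambda>N' s. \<exists>K. prepared \<rho> K s)"
    unfolding s0_def[symmetric]
  proof (rule runs_Seq, rule runs_mono[OF r1], goal_cases)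
    case (1 N1 s1)
    have N1: "2000 * n \<le> N1 + 80 * n + 80" using 1(1) by blast
    have ag1: "\<And>y. y \<notin> {''i'', ''deg'', ''sum'', ''match0'', ''match1''} \<Longrightarrow> ints s1 y = ints s0 y" "\<And>y. reals s1 y = reals s0 y"
      using agreeI[OF 1(2)] agreeR[OF 1(2)] by (auto simp: init_iwrites)
    have inp1: "inp s1" using inp0 by (simp add: inp_def ag1)
    have r2: "runs strip s1 N1 (\<lambda>N' s'. N1 \<le> N' + 200 * n + 200 \<and> strip_inv s' \<and> (\<forall>v\<in>{1..n}. dg (rest s') v \<noteq> 1))"
      by (rule strip_runs[OF inp1]) (use 1(1) N1 n2 in \<open>auto simp: ag1 z0\<close>)
    show ?case
    proof (rule runs_Seq, rule runs_mono[OF r2], goal_cases)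
      case (1 N2 s2)
      have N2: "N1 \<le> N2 + 200 * n + 200" and si: "strip_inv s2" using 1(1) by blast+
      have ag2: "\<And>y. y \<notin> {''v'', ''u'', ''i'', ''deg'', ''sum'', ''match0'', ''match1'', ''rem''} \<Longrightarrow> ints s2 y = ints s0 y"
        "\<And>y. reals s2 y = reals s0 y"
        using agreeI[OF 1(2)] agreeR[OF 1(2)] by (auto simp: strip_iwrites ag1)
      have inp2: "inp s2" using inp0 by (simp add: inp_def ag2)
      interpret S: stripped n Xs a b "rest s2" "ints s2 ''match0''"
      proof unfold_locales
        show "forced_off (rest s2) (ints s2 ''match0'')" using si by (simp add: strip_inv_def)
        show "dg (rest s2) v \<noteq> 1" if "v \<in> {1..n}" for v using 1(1) that by blast
      qed
      have r3: "runs trace s2 N2 (\<lambda>N' s'. N2 \<le> N' + 300 * n + 300 \<and>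
          (\<forall>i\<in>{1..n}. i \<notin> S.core \<longrightarrow> ints s' ''cycle'' i = 0 \<and> ints s' ''match1'' i = ints s' ''match0'' i) \<and>
          cycle_data n Xs S.core (ints s' ''cycle'') (ints s' ''q'' 0) (ints s' ''match0'') (ints s' ''match1''))"
        by (rule S.trace_runs[OF inp2 _ refl]) (use si N1 N2 n2 in \<open>auto simp: strip_inv_def ag2 z0\<close>)
      show ?case
      proof (rule runs_Seq, rule runs_mono[OF r3], goal_cases)
        case (1 N3 s3)
        have N3: "N2 \<le> N3 + 300 * n + 300"
          and off: "\<forall>i\<in>{1..n}. i \<notin> S.core \<longrightarrow> ints s3 ''cycle'' i = 0 \<and> ints s3 ''match1'' i = ints s3 ''match0'' i"
          and cd: "cycle_data n Xs S.core (ints s3 ''cycle'') (ints s3 ''q'' 0) (ints s3 ''match0'') (ints s3 ''match1'')"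
          using 1(1) by blast+
        interpret D: cycle_data n Xs S.core "ints s3 ''cycle''" "ints s3 ''q'' 0" "ints s3 ''match0''" "ints s3 ''match1''"
          by (rule cd)
        define q where "q = ints s3 ''q'' 0"
        \<comment> \<open>Each cycle number is attained at a core position, so time spent per cycle
          can be charged to the positions.\<close>
        have qn: "q \<le> n"
        proof -
          have "card (ints s3 ''cycle'' ` S.core) \<le> card S.core" by (rule card_image_le) (rule D.finK)
          also have "\<dots> \<le> card {1..n}" using D.K by (intro card_mono) auto
          finally show ?thesis using D.range by (simp add: q_def)
        qed
        have cyq: "ints s3 ''cycle'' x \<le> q" if "x \<in> {1..n}" for x
        proof (cases "x \<in> S.core")
          case True
          then have "ints s3 ''cycle'' x \<in> {1..q}" using D.range by (auto simp: q_def)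
          then show ?thesis by simp
        qed (use off that in simp)
        have m: "ints s3 ''match0'' x \<in> {a x, b x} \<and> ints s3 ''match1'' x \<in> {a x, b x}" if x: "x \<in> {1..n}" for x
        proof -
          have "ints s3 ''match0'' x \<in> Xs x" using D.m0_in[OF x] .
          moreover have "ints s3 ''match1'' x \<in> Xs x"
            using off x D.XsK[of x] D.m0_in[OF x] by (cases "x \<in> S.core") auto
          ultimately show ?thesis using ab[OF x] by simp
        qed
        have ag3: "ints s3 ''n'' = ints s0 ''n''" "ints s3 ''req1'' = ints s0 ''req1''" "ints s3 ''req2'' = ints s0 ''req2''"
          "\<And>y. reals s3 y = reals s0 y"
          using agreeI[OF 1(2)] agreeR[OF 1(2)] by (simp_all add: trace_iwrites ag2)
        have r4: "runs rows s3 N3 (\<lambda>N' s'. N3 \<le> N' + 60 * q + 100 \<and> (\<forall>u<2*q+2. ints s' ''row'' u = u * (2*q+2)))"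
          by (rule rows_runs) (use N1 N2 N3 n2 qn in \<open>auto simp: q_def\<close>)
        show ?case
        proof (rule runs_Seq, rule runs_mono[OF r4], goal_cases)
          case (1 N4 s4)
          have N4: "N3 \<le> N4 + 60 * n + 100" using 1(1) qn by simp
          note row4 = conjunct2[OF 1(1)]
          have ag4: "\<And>y. y \<notin> {''w'', ''i'', ''x'', ''row''} \<Longrightarrow> ints s4 y = ints s3 y" "\<And>y. reals s4 y = reals s0 y"
            using agreeI[OF 1(2)] agreeR[OF 1(2)] by (auto simp: rows_iwrites ag3)
          have inp4: "inp s4" using inp0 by (simp add: inp_def ag4 ag3)
          have rinp4: "rinp \<rho> s4" using rinp0 by (simp add: rinp_def ag4)
          define mm where "mm = (\<lambda>d x. if d = (0::nat) then ints s4 ''match0'' x else ints s4 ''match1'' x)"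
          have r5: "runs arcs s4 N4 (\<lambda>N' s'. N4 \<le> N' + 500 * n + 100 \<and>
             (\<forall>k. reals s' ''P'' k = (\<Sum>x=1..n. contrib \<rho> q (ints s4 ''cycle'') mm x k)))"
          proof (rule arcs_runs[OF inp4 rinp4 _ _ _ _ mm_def])
            show "\<forall>x\<in>{1..n}. ints s4 ''cycle'' x \<le> q" using cyq by (simp add: ag4)
            show "\<forall>u<2*q+2. ints s4 ''row'' u = u * (2*q+2)" by (rule row4)
            show "\<forall>x\<in>{1..n}. ints s4 ''match0'' x \<in> {a x, b x} \<and> ints s4 ''match1'' x \<in> {a x, b x}"
              using m by (simp add: ag4)
            show "reals s4 ''P'' k = 0" for k by (simp add: ag4 P0)
            show "500 * n + 100 \<le> N4" using N1 N2 N3 N4 n2 by linarith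
          qed
          show ?case
          proof (rule runs_mono[OF r5], goal_cases)
            case (1 N5 s5)
            have ag5: "\<And>y. y \<notin> {''i'', ''k''} \<Longrightarrow> ints s5 y = ints s4 y"
              using agreeI[OF 1(2)] by (auto simp: arcs_iwrites)
            have e: "ints s5 ''q'' = ints s3 ''q''" "ints s5 ''cycle'' = ints s3 ''cycle''"
              "ints s5 ''match0'' = ints s3 ''match0''" "ints s5 ''match1'' = ints s3 ''match1''"
              "ints s5 ''row'' = ints s4 ''row''" "ints s4 ''cycle'' = ints s3 ''cycle''"
              "ints s4 ''match0'' = ints s3 ''match0''" "ints s4 ''match1'' = ints s3 ''match1''"
              by (simp_all add: ag5 ag4)
            have "prepared \<rho> S.core s5"
              unfolding prepared_def Let_def e
              using cd off conjunct2[OF 1(1), unfolded mm_def e q_def] row4[unfolded q_def] by blast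
            then show ?case ..
          qed
        qed
      qed
    qed
  qed
qed

lemma tour_cost_nxt: "tour_cost n \<rho> f = (\<Sum>x=1..n. \<rho> (f x) (f (nxt x)))"
proof -
  have "{1..n} = insert n {1..n-1}" using n2 by auto
  then have "(\<Sum>x=1..n. \<rho> (f x) (f (nxt x))) = \<rho> (f n) (f (nxt n)) + (\<Sum>x=1..n-1. \<rho> (f x) (f (nxt x)))"
    using n2 by simp
  moreover have "(\<Sum>x=1..n-1. \<rho> (f x) (f (nxt x))) = (\<Sum>x=1..n-1. \<rho> (f x) (f (x + 1)))"
    using n2 by (intro sum.cong) (auto simp: nxt_def)
  ultimately show ?thesis by (simp add: tour_cost_def nxt_def)
qed

text \<open>\<open>d\<close> is \<delta> extended by \<open>d 0 = 0\<close>. Forced positions have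
  cycle number 0, so this value selects their \<open>m0\<close>-partner, and
  \<open>sum_table\<close> applies uniformly to all positions.\<close>

lemma prepared_table_sum:
  assumes p: "prepared \<rho> K s" and \<delta>: "\<delta> \<in> vectors (ints s ''q'' 0)"
    and d: "\<And>j. j \<in> {1..ints s ''q'' 0} \<Longrightarrow> d j = \<delta> j" "d 0 = 0"
  shows "table_sum s d = tour_cost n \<rho> (cycle_data.sel n K (ints s ''cycle'') (ints s ''match0'') (ints s ''match1'') \<delta>)"
proof -
  define q cy m0 m1 where def: "q = ints s ''q'' 0" "cy = ints s ''cycle''" "m0 = ints s ''match0''" "m1 = ints s ''match1''"
  have cd: "cycle_data n Xs K cy q m0 m1" and off: "\<forall>i\<in>{1..n} - K. cy i = 0"
    and row: "\<forall>u<2*q+2. ints s ''row'' u = u * (2*q+2)"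
    and P: "\<forall>k. reals s ''P'' k = (\<Sum>x=1..n. contrib \<rho> q cy (\<lambda>d x. if d = 0 then m0 x else m1 x) x k)"
    using p unfolding prepared_def Let_def def by blast+
  interpret D: cycle_data n Xs K cy q m0 m1 by (rule cd)
  have cK: "cy x \<in> {1..q}" if "x \<in> K" for x using that D.range by blast
  have cyq: "\<forall>x\<in>{1..n}. cy x \<le> q"
  proof
    fix x assume "x \<in> {1..n}"
    then show "cy x \<le> q" using off cK[of x] by (cases "x \<in> K") auto
  qed
  have dl: "\<forall>j\<le>q. d j \<le> 1"
  proof (intro allI impI)
    fix j assume "j \<le> q"
    then consider "j = 0" | "j \<in> {1..q}" by fastforce
    then show "d j \<le> 1"
    proof cases
      case 2
      then have "\<delta> j \<in> {0, 1}" using \<delta> by (auto simp: vectors_def def)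
      then show ?thesis using d(1)[of j] 2 by (auto simp: def)
    qed (use d in simp)
  qed
  have "table_sum s d = (\<Sum>j\<le>q. \<Sum>k\<le>q. reals s ''P'' ((2*j + d j) * (2*q+2) + (2*k + d k)))"
    unfolding table_sum_def def(1)[symmetric]
  proof (intro sum.cong refl)
    fix j k assume "j \<in> {..q}" "k \<in> {..q}"
    then have "2 * j + d j < 2*q+2" using dl[rule_format, of j] by simp
    then have "ints s ''row'' (2 * j + d j) = (2 * j + d j) * (2*q+2)" using row by blast
    then show "entry_at s d j k = reals s ''P'' ((2*j + d j) * (2*q+2) + (2*k + d k))"
      by (simp only: entry_at_def)
  qed
  also have "\<dots> = (\<Sum>x=1..n. \<rho> (if d (cy x) = 0 then m0 x else m1 x) (if d (cy (nxt x)) = 0 then m0 (nxt x) else m1 (nxt x)))"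
    by (rule sum_table[OF P cyq dl])
  also have "\<dots> = tour_cost n \<rho> (D.sel \<delta>)"
  proof -
    have "(if d (cy x) = 0 then m0 x else m1 x) = D.sel \<delta> x" if x: "x \<in> {1..n}" for x
    proof (cases "x \<in> K")
      case True
      then have "d (cy x) = \<delta> (cy x)" using cK[OF True] d(1) unfolding def by blast
      then show ?thesis using True x by (simp add: D.sel_def D.md_def)
    next
      case False
      then show ?thesis using off x d(2) by (simp add: D.sel_def)
    qed
    then show ?thesis unfolding tour_cost_nxt using nxt_range by (intro sum.cong) auto
  qed
  finally show ?thesis by (simp add: def)
qed

text \<open>Positions off \<open>K\<close> carry the number 0, which no \<open>j\<close> in the
  range equals, so the reported matching of a cycle consists of its own positions only.\<close>

lemma prepared_reported:
  assumes p: "prepared \<rho> K s" and j: "j \<in> {1..ints s ''q'' 0}"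
  shows "reported_matching n s d j = cycle_data.mat K (ints s ''cycle'') (ints s ''match0'') (ints s ''match1'') d j"
proof -
  have cd: "cycle_data n Xs K (ints s ''cycle'') (ints s ''q'' 0) (ints s ''match0'') (ints s ''match1'')"
    and off: "\<forall>i\<in>{1..n} - K. ints s ''cycle'' i = 0"
    using p by (simp_all add: prepared_def Let_def)
  interpret D: cycle_data n Xs K "ints s ''cycle''" "ints s ''q'' 0" "ints s ''match0''" "ints s ''match1''" by (rule cd)
  have "i \<in> {1..n} \<and> ints s ''cycle'' i = j \<longleftrightarrow> i \<in> D.cls j" for i
    using off j D.K by (cases "i \<in> K") (auto simp: D.cls_def)
  then show ?thesis by (simp add: reported_matching_def D.mat_def D.md_def)
qed

end

lemma exchange_nbhd_bij:
  assumes \<delta>: "\<delta> \<in> vectors q"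
  shows "bij_betw (\<lambda>r. \<delta>(r := 1 - \<delta> r)) {1..q} (exchange_nbhd q \<delta>)"
proof -
  have dl: "\<delta> j = 0 \<or> \<delta> j = 1" if "j \<in> {1..q}" for j using \<delta> that by (auto simp: vectors_def)
  have ne: "1 - \<delta> j \<noteq> \<delta> j" if "j \<in> {1..q}" for j using dl[OF that] by auto
  show ?thesis unfolding bij_betw_def
  proof
    show "inj_on (\<lambda>r. \<delta>(r := 1 - \<delta> r)) {1..q}"
    proof (rule inj_onI)
      fix r r' assume r: "r \<in> {1..q}" "\<delta>(r := 1 - \<delta> r) = \<delta>(r' := 1 - \<delta> r')"
      show "r = r'" using fun_cong[OF r(2), of r] ne[OF r(1)] by (cases "r = r'") auto
    qed
    show "(\<lambda>r. \<delta>(r := 1 - \<delta> r)) ` {1..q} = exchange_nbhd q \<delta>"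
    proof
      show "(\<lambda>r. \<delta>(r := 1 - \<delta> r)) ` {1..q} \<subseteq> exchange_nbhd q \<delta>"
      proof clarify
        fix r assume r: "r \<in> {1..q}"
        have "{j \<in> {1..q}. \<delta> j \<noteq> (\<delta>(r := 1 - \<delta> r)) j} = {r}" using r ne[OF r] by auto
        then have "hamming q \<delta> (\<delta>(r := 1 - \<delta> r)) = 1" by (simp add: hamming_def)
        moreover have "\<delta>(r := 1 - \<delta> r) \<in> vectors q"
          using \<delta> r dl[OF r] by (auto simp: vectors_def PiE_iff extensional_def)
        ultimately show "\<delta>(r := 1 - \<delta> r) \<in> exchange_nbhd q \<delta>" by (simp add: exchange_nbhd_def)
      qed
      show "exchange_nbhd q \<delta> \<subseteq> (\<lambda>r. \<delta>(r := 1 - \<delta> r)) ` {1..q}"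
      proof
        fix \<delta>' assume "\<delta>' \<in> exchange_nbhd q \<delta>"
        then have v: "\<delta>' \<in> vectors q" and "card {j \<in> {1..q}. \<delta> j \<noteq> \<delta>' j} = 1"
          by (auto simp: exchange_nbhd_def hamming_def)
        then obtain r where r: "{j \<in> {1..q}. \<delta> j \<noteq> \<delta>' j} = {r}" by (metis card_1_singletonE)
        then have rq: "r \<in> {1..q}" and rr: "\<delta> r \<noteq> \<delta>' r" by blast+
        have "\<delta>' = \<delta>(r := 1 - \<delta> r)"
        proof
          fix j show "\<delta>' j = (\<delta>(r := 1 - \<delta> r)) j"
          proof (cases "j \<in> {1..q}")
            case True
            then have "j \<noteq> r \<Longrightarrow> \<delta> j = \<delta>' j" using r by blast
            moreover have "\<delta>' r = 0 \<or> \<delta>' r = 1" using v rq by (auto simp: vectors_def)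
            ultimately show ?thesis using dl[OF rq] rr by auto
          next
            case False
            then show ?thesis using v \<delta> rq by (auto simp: vectors_def PiE_iff extensional_def)
          qed
        qed
        then show "\<delta>' \<in> (\<lambda>r. \<delta>(r := 1 - \<delta> r)) ` {1..q}" using rq by blast
      qed
    qed
  qed
qed

context tsp_instance
begin

lemma prepared_enumerate:
  assumes p: "prepared \<rho> K s" and q: "q = ints s ''q'' 0" and \<delta>: "\<delta> \<in> vectors q"
  shows "\<exists>t s'. exec list_neighbors (load_vector q \<delta> s) t s' \<and> t \<le> 2000 * (1 + q * q) \<and>
    lists_nbhd n Xs \<rho> (reported_matching n s) \<delta> s'"
proof -
  define d where "d = (\<lambda>j. if j \<in> {1..q} then \<delta> j else 0)"
  define sd where "sd = load_vector q \<delta> s"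
  have dl: "d j \<le> 1" for j
    using PiE_mem[OF \<delta>[unfolded vectors_def], of j] by (auto simp: d_def)
  have sd: "ints sd ''q'' 0 = q" "ints sd ''delta'' = d" "\<And>y. y \<noteq> ''delta'' \<Longrightarrow> ints sd y = ints s y" "reals sd = reals s"
    by (simp_all add: sd_def load_vector_def d_def q)
  have ts: "table_sum sd = table_sum s" by (rule table_sum_cong) (simp_all add: sd)
  from runs_exec[OF list_neighbors_runs[OF sd(1,2) dl order_refl]]
  obtain t s' where t: "exec list_neighbors sd t s'" "t \<le> 2000 * (1 + q * q)" and c: "ints s' ''count'' 0 = q"
    and R: "\<And>r. r \<in> {1..q} \<Longrightarrow> reals s' ''cost'' r = table_sum sd (d(r := 1 - d r))"
    "\<And>r j. r \<in> {1..q} \<Longrightarrow> j \<in> {1..q} \<Longrightarrow> ints s' ''nbr'' ((r - 1) * q + j) = (d(r := 1 - d r)) j"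
    by blast
  have cd: "cycle_data n Xs K (ints s ''cycle'') q (ints s ''match0'') (ints s ''match1'')"
    using p by (simp add: prepared_def Let_def q)
  interpret D: cycle_data n Xs K "ints s ''cycle''" q "ints s ''match0''" "ints s ''match1''" by (rule cd)
  have lv: "listed_vector q s' r = \<delta>(r := 1 - \<delta> r)" if r: "r \<in> {1..q}" for r
  proof
    fix j show "listed_vector q s' r j = (\<delta>(r := 1 - \<delta> r)) j"
    proof (cases "j \<in> {1..q}")
      case True
      then show ?thesis using R(2)[OF r True] r by (simp add: listed_vector_def d_def)
    next
      case False
      then have "\<delta> j = undefined" using \<delta> unfolding vectors_def by (rule PiE_arb[rotated])
      then show ?thesis using False r by (auto simp: listed_vector_def)
    qed
  qed
  have bij: "bij_betw (listed_vector q s') {1..q} (exchange_nbhd q \<delta>)"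
    using exchange_nbhd_bij[OF \<delta>] bij_betw_cong[of "{1..q}" "listed_vector q s'"] lv by simp
  have "reals s' ''cost'' r = tour_cost n \<rho> (solution_of n Xs (reported_matching n s) (listed_vector q s' r))"
    if r: "r \<in> {1..q}" for r
  proof -
    have v: "listed_vector q s' r \<in> vectors q" using bij r by (auto simp: bij_betw_def exchange_nbhd_def)
    have "solution_of n Xs (reported_matching n s) (listed_vector q s' r) = D.sel (listed_vector q s' r)"
      by (rule D.solution_of_eq[OF _ v]) (use prepared_reported[OF p] q in simp)
    moreover have "table_sum s (d(r := 1 - d r)) = tour_cost n \<rho> (D.sel (listed_vector q s' r))"
      using v r by (intro prepared_table_sum[OF p]) (auto simp: q[symmetric] lv d_def)
    ultimately show ?thesis using R(1)[OF r] ts by simp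
  qed
  then have "lists_nbhd n Xs \<rho> (reported_matching n s) \<delta> s'"
    using bij by (simp add: lists_nbhd_def Let_def D.num_cycles_eq c)
  then show ?thesis using t unfolding sd_def by blast
qed

text \<open>The cycle structure does not depend on the weights, so a run of the preprocessing with
  all weights zero serves as an existence proof for it.\<close>

lemma card_solutions_ge: "2 ^ num_cycles n (bip_edges n Xs) \<le> card (solutions n Xs)"
proof -
  from runs_exec[OF preprocess_runs] obtain K s where "prepared (\<lambda>_ _. 0) K s" by blast
  then have cd: "cycle_data n Xs K (ints s ''cycle'') (ints s ''q'' 0) (ints s ''match0'') (ints s ''match1'')"
    by (simp add: prepared_def Let_def)
  show ?thesis using cycle_data.card_solutions[OF cd] unfolding cycle_data.num_cycles_eq[OF cd] .
qed

end

section \<open>The time bounds and the limit of the proportion\<close>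

lemma enumerates_exchange_mono:
  assumes "enumerates_exchange p e n Xs \<rho> T1 T2" "T1 \<le> T1'" "T2 \<le> T2'"
  shows "enumerates_exchange p e n Xs \<rho> T1' T2'"
  unfolding enumerates_exchange_def
  using assms(1)[unfolded enumerates_exchange_def] assms(2,3) by (meson order_trans)

lemma enumerates_exchange:
  assumes n: "2 \<le> n" and X: "feasible n Xs"
  shows "enumerates_exchange preprocess list_neighbors n Xs \<rho>
         (2000 * (real n + (real (num_cycles n (bip_edges n Xs)))\<^sup>2))
         (2000 * (1 + (real (num_cycles n (bip_edges n Xs)))\<^sup>2))"
  unfolding enumerates_exchange_def
proof (intro allI impI)
  fix a b assume "\<forall>i\<in>{1..n}. Xs i = {a i, b i}"
  then interpret tsp_instance n Xs a b using n X by unfold_locales auto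
  from runs_exec[OF preprocess_runs[of \<rho>]] obtain t s K where
    s: "exec preprocess (input_memory n a b \<rho>) t s" "t \<le> 2000 * n" "prepared \<rho> K s" by blast
  define q where "q = ints s ''q'' 0"
  have cd: "cycle_data n Xs K (ints s ''cycle'') q (ints s ''match0'') (ints s ''match1'')"
    using s(3) by (simp add: prepared_def Let_def q_def)
  interpret D: cycle_data n Xs K "ints s ''cycle''" q "ints s ''match0''" "ints s ''match1''" by (rule cd)
  have nq: "num_cycles n (bip_edges n Xs) = q" by (rule D.num_cycles_eq)
  have "cycle_numbering n (bip_edges n Xs) (reported_matching n s)"
    by (rule D.cycle_numbering) (use prepared_reported[OF s(3)] in \<open>simp add: q_def\<close>)
  then have rep: "reports_numbering n (bip_edges n Xs) s" by (simp add: reports_numbering_def nq q_def)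
  have t: "real t \<le> 2000 * (real n + (real q)\<^sup>2)"
  proof -
    have "real t \<le> 2000 * real n" using s(2) by (metis of_nat_le_iff of_nat_mult of_nat_numeral)
    also have "\<dots> \<le> 2000 * (real n + (real q)\<^sup>2)" by simp
    finally show ?thesis .
  qed
  have "\<exists>t2 s'. exec list_neighbors (load_vector q \<delta> s) t2 s' \<and> real t2 \<le> 2000 * (1 + (real q)\<^sup>2) \<and>
      lists_nbhd n Xs \<rho> (reported_matching n s) \<delta> s'" if \<delta>: "\<delta> \<in> vectors q" for \<delta>
  proof -
    obtain t2 s' where e: "exec list_neighbors (load_vector q \<delta> s) t2 s'" "t2 \<le> 2000 * (1 + q * q)"
      "lists_nbhd n Xs \<rho> (reported_matching n s) \<delta> s'"
      using prepared_enumerate[OF s(3) q_def \<delta>] by blast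
    have "real t2 \<le> real (2000 * (1 + q * q))" using e(2) by (simp only: of_nat_le_iff)
    also have "\<dots> = 2000 * (1 + (real q)\<^sup>2)" by (simp add: power2_eq_square)
    finally show ?thesis using e by blast
  qed
  then show "\<exists>t1 s. exec preprocess (input_memory n a b \<rho>) t1 s \<and>
      real t1 \<le> 2000 * (real n + (real (num_cycles n (bip_edges n Xs)))\<^sup>2) \<and>
      reports_numbering n (bip_edges n Xs) s \<and>
      (\<forall>\<delta>\<in>vectors (num_cycles n (bip_edges n Xs)). \<exists>t2 s'.
        exec list_neighbors (load_vector (num_cycles n (bip_edges n Xs)) \<delta> s) t2 s' \<and>
        real t2 \<le> 2000 * (1 + (real (num_cycles n (bip_edges n Xs)))\<^sup>2) \<and>
        lists_nbhd n Xs \<rho> (reported_matching n s) \<delta> s')"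
    unfolding nq using s(1) t rep by (intro exI[of _ t] exI[of _ s]) simp
qed

text \<open>The verification of the program speaks of presented instances; the counting argument
  speaks of graphs and has to choose a presentation.\<close>

lemma feasible_presentation:
  assumes "feasible n Xs"
  shows "\<exists>a b. \<forall>i\<in>{1..n}. Xs i = {a i, b i}"
proof -
  obtain f where "f \<in> solutions n Xs" using assms by (auto simp: feasible_def)
  from solution_pair_instance[OF assms this] obtain g where "bip_edges n Xs = bip_edges n (pair_instance f g)" by blast
  then have "\<forall>i\<in>{1..n}. Xs i = {f i, g (f i)}" by (simp add: bip_edges_eq_iff pair_instance_def)
  then show ?thesis by (intro exI[of _ f] exI[of _ "\<lambda>i. g (f i)"])
qed

lemma card_solutions_feasible:
  assumes "2 \<le> n" "feasible n Xs"
  shows "2 ^ num_cycles n (bip_edges n Xs) \<le> card (solutions n Xs)"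
proof -
  obtain a b where "\<forall>i\<in>{1..n}. Xs i = {a i, b i}" using feasible_presentation[OF assms(2)] by blast
  then interpret tsp_instance n Xs a b using assms by unfold_locales auto
  show ?thesis by (rule card_solutions_ge)
qed

lemma few_cycles_proportion:
  assumes n: "2 \<le> n"
  shows "1 - 1 / real n \<le>
    real (card {E \<in> feasible_graphs n. real (num_cycles n E) \<le> 2 * log 2 (real n)}) / real (card (feasible_graphs n))"
proof -
  define m where "m = nat \<lceil>2 * log 2 (real n)\<rceil>"
  define A where "A = {E \<in> feasible_graphs n. real (num_cycles n E) \<le> 2 * log 2 (real n)}"
  define B where "B = {E \<in> feasible_graphs n. m \<le> num_cycles n E}"
  let ?F = "card (feasible_graphs n)"
  have "0 \<le> log 2 (real n)" using n by (intro zero_le_log_cancel_iff[THEN iffD2]) auto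
  then have l0: "0 \<le> 2 * log 2 (real n)" by linarith
  have "feasible_graphs n - B \<subseteq> A"
  proof
    fix E assume E: "E \<in> feasible_graphs n - B"
    then have "num_cycles n E < m" by (auto simp: B_def not_le)
    then have "real (num_cycles n E) < 2 * log 2 (real n)" unfolding m_def by linarith
    then show "E \<in> A" using E by (simp add: A_def)
  qed
  then have "feasible_graphs n \<subseteq> A \<union> B" by blast
  then have "?F \<le> card (A \<union> B)" using finite_feasible_graphs by (intro card_mono) (auto simp: A_def B_def)
  then have F: "?F \<le> card A + card B" using card_Un_le le_trans by blast
  have "2 powr (2 * log 2 (real n)) = (2 powr log 2 (real n)) powr 2" by (simp add: powr_powr mult.commute)
  also have "2 powr log 2 (real n) = real n" using n by (intro powr_log_cancel) auto
  also have "real n powr 2 = real n ^ 2" using n by (intro powr_numeral) auto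
  finally have "real n ^ 2 = 2 powr (2 * log 2 (real n))" ..
  also have "\<dots> \<le> 2 powr real m" using l0 unfolding m_def by (intro powr_mono) linarith+
  also have "\<dots> = 2 ^ m" by (simp add: powr_realpow)
  finally have "real n ^ 2 \<le> 2 ^ m" .
  then have "real n ^ 2 * real (card B) \<le> 2 ^ m * real (card B)" by (rule mult_right_mono) simp
  also have "\<dots> = real (2 ^ m * card B)" by simp
  also have "\<dots> \<le> real (n * ?F)"
    using card_many_cycles[of n m] card_solutions_feasible[OF n] n by (simp only: of_nat_le_iff B_def)
  finally have "real n * (real n * real (card B)) \<le> real n * real ?F" by (simp add: power2_eq_square)
  then have "real n * real (card B) \<le> real ?F" using n by simp
  then have B: "real (card B) \<le> real ?F / real n" using n by (simp add: field_simps)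
  have pos: "0 < real ?F" using card_feasible_graphs_pos[of n] n by simp
  have "real ?F - real ?F / real n \<le> real (card A)" using B F by linarith
  then have "(real ?F - real ?F / real n) / real ?F \<le> real (card A) / real ?F" using pos by (intro divide_right_mono) auto
  moreover have "(real ?F - real ?F / real n) / real ?F = 1 - 1 / real n" using pos by (simp add: diff_divide_distrib)
  ultimately show ?thesis by (simp add: A_def)
qed

lemma ratio_le_1: "a \<le> b \<Longrightarrow> real a / real b \<le> 1"
  by (cases "b = 0") (auto simp: divide_le_eq)

text \<open>Since ln 2 is at least 1/2, log 2 n is at most 2 ln n, so q is at most 4 ln n. From n =
  3 on, ln n is at least 1 and the summand 1 is absorbed too, which gives 2000 (1 + 16) =
  34000.\<close>

lemma logarithmic_bound:
  assumes n: "3 \<le> n" and q: "real q \<le> 2 * log 2 (real n)"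
  shows "2000 * (1 + (real q)\<^sup>2) \<le> 34000 * (ln (real n))\<^sup>2"
proof -
  have "exp 1 \<le> real n" using exp_le n by linarith
  then have l1: "1 \<le> ln (real n)" using n by (simp add: ln_ge_iff)
  have "1 / 2 \<le> ln (2::real)" using ln_2_less_1 ln_le_minus_one[of "1/2::real"] by (simp add: ln_div)
  then have "log 2 (real n) \<le> 2 * ln (real n)" using l1 by (simp add: log_def field_simps)
  then have "real q \<le> 4 * ln (real n)" using q by linarith
  then have "(real q)\<^sup>2 \<le> (4 * ln (real n))\<^sup>2" by (rule power_mono) simp
  moreover have "1 \<le> (ln (real n))\<^sup>2" using l1 by simp
  ultimately show ?thesis by (simp add: power_mult_distrib)
qed

theorem mainTheorem3:
  shows "\<exists>prep enum C.
    (\<forall>n Xs \<rho>. 2 \<le> n \<longrightarrow> feasible n Xs \<longrightarrow> weights n \<rho> \<longrightarrow>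
       enumerates_exchange prep enum n Xs \<rho>
         (C * (real n + (real (num_cycles n (bip_edges n Xs)))\<^sup>2))
         (C * (1 + (real (num_cycles n (bip_edges n Xs)))\<^sup>2))) \<and>
    (\<exists>C'. (\<lambda>n. real (card {E \<in> feasible_graphs n.
              \<forall>Xs \<rho>. feasible n Xs \<longrightarrow> bip_edges n Xs = E \<longrightarrow> weights n \<rho> \<longrightarrow>
                enumerates_exchange prep enum n Xs \<rho>
                  (C * (real n + (real (num_cycles n E))\<^sup>2)) (C' * (ln (real n))\<^sup>2)})
            / real (card (feasible_graphs n))) \<longlonglongrightarrow> 1)"
proof (rule exI[of _ preprocess], rule exI[of _ list_neighbors], rule exI[of _ 2000], intro conjI exI[of _ 34000])
  show "\<forall>n Xs \<rho>. 2 \<le> n \<longrightarrow> feasible n Xs \<longrightarrow> weights n \<rho> \<longrightarrow>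
       enumerates_exchange preprocess list_neighbors n Xs \<rho>
         (2000 * (real n + (real (num_cycles n (bip_edges n Xs)))\<^sup>2))
         (2000 * (1 + (real (num_cycles n (bip_edges n Xs)))\<^sup>2))"
    using enumerates_exchange by blast
  let ?G = "\<lambda>n. {E \<in> feasible_graphs n. \<forall>Xs \<rho>. feasible n Xs \<longrightarrow> bip_edges n Xs = E \<longrightarrow> weights n \<rho> \<longrightarrow>
       enumerates_exchange preprocess list_neighbors n Xs \<rho>
         (2000 * (real n + (real (num_cycles n E))\<^sup>2)) (34000 * (ln (real n))\<^sup>2)}"
  let ?A = "\<lambda>n. {E \<in> feasible_graphs n. real (num_cycles n E) \<le> 2 * log 2 (real n)}"
  have sub: "?A n \<subseteq> ?G n" if n: "3 \<le> n" for n
  proof -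
    have "enumerates_exchange preprocess list_neighbors n Xs \<rho>
         (2000 * (real n + (real (num_cycles n (bip_edges n Xs)))\<^sup>2)) (34000 * (ln (real n))\<^sup>2)"
      if "feasible n Xs" "real (num_cycles n (bip_edges n Xs)) \<le> 2 * log 2 (real n)" for Xs \<rho>
      using enumerates_exchange_mono[OF enumerates_exchange order_refl logarithmic_bound[OF n]] that n by simp
    then show ?thesis by blast
  qed
  show "(\<lambda>n. real (card (?G n)) / real (card (feasible_graphs n))) \<longlonglongrightarrow> 1"
  proof (rule tendsto_sandwich)
    show "\<forall>\<^sub>F n in sequentially. 1 - 1 / real n \<le> real (card (?G n)) / real (card (feasible_graphs n))"
      using eventually_ge_at_top[of 3]
    proof eventually_elim
      case (elim n)
      have "1 - 1 / real n \<le> real (card (?A n)) / real (card (feasible_graphs n))"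
        using few_cycles_proportion[of n] elim by simp
      also have "\<dots> \<le> real (card (?G n)) / real (card (feasible_graphs n))"
        using card_mono[OF _ sub[OF elim]] finite_feasible_graphs by (intro divide_right_mono) auto
      finally show ?case .
    qed
    show "\<forall>\<^sub>F n in sequentially. real (card (?G n)) / real (card (feasible_graphs n)) \<le> 1"
    proof (rule always_eventually, rule allI)
      fix n
      have "card (?G n) \<le> card (feasible_graphs n)" using finite_feasible_graphs by (intro card_mono) auto
      then show "real (card (?G n)) / real (card (feasible_graphs n)) \<le> 1" by (rule ratio_le_1)
    qed
    show "(\<lambda>n. 1 - 1 / real n) \<longlonglongrightarrow> 1"
      using tendsto_diff[OF tendsto_const lim_1_over_n, of 1] by simp
  qed simp
qed

end
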